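(* For $k\in\mathbb{N}$, the vectors $\langle\xi,\mathfrak{f}_1\rangle^k\,I[1]$ are highest weight vectors of weight $\left(k+\frac12,\frac12,\dots,\frac12\right)$ under the $L$-action, i.e. the action of the maximal torus $\mathbb{T}$ of $\mathrm{Spin}(m)$ on them is given by $$L(s)\,\langle\xi,\mathfrak{f}_1\rangle^k\,I[1]=\exp\Big(i\big(k+\tfrac12\big)t_1+\tfrac{i}{2}\sum_{j=2}^n t_j\Big)\,\langle\xi,\mathfrak{f}_1\rangle^k\,I[1]$$ for all $s=\exp\big(\tfrac12(t_1R_2R_1+\dots+t_nR_{2n}R_{2n-1})\big)\in\mathbb{T}$.
   Context: Clifford algebra: $\mathbb{C}_{2m,0}$ is the complex Clifford algebra generated by $\mathbf{e}_j^{\pm}$, $j=1,\dots,m$ ($m\ge2$), with $\{\mathbf{e}_j^+,\mathbf{e}_k^+\}=\{\mathbf{e}_j^-,\mathbf{e}_k^-\}=0$, $\{\mathbf{e}_j^+,\mathbf{e}_k^-\}=\delta_{jk}$ ($\{a,b\}=ab+ba$); $e_j=\mathbf{e}_j^++\mathbf{e}_j^-$, $e_j^\perp=\mathbf{e}_j^+-\mathbf{e}_j^-$. Discrete functions are functions $f:\mathbb{Z}^m\to\mathbb{C}_{2m,0}$. With $\Delta_j^+f(x)=f(x+e_j)-f(x)$, $\Delta_j^-f(x)=f(x)-f(x-e_j)$ (in the argument $e_j$ denotes the $j$-th unit lattice vector), put $\partial_j=\mathbf{e}_j^+\Delta_j^++\mathbf{e}_j^-\Delta_j^-$. Basic polynomials: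 for $\alpha\in\mathbb{N}^m$, $\xi^\alpha[1]=\xi_1^{\alpha_1}\cdots\xi_m^{\alpha_m}[1]$ is the discrete function determined by $\xi^0[1]=1$, $\partial_j\,\xi^\alpha[1]=(-1)^{\alpha_1+\dots+\alpha_{j-1}}\alpha_j\,\xi^{\alpha-\epsilon_j}[1]$ ($\epsilon_j$ the $j$-th unit multi-index) and $\xi^\alpha[1](0)=0$ for $\alpha\ne0$. Discrete polynomials are the finite sums $f=\sum_\alpha\xi^\alpha[1]\,c_\alpha$, $c_\alpha\in\mathbb{C}_{2m,0}$ (with unique coefficients). The right $\mathbb{C}_{2m,0}$-linear operators $\xi_j,R_j$ on discrete polynomials are given by $\xi_j(\xi^\alpha[1])=(-1)^{\alpha_1+\dots+\alpha_{j-1}}\xi^{\alpha+\epsilon_j}[1]$ and $R_j(\xi^\alpha[1])=(-1)^{|\alpha|-\alpha_j}\xi^\alpha[1]\,e_j$. They satisfy $\{\xi_j,\xi_k\}=0$ ($j\neq k$), $\{R_j,R_k\}=2\delta_{jk}$, $R_j[1]=e_j$, $\{R_j,\xi_k\}=2R_j\xi_j\delta_{jk}$. Put $\xi=\sum_j\xi_j$ and $\langle X,Y\rangle=\frac12(XY+YX)$ for operators $X,Y$. $S_j$ is the reflection $f(x)\mapsto f(x_1,\dots,-x_j,\dots,x_m)$, and $S_je_j^\perp$ is the operator of left multiplication by $e_j^\perp$ followed by $S_j$; one has $\{S_je_j^\perp,S_ke_k^\perp\}=-2\delta_{jk}$, $\{R_j,S_ke_k^\perp\}=0$, and $S_je_j^\perp[c]=e_j^\perp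 c$, $R_j[c]=e_jc$ for constants $c$. Element $I$: let $n=\lfloor m/2\rfloor$ and, for $j=1,\dots,n$, $\mathfrak{f}_j=\frac12(R_{2j-1}-iR_{2j})$, $\mathfrak{f}_j^\dagger=\frac12(R_{2j-1}+iR_{2j})$, $\mathfrak{g}_j=\frac12(S_{2j-1}e_{2j-1}^\perp-i\,S_{2j}e_{2j}^\perp)$, $\mathfrak{g}_j^\dagger=-\frac12(S_{2j-1}e_{2j-1}^\perp+i\,S_{2j}e_{2j}^\perp)$, $I_j=\mathfrak{f}_j\mathfrak{f}_j^\dagger\mathfrak{g}_j\mathfrak{g}_j^\dagger$. Then $I=\prod_{j=1}^nI_j$ for $m$ even, and $I=\big(\prod_{j=1}^nI_j\big)R_mS_me_m^\perp$ for $m$ odd. $X[1]$ denotes the action of an operator $X$ on the constant function $1$. Spin group: $\mathbb{R}^1_m=\{\sum_j\omega_jR_j:\omega_j\in\mathbb{R}\}$, $S^{m-1}=\{\underline\omega\in\mathbb{R}^1_m:\underline\omega^2=1\}$; $\mathrm{Spin}(m)$ is the group of products of an even number of elements of $S^{m-1}$. The conjugation satisfies $\overline{R_j}=-R_j$, $\overline{ab}=\bar b\,\bar a$. The maximal torus is $\mathbb{T}=\{\exp(\frac12(t_1R_2R_1+\dots+t_nR_{2n}R_{2n-1})):t_j\in\mathbb{R}\}$. $L$-action: for $s\in\mathrm{Spin}(m)$ let $\eta=\bar s\,\xi\,s$, $\eta_j=\langle\eta,R_j\rangle R_j$. For $f=\sum_\alpha\xi^\alpha[1]c_\alpha$, $L(s)f=s\,f(\bar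 s\,\xi\,s)$, where $f(\bar s\,\xi\,s)=\sum_\alpha\eta_1^{\alpha_1}\cdots\eta_m^{\alpha_m}[1]\,c_\alpha$ and $s$ acts as an operator. *)

theory Defs
  imports "HOL-Analysis.Analysis"
begin

section \<open>The complex Clifford algebra\<close>

text \<open>
  The index set \<open>{1, \<dots>, m}\<close> is a finite linearly ordered type \<open>'n\<close> with \<open>m = CARD('n)\<close>.
  An element of the algebra is given by its \<open>4 ^ m\<close> complex coordinates with respect to the
  basis of ordered products of the generators \<open>Inl j\<close> (for \<open>e\<^sub>j\<close>, square \<open>1\<close>) and \<open>Inr j\<close>
  (for \<open>e\<^sub>j\<^sup>\<bottom>\<close>, square \<open>-1\<close>), the \<open>Inl\<close> generators coming first.
\<close>

typedef 'n cliff = "UNIV :: (('n + 'n) set \<Rightarrow> complex) set"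
  morphisms coeff Cliff ..

lemma coeff_Cliff [simp]: "coeff (Cliff c) = c"
  by (simp add: Cliff_inverse)

lemma cliff_eqI: "(\<And>A. coeff x A = coeff y A) \<Longrightarrow> x = y"
  by (metis coeff_inject ext)

text \<open>
  \<open>swap_neg a b\<close> says that the factor \<open>-1\<close> arises when \<open>a\<close> is moved past \<open>b\<close> into sorted
  position, or when the two coincide and the square is \<open>-1\<close>.
\<close>

fun swap_neg :: "'n::linorder + 'n \<Rightarrow> 'n + 'n \<Rightarrow> bool" where
  "swap_neg (Inl i) (Inl j) \<longleftrightarrow> j < i"
| "swap_neg (Inl i) (Inr j) \<longleftrightarrow> False"
| "swap_neg (Inr i) (Inl j) \<longleftrightarrow> True"
| "swap_neg (Inr i) (Inr j) \<longleftrightarrow> j \<le> i"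

definition blade_sign :: "('n::linorder + 'n) set \<Rightarrow> ('n + 'n) set \<Rightarrow> complex" where
  "blade_sign A B = (\<Prod>a\<in>A. \<Prod>b\<in>B. if swap_neg a b then - 1 else 1)"

definition blade :: "('n + 'n) set \<Rightarrow> 'n cliff" where
  "blade A = Cliff (\<lambda>B. if B = A then 1 else 0)"

definition scaleC :: "complex \<Rightarrow> 'n cliff \<Rightarrow> 'n cliff" (infixr "*\<^sub>C" 75) where
  "c *\<^sub>C x = Cliff (\<lambda>A. c * coeff x A)"

lemma coeff_scaleC [simp]: "coeff (c *\<^sub>C x) A = c * coeff x A"
  by (simp add: scaleC_def)

instantiation cliff :: (type) real_vector
begin

definition "0 = Cliff (\<lambda>_. 0)"
definition "x + y = Cliff (\<lambda>A. coeff x A + coeff y A)"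
definition "- x = Cliff (\<lambda>A. - coeff x A)"
definition "x - y = Cliff (\<lambda>A. coeff x A - coeff y A)"
definition "r *\<^sub>R x = of_real r *\<^sub>C x"

instance
  by standard
    (auto intro!: cliff_eqI simp: zero_cliff_def plus_cliff_def uminus_cliff_def
      minus_cliff_def scaleR_cliff_def algebra_simps)

end

lemma coeff_0 [simp]: "coeff 0 A = 0"
  and coeff_add [simp]: "coeff (x + y) A = coeff x A + coeff y A"
  and coeff_uminus [simp]: "coeff (- x) A = - coeff x A"
  and coeff_diff [simp]: "coeff (x - y) A = coeff x A - coeff y A"
  and coeff_scaleR [simp]: "coeff (r *\<^sub>R x) A = of_real r * coeff x A"
  by (simp_all add: zero_cliff_def plus_cliff_def uminus_cliff_def minus_cliff_def scaleR_cliff_def)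

lemma coeff_sum [simp]: "coeff (sum f S) A = (\<Sum>i\<in>S. coeff (f i) A)"
  by (induction S rule: infinite_finite_induct) auto

text \<open>
  The product is the bilinear extension of
  \<open>blade A * blade B = blade_sign A B *\<^sub>C blade (sym_diff A B)\<close>.
\<close>

instantiation cliff :: ("{finite, linorder}") ring_1
begin

definition "1 = (blade {} :: 'a cliff)"
definition "x * y = Cliff (\<lambda>C. \<Sum>A\<in>UNIV.
    blade_sign A (sym_diff A C) * coeff x A * coeff y (sym_diff A C))"

lemma sign_cancel:
  fixes h :: "'b \<Rightarrow> complex"
  assumes "finite A" "finite B" "\<And>x. h x * h x = 1"
  shows "prod h (sym_diff A B) = prod h A * prod h B"
proof -
  have sq: "prod h (A \<inter> B) * prod h (A \<inter> B) = 1"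
    using assms(3) by (simp add: prod.distrib [symmetric])
  have "prod h A = prod h (A - B) * prod h (A \<inter> B)"
    using prod.Int_Diff [OF assms(1), of h B] by (simp only: mult.commute)
  moreover have "prod h B = prod h (B - A) * prod h (A \<inter> B)"
    using prod.Int_Diff [OF assms(2), of h A] by (simp only: mult.commute Int_commute)
  moreover have "prod h (sym_diff A B) = prod h (A - B) * prod h (B - A)"
    using assms by (intro prod.union_disjoint) auto
  ultimately have "prod h A * prod h B = prod h (sym_diff A B) * (prod h (A \<inter> B) * prod h (A \<inter> B))"
    by (simp only: mult_ac)
  then show ?thesis
    by (simp only: sq mult_1_right)
qed

lemma blade_sign_diff_left:
  fixes A B C :: "('a + 'a) set"
  shows "blade_sign (sym_diff A B) C = blade_sign A C * blade_sign B C"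
  unfolding blade_sign_def
  by (rule sign_cancel) (auto simp: prod.distrib [symmetric] intro!: prod.neutral)

lemma blade_sign_diff_right:
  fixes A B C :: "('a + 'a) set"
  shows "blade_sign A (sym_diff B C) = blade_sign A B * blade_sign A C"
  unfolding blade_sign_def prod.distrib [symmetric]
  by (rule prod.cong [OF refl], rule sign_cancel) auto

lemma sum_sym_diff:
  fixes A :: "('a + 'a) set"
  shows "(\<Sum>B\<in>UNIV. g (sym_diff A B)) = (\<Sum>B\<in>UNIV. g B)"
proof -
  have "sym_diff A (sym_diff A B) = B" for B by blast
  then show ?thesis
    by (intro sum.reindex_bij_witness [where i = "\<lambda>B. sym_diff A B" and j = "\<lambda>B. sym_diff A B"])
      (simp_all only: UNIV_I)
qed

lemma coeff_mult:
  fixes x y :: "'a cliff"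
  shows "coeff (x * y) C = (\<Sum>A\<in>UNIV.
    blade_sign A (sym_diff A C) * coeff x A * coeff y (sym_diff A C))"
  by (simp add: times_cliff_def)

lemma blade_sign_empty [simp]: "blade_sign {} B = 1" "blade_sign A {} = 1"
  by (simp_all add: blade_sign_def)

lemma coeff_1: "coeff (1 :: 'a cliff) A = (if A = {} then 1 else 0)"
  by (simp add: one_cliff_def blade_def)

instance
proof
  fix x y z :: "'a cliff"
  show "x * y * z = x * (y * z)"
  proof (rule cliff_eqI)
    fix D
    let ?t = "\<lambda>A B. blade_sign A B * blade_sign A (sym_diff B (sym_diff A D))
      * blade_sign B (sym_diff B (sym_diff A D))
      * coeff x A * coeff y B * coeff z (sym_diff B (sym_diff A D))"
    have "coeff (x * y * z) D = (\<Sum>E\<in>UNIV. \<Sum>A\<in>UNIV. blade_sign E (sym_diff E D) *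
        (blade_sign A (sym_diff A E) * coeff x A * coeff y (sym_diff A E)) * coeff z (sym_diff E D))"
      by (simp add: coeff_mult sum_distrib_left sum_distrib_right)
    also have "\<dots> = (\<Sum>A\<in>UNIV. \<Sum>E\<in>UNIV. blade_sign E (sym_diff E D) *
        (blade_sign A (sym_diff A E) * coeff x A * coeff y (sym_diff A E)) * coeff z (sym_diff E D))"
      by (rule sum.swap)
    also have "\<dots> = (\<Sum>A\<in>UNIV. \<Sum>B\<in>UNIV. ?t A B)"
    proof (rule sum.cong [OF refl])
      fix A :: "('a + 'a) set"
      let ?g = "\<lambda>E. blade_sign E (sym_diff E D) *
        (blade_sign A (sym_diff A E) * coeff x A * coeff y (sym_diff A E)) * coeff z (sym_diff E D)"
      have "(\<Sum>E\<in>UNIV. ?g E) = (\<Sum>B\<in>UNIV. ?g (sym_diff A B))"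
        by (rule sum_sym_diff [symmetric])
      also have "\<dots> = (\<Sum>B\<in>UNIV. ?t A B)"
      proof (rule sum.cong [OF refl])
        fix B :: "('a + 'a) set"
        have 1: "sym_diff A (sym_diff A B) = B" "sym_diff (sym_diff A B) D = sym_diff B (sym_diff A D)"
          by auto
        show "?g (sym_diff A B) = ?t A B"
          unfolding 1 blade_sign_diff_left [of A B] by (simp only: mult_ac)
      qed
      finally show "(\<Sum>E\<in>UNIV. ?g E) = (\<Sum>B\<in>UNIV. ?t A B)" .
    qed
    also have "\<dots> = coeff (x * (y * z)) D"
    proof -
      have "blade_sign A (sym_diff A D)
          = blade_sign A B * blade_sign A (sym_diff B (sym_diff A D))" for A B :: "('a + 'a) set"
      proof -
        have "sym_diff A D = sym_diff B (sym_diff B (sym_diff A D))" by auto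
        then show ?thesis by (metis blade_sign_diff_right)
      qed
      then have "(\<Sum>B\<in>UNIV. ?t A B) = (\<Sum>B\<in>UNIV. blade_sign A (sym_diff A D) * coeff x A *
          (blade_sign B (sym_diff B (sym_diff A D)) * coeff y B * coeff z (sym_diff B (sym_diff A D))))"
        for A :: "('a + 'a) set"
        by (intro sum.cong [OF refl]) (simp only: mult_ac)
      then show ?thesis
        by (simp only: coeff_mult sum_distrib_left)
    qed
    finally show "coeff (x * y * z) D = coeff (x * (y * z)) D" .
  qed
  show "1 * x = x"
  proof (rule cliff_eqI)
    fix C
    have "coeff (1 * x) C = (\<Sum>A::('a + 'a) set\<in>UNIV. if A = {} then coeff x C else 0)"
      unfolding coeff_mult by (rule sum.cong) (auto simp: coeff_1)
    then show "coeff (1 * x) C = coeff x C" by simp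
  qed
  show "x * 1 = x"
  proof (rule cliff_eqI)
    fix C
    have "coeff (x * 1) C = (\<Sum>A::('a + 'a) set\<in>UNIV. if A = C then coeff x C else 0)"
      unfolding coeff_mult by (rule sum.cong) (auto simp: coeff_1)
    then show "coeff (x * 1) C = coeff x C" by simp
  qed
  show "(x + y) * z = x * z + y * z" "x * (y + z) = x * y + x * z"
    by (rule cliff_eqI, simp add: coeff_mult sum.distrib algebra_simps)+
  have "coeff (0 :: 'a cliff) {} \<noteq> coeff 1 {}" by (simp add: coeff_1)
  then show "(0 :: 'a cliff) \<noteq> 1" by metis
qed

end

text \<open>All norms on this finite-dimensional space are equivalent; the \<open>\<ell>\<^sup>1\<close> norm is submultiplicative.\<close>

instantiation cliff :: ("{finite, linorder}") real_normed_algebra_1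
begin

definition "norm (x :: 'a cliff) = (\<Sum>A\<in>UNIV. cmod (coeff x A))"
definition "dist (x :: 'a cliff) y = norm (x - y)"
definition "sgn (x :: 'a cliff) = x /\<^sub>R norm x"
definition "(uniformity :: ('a cliff \<times> 'a cliff) filter)
  = (INF e\<in>{0<..}. principal {(x, y). dist x y < e})"
definition "open (U :: 'a cliff set) \<longleftrightarrow>
  (\<forall>x\<in>U. eventually (\<lambda>(x', y). x' = x \<longrightarrow> y \<in> U) uniformity)"

lemma cmod_blade_sign: 
  fixes A B :: "('a + 'a) set"
  shows "cmod (blade_sign A B) = 1"
  unfolding blade_sign_def prod_norm [symmetric] by (auto intro!: prod.neutral)

instance
proof
  fix x y :: "'a cliff" and r :: real
  show "dist x y = norm (x - y)" by (rule dist_cliff_def)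
  show "sgn x = x /\<^sub>R norm x" by (rule sgn_cliff_def)
  show "(uniformity :: ('a cliff \<times> 'a cliff) filter)
    = (INF e\<in>{0<..}. principal {(x, y). dist x y < e})" by (rule uniformity_cliff_def)
  show "open U \<longleftrightarrow> (\<forall>x\<in>U. eventually (\<lambda>(x', y). x' = x \<longrightarrow> y \<in> U) uniformity)"
    for U :: "'a cliff set" by (rule open_cliff_def)
  show "norm x = 0 \<longleftrightarrow> x = 0"
    by (auto simp: norm_cliff_def sum_nonneg_eq_0_iff intro!: cliff_eqI)
  show "norm (x + y) \<le> norm x + norm y"
    unfolding norm_cliff_def sum.distrib [symmetric] coeff_add by (intro sum_mono norm_triangle_ineq)
  show "norm (r *\<^sub>R x) = \<bar>r\<bar> * norm x"
    by (simp add: norm_cliff_def norm_mult sum_distrib_left)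
  show "r *\<^sub>R x * y = r *\<^sub>R (x * y)" "x * r *\<^sub>R y = r *\<^sub>R (x * y)"
    by (rule cliff_eqI, simp add: coeff_mult sum_distrib_left mult_ac)+
  show "norm (1 :: 'a cliff) = 1"
  proof -
    have "norm (1 :: 'a cliff) = (\<Sum>A::('a + 'a) set\<in>UNIV. if A = {} then 1 else 0)"
      unfolding norm_cliff_def by (rule sum.cong) (auto simp: coeff_1)
    then show ?thesis by simp
  qed
  show "norm (x * y) \<le> norm x * norm y"
  proof -
    have "norm (x * y) \<le> (\<Sum>C\<in>UNIV. \<Sum>A\<in>UNIV. cmod (coeff x A) * cmod (coeff y (sym_diff A C)))"
      unfolding norm_cliff_def coeff_mult
      by (intro sum_mono order.trans [OF norm_sum]) (simp add: norm_mult cmod_blade_sign)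
    also have "\<dots> = (\<Sum>A\<in>UNIV. \<Sum>C\<in>UNIV. cmod (coeff x A) * cmod (coeff y (sym_diff A C)))"
      by (rule sum.swap)
    also have "\<dots> = norm x * norm y"
      unfolding norm_cliff_def sum_distrib_left [symmetric] sum_distrib_right
      by (simp only: sum_sym_diff [where g = "\<lambda>B. cmod (coeff y B)"])
    finally show ?thesis .
  qed
qed

end

lemma scaleC_mult [simp]:
  fixes x y :: "'n::{finite,linorder} cliff"
  shows "(c *\<^sub>C x) * y = c *\<^sub>C (x * y)" "x * (c *\<^sub>C y) = c *\<^sub>C (x * y)"
  by (rule cliff_eqI, simp add: coeff_mult sum_distrib_left mult_ac)+

lemma coeff_blade: "coeff (blade A) B = (if B = A then 1 else 0)"
  by (simp add: blade_def)

lemma scaleC_add: "c *\<^sub>C (x + y) = c *\<^sub>C x + c *\<^sub>C y"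
  and scaleC_diff: "c *\<^sub>C (x - y) = c *\<^sub>C x - c *\<^sub>C y"
  by (rule cliff_eqI, simp add: algebra_simps)+

lemma blade_mult:
  fixes A B :: "('n::{finite,linorder} + 'n) set"
  shows "blade A * blade B = blade_sign A B *\<^sub>C blade (sym_diff A B)"
proof (rule cliff_eqI)
  fix C
  have "coeff (blade A * blade B) C
      = (\<Sum>D\<in>UNIV. if D = A then (if sym_diff A C = B then blade_sign A B else 0) else 0)"
    unfolding coeff_mult by (rule sum.cong) (auto simp: blade_def)
  moreover have "sym_diff A C = B \<longleftrightarrow> C = sym_diff A B" by blast
  ultimately show "coeff (blade A * blade B) C = coeff (blade_sign A B *\<^sub>C blade (sym_diff A B)) C"
    by (simp add: blade_def)
qed

definition e_vec :: "'n::{finite,linorder} \<Rightarrow> 'n cliff" where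
  "e_vec j = blade {Inl j}"

definition e_perp :: "'n::{finite,linorder} \<Rightarrow> 'n cliff" where
  "e_perp j = blade {Inr j}"

definition e_plus :: "'n::{finite,linorder} \<Rightarrow> 'n cliff" where
  "e_plus j = (1/2) *\<^sub>C (e_vec j + e_perp j)"

definition e_minus :: "'n::{finite,linorder} \<Rightarrow> 'n cliff" where
  "e_minus j = (1/2) *\<^sub>C (e_vec j - e_perp j)"

text \<open>
  The algebra is generated by \<open>e_plus j\<close> and \<open>e_minus j\<close> (\<open>e_plus_minus_generate\<close>), which satisfy the
  defining relations of \<open>\<complex>\<^bsub>2m,0\<^esub>\<close>; since these force dimension at most \<open>4 ^ m\<close>, it is
  \<open>\<complex>\<^bsub>2m,0\<^esub>\<close>.
\<close>

lemma e_vec_eq: "e_vec j = e_plus j + e_minus j"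
  and e_perp_eq: "e_perp j = e_plus j - e_minus j"
  by (rule cliff_eqI, simp add: e_plus_def e_minus_def field_simps)+

lemma coeff_2: "coeff (2 :: 'n::{finite,linorder} cliff) A = (if A = {} then 2 else 0)"
  using coeff_add [of "1 :: 'n cliff" 1 A] by (simp add: coeff_1 split: if_splits)

lemma e_relations:
  fixes j k :: "'n::{finite,linorder}"
  shows "e_vec j * e_vec k + e_vec k * e_vec j = (if j = k then 2 else 0)"
    and "e_perp j * e_perp k + e_perp k * e_perp j = (if j = k then - 2 else 0)"
    and "e_vec j * e_perp k + e_perp k * e_vec j = 0"
proof -
  have D: "sym_diff {x} {y} = (if x = y then {} else {x, y})" for x y :: "'n + 'n" by auto
  have E: "coeff (blade A * blade B + blade B * blade A) C =
      (if C = sym_diff A B then blade_sign A B + blade_sign B A else 0)"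
    for A B C :: "('n + 'n) set"
  proof -
    have "sym_diff B A = sym_diff A B" by blast
    then show ?thesis
      by (simp only: blade_mult coeff_add coeff_scaleC coeff_blade split: if_splits) simp
  qed
  show "e_vec j * e_vec k + e_vec k * e_vec j = (if j = k then 2 else 0)"
    "e_perp j * e_perp k + e_perp k * e_perp j = (if j = k then - 2 else 0)"
    "e_vec j * e_perp k + e_perp k * e_vec j = 0"
    unfolding e_vec_def e_perp_def
    by (rule cliff_eqI, simp only: E D, cases j k rule: linorder_cases,
        (auto simp: coeff_2 blade_sign_def)[3])+
qed

lemma e_plus_minus_relations:
  fixes j k :: "'n::{finite,linorder}"
  shows "e_plus j * e_plus k + e_plus k * e_plus j = 0"
    and "e_minus j * e_minus k + e_minus k * e_minus j = 0"
    and "e_plus j * e_minus k + e_minus k * e_plus j = (if j = k then 1 else 0)"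
proof -
  let ?a = "e_vec j * e_vec k + e_vec k * e_vec j"
  let ?b = "e_perp j * e_perp k + e_perp k * e_perp j"
  let ?c = "e_vec j * e_perp k + e_perp k * e_vec j"
  let ?d = "e_vec k * e_perp j + e_perp j * e_vec k"
  have "e_plus j * e_plus k + e_plus k * e_plus j = (1/4) *\<^sub>C (?a + ?b + ?c + ?d)"
    "e_minus j * e_minus k + e_minus k * e_minus j = (1/4) *\<^sub>C (?a + ?b - ?c - ?d)"
    "e_plus j * e_minus k + e_minus k * e_plus j = (1/4) *\<^sub>C (?a - ?b - ?c + ?d)"
    unfolding e_plus_def e_minus_def
    by (simp_all only: scaleC_mult scaleC_add scaleC_diff ring_distribs, rule_tac [!] cliff_eqI)
      (simp_all add: field_simps)
  then show "e_plus j * e_plus k + e_plus k * e_plus j = 0"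
    "e_minus j * e_minus k + e_minus k * e_minus j = 0"
    "e_plus j * e_minus k + e_minus k * e_plus j = (if j = k then 1 else 0)"
    unfolding e_relations
    by (rule_tac [!] cliff_eqI) (simp_all add: coeff_1 coeff_2)
qed

lemma e_plus_minus_generate:
  fixes S :: "'n::{finite,linorder} cliff set"
  assumes "1 \<in> S" and gen: "\<And>j. e_plus j \<in> S" "\<And>j. e_minus j \<in> S"
    and scale: "\<And>c x. x \<in> S \<Longrightarrow> c *\<^sub>C x \<in> S"
    and add: "\<And>x y. x \<in> S \<Longrightarrow> y \<in> S \<Longrightarrow> x + y \<in> S"
    and mult: "\<And>x y. x \<in> S \<Longrightarrow> y \<in> S \<Longrightarrow> x * y \<in> S"
  shows "S = UNIV"
proof -
  have blade1: "blade {a} \<in> S" for a :: "'n + 'n"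
  proof (cases a)
    case (Inl j)
    then show ?thesis using e_vec_eq [of j] gen add by (simp add: e_vec_def)
  next
    case (Inr j)
    have "e_perp j = e_plus j + (- 1) *\<^sub>C e_minus j"
      by (rule cliff_eqI) (simp add: e_perp_eq)
    then show ?thesis using Inr gen add scale by (simp add: e_perp_def)
  qed
  have blade: "blade A \<in> S" for A :: "('n + 'n) set"
  proof (induction A rule: finite_induct [OF finite])
    case 1
    show ?case using \<open>1 \<in> S\<close> by (simp add: one_cliff_def)
  next
    case (2 a A)
    let ?s = "blade_sign {a} A"
    have "?s * ?s = 1"
      by (auto simp: blade_sign_def prod.distrib [symmetric] intro!: prod.neutral)
    moreover have "blade {a} * blade A = ?s *\<^sub>C blade (insert a A)"
      using 2 by (simp add: blade_mult)
    ultimately have "blade (insert a A) = ?s *\<^sub>C (blade {a} * blade A)"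
      by (intro cliff_eqI) (simp add: mult.assoc [symmetric])
    then show ?case using 2 blade1 mult scale by simp
  qed
  have zero: "0 \<in> S"
    using scale [OF \<open>1 \<in> S\<close>, of 0] by (simp add: scaleC_def zero_cliff_def)
  have "(\<Sum>A\<in>T. coeff x A *\<^sub>C blade A) \<in> S" for x :: "'n cliff" and T
    by (induction T rule: infinite_finite_induct) (auto intro: zero add scale blade)
  moreover have "(\<Sum>A\<in>UNIV. coeff x A *\<^sub>C blade A) = x" for x :: "'n cliff"
    by (rule cliff_eqI) (simp add: blade_def if_distrib cong: if_cong)
  ultimately show ?thesis by (metis UNIV_eq_I)
qed


section \<open>Discrete functions and discrete polynomials\<close>

type_synonym 'n dfun = "('n \<Rightarrow> int) \<Rightarrow> 'n cliff"
type_synonym 'n opr = "'n dfun \<Rightarrow> 'n dfun"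

definition fwd_diff :: "'n::{finite,linorder} \<Rightarrow> 'n opr" where
  "fwd_diff j f = (\<lambda>x. f (x(j := x j + 1)) - f x)"

definition bwd_diff :: "'n::{finite,linorder} \<Rightarrow> 'n opr" where
  "bwd_diff j f = (\<lambda>x. f x - f (x(j := x j - 1)))"

definition partial :: "'n::{finite,linorder} \<Rightarrow> 'n opr" where
  "partial j f = (\<lambda>x. e_plus j * fwd_diff j f x + e_minus j * bwd_diff j f x)"

text \<open>\<open>xi_poly \<alpha>\<close> is \<open>\<xi>\<^sup>\<alpha>[1]\<close>; the factor \<open>\<alpha> j\<close> vanishes where \<open>\<alpha> j - 1\<close> is truncated.\<close>

definition xi_poly :: "('n::{finite,linorder} \<Rightarrow> nat) \<Rightarrow> 'n dfun" where
  "xi_poly = (THE P.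
     P (\<lambda>_. 0) = (\<lambda>_. 1) \<and>
     (\<forall>\<alpha> j. partial j (P \<alpha>)
        = (\<lambda>x. (- 1) ^ (\<Sum>i | i < j. \<alpha> i) * of_nat (\<alpha> j) * P (\<alpha>(j := \<alpha> j - 1)) x)) \<and>
     (\<forall>\<alpha>. \<alpha> \<noteq> (\<lambda>_. 0) \<longrightarrow> P \<alpha> (\<lambda>_. 0) = 0))"

definition poly_of :: "(('n::{finite,linorder} \<Rightarrow> nat) \<Rightarrow> 'n cliff) \<Rightarrow> 'n dfun" where
  "poly_of c = (\<lambda>x. \<Sum>\<alpha> | c \<alpha> \<noteq> 0. xi_poly \<alpha> x * c \<alpha>)"

definition dpolys :: "'n::{finite,linorder} dfun set" where
  "dpolys = {poly_of c | c. finite {\<alpha>. c \<alpha> \<noteq> 0}}"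

definition poly_coeff :: "'n::{finite,linorder} dfun \<Rightarrow> ('n \<Rightarrow> nat) \<Rightarrow> 'n cliff" where
  "poly_coeff f = (THE c. finite {\<alpha>. c \<alpha> \<noteq> 0} \<and> f = poly_of c)"

text \<open>
  The right linear operator sending \<open>\<xi>\<^sup>\<alpha>[1]\<close> to \<open>T \<alpha>\<close>. It, and every operator built from it below,
  is meaningful on \<open>dpolys\<close> only.
\<close>

definition right_linear :: "(('n::{finite,linorder} \<Rightarrow> nat) \<Rightarrow> 'n dfun) \<Rightarrow> 'n opr" where
  "right_linear T f = (\<lambda>x. \<Sum>\<alpha> | poly_coeff f \<alpha> \<noteq> 0. T \<alpha> x * poly_coeff f \<alpha>)"


section \<open>Operators\<close>

definition xi :: "'n::{finite,linorder} \<Rightarrow> 'n opr" where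
  "xi j = right_linear (\<lambda>\<alpha> x. (- 1) ^ (\<Sum>i | i < j. \<alpha> i) * xi_poly (\<alpha>(j := \<alpha> j + 1)) x)"

definition R_op :: "'n::{finite,linorder} \<Rightarrow> 'n opr" where
  "R_op j = right_linear (\<lambda>\<alpha> x. (- 1) ^ (\<Sum>i | i \<noteq> j. \<alpha> i) * xi_poly \<alpha> x * e_vec j)"

definition S_perp :: "'n::{finite,linorder} \<Rightarrow> 'n opr" where
  "S_perp j f = (\<lambda>x. e_perp j * f (x(j := - x j)))"

definition xi_sum :: "'n::{finite,linorder} opr" where
  "xi_sum f = (\<lambda>x. \<Sum>j\<in>UNIV. xi j f x)"

definition bracket :: "'n opr \<Rightarrow> 'n opr \<Rightarrow> 'n opr" where
  "bracket X Y f = (\<lambda>x. (1/2) *\<^sub>C (X (Y f) x + Y (X f) x))"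

text \<open>\<open>nth_index j\<close> is the \<open>j\<close>-th element of \<open>'n\<close>, for \<open>1 \<le> j \<le> m\<close>.\<close>

definition nth_index :: "nat \<Rightarrow> 'n::{finite,linorder}" where
  "nth_index j = sorted_list_of_set UNIV ! (j - 1)"

definition f_op :: "nat \<Rightarrow> 'n::{finite,linorder} opr" where
  "f_op j f = (\<lambda>x. (1/2) *\<^sub>C (R_op (nth_index (2*j - 1)) f x - \<i> *\<^sub>C R_op (nth_index (2*j)) f x))"

definition f_dag :: "nat \<Rightarrow> 'n::{finite,linorder} opr" where
  "f_dag j f = (\<lambda>x. (1/2) *\<^sub>C (R_op (nth_index (2*j - 1)) f x + \<i> *\<^sub>C R_op (nth_index (2*j)) f x))"

definition g_op :: "nat \<Rightarrow> 'n::{finite,linorder} opr" where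
  "g_op j f = (\<lambda>x. (1/2) *\<^sub>C
     (S_perp (nth_index (2*j - 1)) f x - \<i> *\<^sub>C S_perp (nth_index (2*j)) f x))"

definition g_dag :: "nat \<Rightarrow> 'n::{finite,linorder} opr" where
  "g_dag j f = (\<lambda>x. - (1/2) *\<^sub>C
     (S_perp (nth_index (2*j - 1)) f x + \<i> *\<^sub>C S_perp (nth_index (2*j)) f x))"

definition I_factor :: "nat \<Rightarrow> 'n::{finite,linorder} opr" where
  "I_factor j = f_op j \<circ> f_dag j \<circ> g_op j \<circ> g_dag j"

definition I_op :: "'n::{finite,linorder} opr" where
  "I_op = foldr (\<circ>) (map I_factor [1..<CARD('n) div 2 + 1])
     (if even CARD('n) then id
      else R_op (nth_index CARD('n)) \<circ> S_perp (nth_index CARD('n)))"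


section \<open>The torus and the L-action\<close>

definition op_exp :: "'n::{finite,linorder} opr \<Rightarrow> 'n opr" where
  "op_exp X f = (\<lambda>x. \<Sum>k. (1 / fact k) *\<^sub>R (X ^^ k) f x)"

definition torus_elt :: "(nat \<Rightarrow> real) \<Rightarrow> 'n::{finite,linorder} opr" where
  "torus_elt t = op_exp (\<lambda>f x. (1/2) *\<^sub>R
     (\<Sum>j = 1..CARD('n) div 2. t j *\<^sub>R R_op (nth_index (2*j)) (R_op (nth_index (2*j - 1)) f) x))"

text \<open>
  Conjugation on the real algebra generated by the \<open>R_op j\<close>, which contains \<open>Spin(m)\<close>: an element is
  expanded in the basis of ordered products \<open>R_blade A\<close>, and
  \<open>R_op a\<^sub>1 \<circ> \<dots> \<circ> R_op a\<^sub>k\<close> has conjugate \<open>(-1)\<^sup>k R_op a\<^sub>k \<circ> \<dots> \<circ> R_op a\<^sub>1\<close>.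
\<close>

definition R_blade :: "'n::{finite,linorder} set \<Rightarrow> 'n opr" where
  "R_blade A = foldr (\<circ>) (map R_op (sorted_list_of_set A)) id"

definition R_blade_rev :: "'n::{finite,linorder} set \<Rightarrow> 'n opr" where
  "R_blade_rev A = foldr (\<circ>) (map R_op (rev (sorted_list_of_set A))) id"

definition op_coeff :: "'n::{finite,linorder} opr \<Rightarrow> 'n set \<Rightarrow> real" where
  "op_coeff s = (THE c. \<forall>f\<in>dpolys. s f = (\<lambda>x. \<Sum>A\<in>UNIV. c A *\<^sub>R R_blade A f x))"

definition op_conj :: "'n::{finite,linorder} opr \<Rightarrow> 'n opr" where
  "op_conj s f = (\<lambda>x. \<Sum>A\<in>UNIV. (op_coeff s A * (- 1) ^ card A) *\<^sub>R R_blade_rev A f x)"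

definition eta :: "'n::{finite,linorder} opr \<Rightarrow> 'n opr" where
  "eta s = op_conj s \<circ> xi_sum \<circ> s"

definition eta_comp :: "'n::{finite,linorder} opr \<Rightarrow> 'n \<Rightarrow> 'n opr" where
  "eta_comp s j = bracket (eta s) (R_op j) \<circ> R_op j"

definition op_monomial :: "('n::{finite,linorder} \<Rightarrow> 'n opr) \<Rightarrow> ('n \<Rightarrow> nat) \<Rightarrow> 'n opr" where
  "op_monomial X \<alpha> = foldr (\<circ>) (map (\<lambda>j. X j ^^ \<alpha> j) (sorted_list_of_set UNIV)) id"

definition L_action :: "'n::{finite,linorder} opr \<Rightarrow> 'n opr" where
  "L_action s f = s (right_linear (\<lambda>\<alpha>. op_monomial (eta_comp s) \<alpha> (\<lambda>_. 1)) f)"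

definition hw_vector :: "nat \<Rightarrow> 'n::{finite,linorder} dfun" where
  "hw_vector k = (bracket xi_sum (f_op 1) ^^ k) (I_op (\<lambda>_. 1))"

end

theory Submission
  imports Defs
begin

text \<open>
  The operators \<open>u\<^sub>j = R\<^sub>j \<xi>\<^sub>j\<close> commute with each other and with all \<open>R\<^sub>k\<close>. Expanding discrete polynomials
  in \<open>u\<^sup>\<alpha>[1]\<close> instead of \<open>\<xi>\<^sup>\<alpha>[1]\<close> thus removes all signs: polynomials become finitely supported
  coefficient families, \<open>R\<^sub>j\<close> and the torus act by left multiplication with \<open>e\<^sub>j\<close> and with
  \<open>exp B\<close>, where \<open>B = \<Sum>\<^sub>j (t\<^sub>j / 2) e\<^sub>2\<^sub>j e\<^sub>2\<^sub>j\<^sub>-\<^sub>1\<close>, and \<open>\<langle>\<xi>, \<ff>\<^sub>1\<rangle> = (u\<^sub>1 - \<i> u\<^sub>2) / 2\<close>. The substitution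
  \<open>\<xi> \<mapsto> s\<^sup>-\<^sup>1 \<xi> s\<close> rotates \<open>(u\<^sub>1, u\<^sub>2)\<close> by the angle \<open>t\<^sub>1\<close>, so it multiplies \<open>u\<^sub>1 - \<i> u\<^sub>2\<close> by
  \<open>exp (\<i> t\<^sub>1)\<close>; and since \<open>e\<^sub>2\<^sub>j e\<^sub>2\<^sub>j\<^sub>-\<^sub>1 I[1] = \<i> I[1]\<close>, the factor \<open>s\<close> contributes
  \<open>exp (\<i> / 2 \<Sum>\<^sub>j t\<^sub>j)\<close>.
\<close>

section \<open>Scalars and generators\<close>

text \<open>R_j commutes with its own xi_j and anticommutes with the other xi_k; this is why the u_j
  commute, and since R_j squares to 1 it gives xi_j = R_j u_j. Hence eta is the sum over l of u_l
  times exp(-B) e_l exp(B). Its bracket with R_k is half the anticommutator of e_l with exp(B) e_k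
  exp(-B), conjugated by exp(B), and so a scalar: an entry of the rotation matrix. The vectors in
  question involve only u_1 and u_2, so one plane rotation has to be computed.

  Three objects are given by definite descriptions: the basic polynomials, the coefficients of a
  polynomial, and the coefficients of an operator in the products of the R_j. Each needs existence
  and uniqueness before it can be evaluated; the last also requires exp(B) to be a real combination
  of products of the e_j.

  A weight vector has to be nonzero. The constant I[1] arises by applying half-projections to an
  invertible element, and none of them can annihilate: each is conjugate to its complement by an
  element commuting with everything to its right.\<close>

lemma scaleC_0_right [simp]: "c *\<^sub>C 0 = 0"
  and scaleC_0_left [simp]: "0 *\<^sub>C x = 0"
  and scaleC_1 [simp]: "1 *\<^sub>C x = x"
  and scaleC_scaleC [simp]: "a *\<^sub>C b *\<^sub>C x = (a * b) *\<^sub>C x"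
  and scaleC_minus_right [simp]: "c *\<^sub>C (- x) = - (c *\<^sub>C x)"
  and scaleC_minus_left [simp]: "(- c) *\<^sub>C x = - (c *\<^sub>C x)"
  and scaleC_add_left: "(a + b) *\<^sub>C x = a *\<^sub>C x + b *\<^sub>C x"
  and scaleR_eq_scaleC: "r *\<^sub>R x = of_real r *\<^sub>C x"
  by (auto intro!: cliff_eqI simp: algebra_simps)

lemma scaleC_sum: "c *\<^sub>C sum f A = (\<Sum>i\<in>A. c *\<^sub>C f i)"
  by (rule cliff_eqI) (simp add: sum_distrib_left)

lemma scaleC_cancel: "c *\<^sub>C x = 0 \<longleftrightarrow> c = 0 \<or> x = 0"
proof
  assume h: "c *\<^sub>C x = 0"
  show "c = 0 \<or> x = 0"
  proof (rule ccontr)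
    assume "\<not> ?thesis"
    then have "c \<noteq> 0" "x \<noteq> 0" by auto
    moreover have "inverse c *\<^sub>C c *\<^sub>C x = 0" by (simp only: h scaleC_0_right)
    ultimately show False by simp
  qed
qed auto

lemma double_eq: "x + x = (y::'a::real_vector) + y \<Longrightarrow> x = y"
  by (metis scaleR_half_double)

context
  fixes j k :: "'n::{finite,linorder}"
begin

lemma e_vec_sq: "e_vec j * e_vec j = 1"
  using e_relations(1) [of j j] by (rule_tac double_eq) simp

lemma e_perp_sq: "e_perp j * e_perp j = - 1"
  using e_relations(2) [of j j] by (rule_tac double_eq) simp

lemma e_vec_anticomm: "j \<noteq> k \<Longrightarrow> e_vec j * e_vec k = - (e_vec k * e_vec j)"
  using e_relations(1) [of j k] by (simp add: eq_neg_iff_add_eq_0)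

lemma e_perp_anticomm: "j \<noteq> k \<Longrightarrow> e_perp j * e_perp k = - (e_perp k * e_perp j)"
  using e_relations(2) [of j k] by (simp add: eq_neg_iff_add_eq_0)

lemma e_vec_e_perp_anticomm: "e_vec j * e_perp k = - (e_perp k * e_vec j)"
  using e_relations(3) [of j k] by (simp add: eq_neg_iff_add_eq_0)

lemma e_plus_sq: "e_plus j * e_plus j = 0"
  using e_plus_minus_relations(1) [of j j] by (rule_tac double_eq) simp

lemma e_minus_sq: "e_minus j * e_minus j = 0"
  using e_plus_minus_relations(2) [of j j] by (rule_tac double_eq) simp

lemma e_plus_minus_sum: "e_plus j * e_minus j + e_minus j * e_plus j = 1"
  using e_plus_minus_relations(3) [of j j] by simp

lemma e_plus_minus_anticomm:
  assumes "j \<noteq> k"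
  shows "e_plus j * e_plus k = - (e_plus k * e_plus j)"
    "e_minus j * e_minus k = - (e_minus k * e_minus j)"
    "e_plus j * e_minus k = - (e_minus k * e_plus j)"
    "e_minus j * e_plus k = - (e_plus k * e_minus j)"
  using assms e_plus_minus_relations [of j k] e_plus_minus_relations [of k j]
  by (simp_all add: eq_neg_iff_add_eq_0 add.commute)

end

section \<open>Signs from reordering products\<close>

lemma minus_one_power_commute: "(- 1) ^ n * x = x * (- 1 :: 'a::ring_1) ^ n"
  by (cases "even n") auto

lemma of_nat_mult_left_commute: "a * (of_nat n * b) = of_nat n * (a * (b::'a::ring_1))"
  by (metis mult.assoc mult_of_nat_commute)

lemma prod_list_pass:
  fixes a :: "'a::ring_1"
  assumes "\<And>i. i \<in> set l \<Longrightarrow> a * F i = (- 1) ^ n i * (F i * a)"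
  shows "a * prod_list (map F l) = (- 1) ^ sum_list (map n l) * (prod_list (map F l) * a)"
  using assms
proof (induction l)
  case (Cons i l)
  have "a * prod_list (map F (i # l)) = (a * F i) * prod_list (map F l)"
    by (simp add: mult.assoc)
  also have "\<dots> = (- 1) ^ n i * (F i * (a * prod_list (map F l)))"
    using Cons.prems [of i] by (simp add: mult.assoc)
  also have "\<dots> = (- 1) ^ n i * (F i * ((- 1) ^ sum_list (map n l) * (prod_list (map F l) * a)))"
    using Cons by simp
  also have "\<dots> = (- 1) ^ n i * ((- 1) ^ sum_list (map n l) * (F i * (prod_list (map F l) * a)))"
    by (metis minus_one_power_commute mult.assoc)
  finally show ?case by (simp add: power_add mult.assoc)
qed simp

text \<open>Cuts an ordered product at its factor with index j: updates at j leave the two outer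
  pieces unchanged, and signs come from the indices on one side of j.\<close>

lemma sorted_UNIV_split:
  fixes j :: "'n::{finite,linorder}"
  obtains l1 l2 where "sorted_list_of_set UNIV = l1 @ j # l2"
    "set l1 = {i. i < j}" "set l2 = {i. j < i}" "distinct l1" "distinct l2"
proof -
  let ?l = "sorted_list_of_set (UNIV :: 'n set)"
  have "j \<in> set ?l" by simp
  then obtain l1 l2 where l: "?l = l1 @ j # l2" by (meson split_list)
  have "sorted_wrt (<) (l1 @ j # l2)" unfolding l [symmetric] by (rule strict_sorted_list_of_set)
  then have s: "\<forall>i\<in>set l1. i < j" "\<forall>i\<in>set l2. j < i" by (auto simp: sorted_wrt_append)
  have "set l1 \<union> {j} \<union> set l2 = UNIV" using arg_cong [OF l, of set] by auto
  then have "set l1 = {i. i < j}" "set l2 = {i. j < i}"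
    using s by (auto, (metis UNIV_I UnE order_less_asym singletonD order_less_irrefl)+)
  moreover have "distinct (l1 @ j # l2)" unfolding l [symmetric] by simp
  ultimately show thesis using l that by auto
qed


section \<open>Existence and uniqueness of the basic polynomials\<close>

text \<open>The discrete antiderivative vanishing at 0; summing with the opposite sign to the left
  of 0 makes the step formula hold on all integers.\<close>

definition indef_sum :: "(int \<Rightarrow> 'a::ab_group_add) \<Rightarrow> int \<Rightarrow> 'a" where
  "indef_sum h x = (if 0 \<le> x then \<Sum>y\<in>{0..<x}. h y else - (\<Sum>y\<in>{x..<0}. h y))"

lemma indef_sum_0 [simp]: "indef_sum h 0 = 0"
  by (simp add: indef_sum_def)

lemma indef_sum_step: "indef_sum h (x + 1) = indef_sum h x + h x"
proof (cases "0 \<le> x")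
  case True
  then have "{0..<x + 1} = insert x {0..<x}" by auto
  then show ?thesis using True by (simp add: indef_sum_def add.commute)
next
  case False
  then have "{x..<0} = insert x {x + 1..<0}" by auto
  then show ?thesis using False by (auto simp: indef_sum_def)
qed

text \<open>
  One-dimensional basic polynomials. Since \<open>e_plus j\<close> and \<open>e_minus j\<close> square to \<open>0\<close> and have
  anticommutator \<open>1\<close>, any \<open>g\<close> with \<open>g (x + 1) - g x = e_minus j * h x + e_plus j * h (x + 1)\<close>
  has \<open>\<partial>\<^sub>j g = h\<close>.
\<close>

primrec xi_pow :: "'n::{finite,linorder} \<Rightarrow> nat \<Rightarrow> int \<Rightarrow> 'n cliff" where
  "xi_pow j 0 = (\<lambda>_. 1)"
| "xi_pow j (Suc k) = (\<lambda>x. of_nat (Suc k) *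
     indef_sum (\<lambda>y. e_minus j * xi_pow j k y + e_plus j * xi_pow j k (y + 1)) x)"

lemma xi_pow_diff: "xi_pow j (Suc k) (x + 1) - xi_pow j (Suc k) x
    = of_nat (Suc k) * (e_minus j * xi_pow j k x + e_plus j * xi_pow j k (x + 1))"
  by (simp add: indef_sum_step ring_distribs del: of_nat_Suc)

lemma xi_pow_partial:
  "e_plus j * (xi_pow j k (x + 1) - xi_pow j k x) + e_minus j * (xi_pow j k x - xi_pow j k (x - 1))
    = of_nat k * xi_pow j (k - 1) x"
proof (cases k)
  case (Suc k')
  let ?p = "e_plus j" and ?q = "e_minus j" and ?h = "xi_pow j k'"
  have z: "a * (a * b) = 0" if "a * a = 0" for a b :: "'a cliff"
    using that by (metis mult.assoc mult_zero_left)
  \<comment> \<open>The backward difference is the forward one at x - 1. After multiplication the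
    terms at x - 1 and x + 1 contain the square of a generator and vanish, so only values at x
    survive.\<close>
  have d: "xi_pow j k x - xi_pow j k (x - 1) = of_nat k * (?q * ?h (x - 1) + ?p * ?h x)"
    using xi_pow_diff [of j k' "x - 1"] by (simp add: Suc)
  have u: "xi_pow j k (x + 1) - xi_pow j k x = of_nat k * (?q * ?h x + ?p * ?h (x + 1))"
    unfolding Suc by (rule xi_pow_diff)
  have "?p * (?q * ?h x) + ?q * (?p * ?h x) = ?h x"
    using arg_cong [OF e_plus_minus_sum [of j], of "\<lambda>y. y * ?h x"]
    by (simp add: distrib_right mult.assoc)
  then show ?thesis
    unfolding d u of_nat_mult_left_commute distrib_left z [OF e_plus_sq] z [OF e_minus_sq]
    by (simp add: Suc flip: distrib_left)
qed simp

lemma indef_sum_commute: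
  fixes a :: "'a::ring_1"
  assumes "\<And>y. a * h y = (- 1) ^ n * (h y * a)"
  shows "a * indef_sum h x = (- 1) ^ n * (indef_sum h x * a)"
  by (simp add: indef_sum_def sum_distrib_left sum_distrib_right assms)

text \<open>The values of \<open>xi_pow j k\<close> are homogeneous of degree k in
  \<open>e_plus j\<close> and \<open>e_minus j\<close>, and each generator that is passed
  contributes one sign.\<close>

lemma xi_pow_pass:
  assumes a: "a * e_plus j = - (e_plus j * a)" "a * e_minus j = - (e_minus j * a)"
  shows "a * xi_pow j k x = (- 1) ^ k * (xi_pow j k x * a)"
proof (induction k arbitrary: x)
  case (Suc k)
  have E: "a * (e * xi_pow j k y) = (- 1) ^ Suc k * (e * xi_pow j k y * a)"
    if "a * e = - (e * a)" for e y
  proof -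
    have "a * (e * xi_pow j k y) = - (e * (a * xi_pow j k y))"
      using that by (metis mult.assoc mult_minus_left)
    then show ?thesis using minus_one_power_commute [of k e] by (simp add: Suc) (metis mult.assoc)
  qed
  have "a * (e_minus j * xi_pow j k y + e_plus j * xi_pow j k (y + 1)) = (- 1) ^ Suc k *
      ((e_minus j * xi_pow j k y + e_plus j * xi_pow j k (y + 1)) * a)" for y
    using E [OF a(2), of y] E [OF a(1), of "y + 1"] by (simp only: distrib_left distrib_right)
  note F = indef_sum_commute [OF this, where x = x]
  have "a * (of_nat n * b) = (- 1) ^ Suc k * (of_nat n * b * a)" if "a * b = (- 1) ^ Suc k * (b * a)"
    for b n
    using that by (metis mult.assoc mult_of_nat_commute)
  from this [OF F] show ?case by (simp only: xi_pow.simps)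
qed simp

definition xi_prod :: "('n::{finite,linorder} \<Rightarrow> nat) \<Rightarrow> 'n dfun" where
  "xi_prod \<alpha> x = prod_list (map (\<lambda>i. xi_pow i (\<alpha> i) (x i)) (sorted_list_of_set UNIV))"

text \<open>The predicate under the definite description of \<open>xi_poly\<close>, named so that
  existence and uniqueness can be stated.\<close>

definition basic_polys :: "(('n::{finite,linorder} \<Rightarrow> nat) \<Rightarrow> 'n dfun) \<Rightarrow> bool" where
  "basic_polys P \<longleftrightarrow>
     P (\<lambda>_. 0) = (\<lambda>_. 1) \<and>
     (\<forall>\<alpha> j. partial j (P \<alpha>)
        = (\<lambda>x. (- 1) ^ (\<Sum>i | i < j. \<alpha> i) * of_nat (\<alpha> j) * P (\<alpha>(j := \<alpha> j - 1)) x)) \<and>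
     (\<forall>\<alpha>. \<alpha> \<noteq> (\<lambda>_. 0) \<longrightarrow> P \<alpha> (\<lambda>_. 0) = 0)"

text \<open>Separation of variables: the differences act on the j-th factor alone, and the sign
  arises when \<open>e_plus j\<close> and \<open>e_minus j\<close> pass the factors of smaller index
  to reach it.\<close>

lemma partial_xi_prod:
  fixes j :: "'n::{finite,linorder}"
  shows "partial j (xi_prod \<alpha>) x
    = (- 1) ^ (\<Sum>i | i < j. \<alpha> i) * of_nat (\<alpha> j) * xi_prod (\<alpha>(j := \<alpha> j - 1)) x"
proof -
  obtain l1 l2 where l: "sorted_list_of_set UNIV = l1 @ j # l2"
    "set l1 = {i. i < j}" "set l2 = {i. j < i}" "distinct l1" "distinct l2"
    by (rule sorted_UNIV_split)
  define A where "A = prod_list (map (\<lambda>i. xi_pow i (\<alpha> i) (x i)) l1)"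
  define C where "C = prod_list (map (\<lambda>i. xi_pow i (\<alpha> i) (x i)) l2)"
  have A': "map (\<lambda>i. xi_pow i ((\<alpha>(j := p)) i) ((x(j := y)) i)) l1
      = map (\<lambda>i. xi_pow i (\<alpha> i) (x i)) l1" for p y
    using l by (intro map_cong) auto
  have C': "map (\<lambda>i. xi_pow i ((\<alpha>(j := p)) i) ((x(j := y)) i)) l2
      = map (\<lambda>i. xi_pow i (\<alpha> i) (x i)) l2" for p y
    using l by (intro map_cong) auto
  have P: "xi_prod (\<alpha>(j := p)) (x(j := y)) = A * xi_pow j p y * C" for p y
    unfolding xi_prod_def l(1) map_append list.map prod_list.append prod_list.Cons A' C'
    by (simp add: A_def C_def mult.assoc)
  have s: "sum_list (map \<alpha> l1) = (\<Sum>i | i < j. \<alpha> i)"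
    using l by (simp add: sum_list_distinct_conv_sum_set)
  have pass: "a * A = (- 1) ^ (\<Sum>i | i < j. \<alpha> i) * (A * a)" if "a \<in> {e_plus j, e_minus j}" for a
    unfolding A_def s [symmetric] 
  proof (rule prod_list_pass)
    fix i assume "i \<in> set l1"
    then have "j \<noteq> i" using l by auto
    then show "a * xi_pow i (\<alpha> i) (x i) = (- 1) ^ \<alpha> i * (xi_pow i (\<alpha> i) (x i) * a)"
      using that e_plus_minus_anticomm [of j i] by (intro xi_pow_pass) auto
  qed
  let ?s = "(- 1) ^ (\<Sum>i | i < j. \<alpha> i) :: 'n cliff"
  have pass': "a * (A * b * C) = ?s * (A * (a * b) * C)" if "a \<in> {e_plus j, e_minus j}" for a b
    using pass [OF that] by (metis mult.assoc)
  have "partial j (xi_prod \<alpha>) x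
      = e_plus j * (A * (xi_pow j (\<alpha> j) (x j + 1) - xi_pow j (\<alpha> j) (x j)) * C)
      + e_minus j * (A * (xi_pow j (\<alpha> j) (x j) - xi_pow j (\<alpha> j) (x j - 1)) * C)"
    using P [of "\<alpha> j"] P [of "\<alpha> j" "x j"]
    by (simp add: partial_def fwd_diff_def bwd_diff_def algebra_simps)
  also have "\<dots> = ?s * (A * (of_nat (\<alpha> j) * xi_pow j (\<alpha> j - 1) (x j)) * C)"
    using xi_pow_partial [of j "\<alpha> j" "x j"] by (simp add: pass' flip: distrib_left distrib_right)
  also have "\<dots> = ?s * of_nat (\<alpha> j) * (A * xi_pow j (\<alpha> j - 1) (x j) * C)"
    by (simp only: mult.assoc of_nat_mult_left_commute [of A])
  also have "\<dots> = ?s * of_nat (\<alpha> j) * xi_prod (\<alpha>(j := \<alpha> j - 1)) x"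
    using P [of "\<alpha> j - 1" "x j"] by simp
  finally show ?thesis .
qed

lemma basic_polys_xi_prod: "basic_polys xi_prod"
  unfolding basic_polys_def
proof (intro conjI allI impI ext)
  show "xi_prod (\<lambda>_. 0) x = 1" for x :: "'a \<Rightarrow> int"
  proof -
    have "prod_list (map (\<lambda>i. 1 :: 'a cliff) l) = 1" for l :: "'a list" by (induction l) auto
    then show ?thesis by (simp add: xi_prod_def)
  qed
next
  fix \<alpha> :: "'a \<Rightarrow> nat" assume "\<alpha> \<noteq> (\<lambda>_. 0)"
  then obtain j where j: "\<alpha> j \<noteq> 0" by auto
  obtain l1 l2 where l: "sorted_list_of_set UNIV = l1 @ j # l2" by (rule sorted_UNIV_split)
  have "xi_pow j (\<alpha> j) 0 = 0" using j by (cases "\<alpha> j") auto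
  then show "xi_prod \<alpha> (\<lambda>_. 0) = 0" by (simp add: xi_prod_def l)
qed (rule partial_xi_prod)

text \<open>Let d be the forward difference at x. Multiplying the equation at x by
  \<open>e_minus j\<close> removes the backward term; multiplying the equation at the next lattice
  point, where d is the backward difference, by \<open>e_plus j\<close> removes the forward term.
  The two results add up to d because the anticommutator is 1.\<close>

lemma partial_eq_0_imp_step:
  assumes "partial j f = (\<lambda>_. 0)"
  shows "f (x(j := x j + 1)) = f x"
proof -
  let ?p = "e_plus j" and ?q = "e_minus j"
  have h: "?p * (f (x(j := x j + 1)) - f x) + ?q * (f x - f (x(j := x j - 1))) = 0" for x
    using fun_cong [OF assms, of x] by (simp add: partial_def fwd_diff_def bwd_diff_def)
  have z: "a * (a * b) = 0" if "a * a = 0" for a b :: "'a cliff"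
    using that by (metis mult.assoc mult_zero_left)
  let ?d = "f (x(j := x j + 1)) - f x"
  have "?q * (?p * ?d) = 0"
    using arg_cong [OF h [of x], of "\<lambda>y. ?q * y"] by (simp only: distrib_left z [OF e_minus_sq]) simp
  moreover have "?p * (?q * ?d) = 0"
    using arg_cong [OF h [of "x(j := x j + 1)"], of "\<lambda>y. ?p * y"]
    by (simp only: distrib_left z [OF e_plus_sq]) simp
  ultimately have "(?p * ?q + ?q * ?p) * ?d = 0" by (simp add: distrib_right mult.assoc)
  then show ?thesis by (simp add: e_plus_minus_sum)
qed

lemma partial_eq_0_imp_const:
  fixes f :: "'n::{finite,linorder} dfun"
  assumes "\<And>j. partial j f = (\<lambda>_. 0)"
  shows "f x = f (\<lambda>_. 0)"
proof -
  have step: "f (x(j := y + 1)) = f (x(j := y))" for x j y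
    using partial_eq_0_imp_step [OF assms [of j], of "x(j := y)"] by simp
  have upd: "f (x(j := y)) = f (x(j := 0))" for x j y
  proof (induction y rule: int_induct [of _ 0])
    case (step1 i)
    then show ?case by (simp only: step)
  next
    case (step2 i)
    then show ?case using step [of x j "i - 1"] by (simp only: diff_add_cancel)
  qed simp
  have "f (\<lambda>i. if i \<in> A then 0 else x i) = f x" for A :: "'n set"
  proof (induction A rule: finite_induct [OF finite])
    case (2 a A)
    define y where "y = (\<lambda>i. if i \<in> A then 0 else x i)"
    have e: "(\<lambda>i. if i \<in> insert a A then 0 else x i) = y(a := 0)" by (auto simp: y_def)
    have "f (y(a := 0)) = f (y(a := y a))" by (rule upd [symmetric])
    then show ?case using 2 by (simp only: e fun_upd_triv y_def [symmetric])
  qed simp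
  from this [of UNIV] show ?thesis by simp
qed

lemma partial_diff: "partial j (\<lambda>x. f x - g x) = (\<lambda>x. partial j f x - partial j g x)"
  by (rule ext) (simp add: partial_def fwd_diff_def bwd_diff_def algebra_simps)

text \<open>Induction on the total degree: the derivatives of both candidates agree, so their
  difference is constant, and it vanishes at the origin.\<close>

lemma basic_polys_unique:
  fixes P Q :: "('n::{finite,linorder} \<Rightarrow> nat) \<Rightarrow> 'n dfun"
  assumes P: "basic_polys P" and Q: "basic_polys Q"
  shows "P \<alpha> = Q \<alpha>"
proof (induction "\<Sum>i\<in>UNIV. \<alpha> i" arbitrary: \<alpha> rule: less_induct)
  case less
  show ?case
  proof (cases "\<alpha> = (\<lambda>_. 0)")
    case True
    then show ?thesis using P Q by (simp add: basic_polys_def)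
  next
    case False
    have "partial j (\<lambda>x. P \<alpha> x - Q \<alpha> x) = (\<lambda>_. 0)" for j
    proof (cases "\<alpha> j = 0")
      \<comment> \<open>Here truncated subtraction returns \<alpha> itself, out of reach of the
        induction hypothesis; the factor \<open>\<alpha> j\<close> makes both derivatives vanish
        instead.\<close>
      case True
      then show ?thesis using P Q by (simp add: basic_polys_def partial_diff)
    next
      case False
      then have "(\<Sum>i\<in>UNIV. (\<alpha>(j := \<alpha> j - 1)) i) < (\<Sum>i\<in>UNIV. \<alpha> i)"
        by (intro sum_strict_mono_ex1) auto
      then have e: "P (\<alpha>(j := \<alpha> j - 1)) = Q (\<alpha>(j := \<alpha> j - 1))" by (rule less)
      show ?thesis using P Q unfolding basic_polys_def partial_diff by (simp only: e) simp
    qed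
    then have "P \<alpha> x - Q \<alpha> x = P \<alpha> (\<lambda>_. 0) - Q \<alpha> (\<lambda>_. 0)" for x
      using partial_eq_0_imp_const [of "\<lambda>x. P \<alpha> x - Q \<alpha> x" x] by simp
    then show ?thesis using P Q False by (auto simp: basic_polys_def)
  qed
qed

lemma basic_polys_xi_poly: "basic_polys xi_poly"
proof -
  have "xi_poly = (THE P. basic_polys P)"
    unfolding xi_poly_def basic_polys_def by (rule refl)
  moreover have "\<exists>!P. basic_polys (P :: ('n::{finite,linorder} \<Rightarrow> nat) \<Rightarrow> 'n dfun)"
    using basic_polys_xi_prod basic_polys_unique by blast
  ultimately show ?thesis by (metis theI')
qed

lemma xi_poly_0 [simp]: "xi_poly (\<lambda>_. 0) = (\<lambda>_. 1)"
  and partial_xi_poly: "partial j (xi_poly \<alpha>)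
      = (\<lambda>x. (- 1) ^ (\<Sum>i | i < j. \<alpha> i) * of_nat (\<alpha> j) * xi_poly (\<alpha>(j := \<alpha> j - 1)) x)"
  and xi_poly_at_0: "\<alpha> \<noteq> (\<lambda>_. 0) \<Longrightarrow> xi_poly \<alpha> (\<lambda>_. 0) = 0"
  using basic_polys_xi_poly by (auto simp: basic_polys_def)

section \<open>Uniqueness of coefficients\<close>

definition incr :: "'n \<Rightarrow> ('n \<Rightarrow> nat) \<Rightarrow> ('n \<Rightarrow> nat)" where
  "incr j \<alpha> = \<alpha>(j := Suc (\<alpha> j))"

lemma incr_same [simp]: "incr j \<alpha> j = Suc (\<alpha> j)"
  and incr_other: "i \<noteq> j \<Longrightarrow> incr j \<alpha> i = \<alpha> i"
  by (simp_all add: incr_def)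

lemma incr_pred: "\<beta> j \<noteq> 0 \<Longrightarrow> incr j (\<beta>(j := \<beta> j - 1)) = \<beta>"
  and pred_incr [simp]: "(incr j \<alpha>)(j := \<alpha> j) = \<alpha>"
  by (auto simp: incr_def)

lemma in_incr_image:
  assumes "\<beta> j \<noteq> 0" "\<beta>(j := \<beta> j - 1) \<in> A"
  shows "\<beta> \<in> incr j ` A"
  using assms by (metis incr_pred image_eqI)

lemma inj_incr: "inj (incr j)"
  by (rule injI) (metis fun_upd_idem_iff fun_upd_upd incr_def incr_same nat.inject)

lemma finite_incr: "finite A \<Longrightarrow> finite {\<beta>. incr j \<beta> \<in> A}"
  using finite_vimageI [OF _ inj_incr] by (simp add: vimage_def)

lemma sum_incr:
  assumes "finite A" "\<And>\<alpha>. \<alpha> j = 0 \<Longrightarrow> g \<alpha> = 0"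
  shows "sum g A = (\<Sum>\<beta> | incr j \<beta> \<in> A. g (incr j \<beta>))"
proof -
  have "sum g A = sum g {\<alpha> \<in> A. \<alpha> j \<noteq> 0}"
    using assms by (intro sum.mono_neutral_right) auto
  also have "{\<alpha> \<in> A. \<alpha> j \<noteq> 0} = incr j ` {\<beta>. incr j \<beta> \<in> A}"
    by (auto intro!: in_incr_image simp: incr_pred [simplified])
  also have "sum g \<dots> = (\<Sum>\<beta> | incr j \<beta> \<in> A. g (incr j \<beta>))"
    using inj_incr [of j] by (subst sum.reindex) (auto intro: inj_on_subset)
  finally show ?thesis .
qed

abbreviation fin_supp :: "('a \<Rightarrow> 'b::zero) \<Rightarrow> bool" where
  "fin_supp c \<equiv> finite {\<alpha>. c \<alpha> \<noteq> 0}"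

lemma poly_of_superset:
  assumes "finite A" "{\<alpha>. c \<alpha> \<noteq> 0} \<subseteq> A"
  shows "poly_of c x = (\<Sum>\<alpha>\<in>A. xi_poly \<alpha> x * c \<alpha>)"
  unfolding poly_of_def using assms by (intro sum.mono_neutral_left) auto

lemma minus_one_power_mult_eq_0_iff: "(- 1) ^ n * (x::'a::ring_1) = 0 \<longleftrightarrow> x = 0"
  by (cases "even n") auto

lemma of_nat_mult_cliff_eq_0_iff:
  "of_nat n * (x :: 'n::{finite,linorder} cliff) = 0 \<longleftrightarrow> n = 0 \<or> x = 0"
proof -
  have "of_nat n * x = of_real (real n) * x" by simp
  also have "\<dots> = real n *\<^sub>R x" unfolding of_real_def by simp
  finally show ?thesis by simp
qed

lemma partial_poly_of:
  fixes j :: "'n::{finite,linorder}"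
  assumes "fin_supp c"
  shows "partial j (poly_of c)
    = poly_of (\<lambda>\<beta>. (- 1) ^ (\<Sum>i | i < j. \<beta> i) * of_nat (Suc (\<beta> j)) * c (incr j \<beta>))"
    (is "_ = poly_of ?d")
proof
  fix x
  let ?A = "{\<alpha>. c \<alpha> \<noteq> 0}"
  let ?g = "\<lambda>\<alpha>. partial j (xi_poly \<alpha>) x * c \<alpha>"
  have "partial j (poly_of c) x = sum ?g ?A"
    unfolding partial_def fwd_diff_def bwd_diff_def poly_of_def
    by (simp add: sum_subtractf [symmetric] sum_distrib_left sum.distrib [symmetric]
        ring_distribs mult.assoc)
  also have "\<dots> = (\<Sum>\<beta> | incr j \<beta> \<in> ?A. ?g (incr j \<beta>))"
    using assms by (rule sum_incr) (simp add: partial_xi_poly)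
  also have "\<dots> = (\<Sum>\<beta> | incr j \<beta> \<in> ?A. xi_poly \<beta> x * ?d \<beta>)"
  proof (rule sum.cong [OF refl])
    fix \<beta>
    have s: "(\<Sum>i | i < j. incr j \<beta> i) = (\<Sum>i | i < j. \<beta> i)"
      by (intro sum.cong) (auto simp: incr_other)
    let ?s = "(- 1) ^ (\<Sum>i | i < j. \<beta> i) :: 'n cliff" and ?n = "of_nat (Suc (\<beta> j)) :: 'n cliff"
    have "?g (incr j \<beta>) = ?s * (?n * xi_poly \<beta> x * c (incr j \<beta>))"
      by (simp add: partial_xi_poly s mult.assoc del: of_nat_Suc)
    also have "\<dots> = ?s * (xi_poly \<beta> x * (?n * c (incr j \<beta>)))"
      by (simp only: of_nat_mult_left_commute mult.assoc)
    also have "\<dots> = xi_poly \<beta> x * (?s * (?n * c (incr j \<beta>)))"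
      by (cases "even (\<Sum>i | i < j. \<beta> i)") simp_all
    finally show "?g (incr j \<beta>) = xi_poly \<beta> x * ?d \<beta>" by (simp only: mult.assoc)
  qed
  also have "\<dots> = poly_of ?d x"
    using assms by (intro poly_of_superset [symmetric] finite_incr) auto
  finally show "partial j (poly_of c) x = poly_of ?d x" .
qed

text \<open>Induction on the degree of \<alpha>: evaluation at the origin isolates the constant
  coefficient, and a derivative in a direction with \<open>\<alpha> j \<noteq> 0\<close> turns
  \<open>c \<alpha>\<close> into a nonzero integer multiple, up to sign, of itself at a lower
  index.\<close>

lemma poly_of_eq_0:
  fixes c :: "('n::{finite,linorder} \<Rightarrow> nat) \<Rightarrow> 'n cliff"
  assumes "fin_supp c" "poly_of c = (\<lambda>_. 0)"
  shows "c \<alpha> = 0"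
  using assms
proof (induction "\<Sum>i\<in>UNIV. \<alpha> i" arbitrary: \<alpha> c rule: less_induct)
  case less
  show ?case
  proof (cases "\<alpha> = (\<lambda>_. 0)")
    case True
    let ?A = "insert (\<lambda>_. 0) {\<alpha>. c \<alpha> \<noteq> 0}"
    have "poly_of c (\<lambda>_. 0) = (\<Sum>\<alpha>\<in>?A. xi_poly \<alpha> (\<lambda>_. 0) * c \<alpha>)"
      using less.prems by (intro poly_of_superset) auto
    also have "\<dots> = (\<Sum>\<alpha>\<in>?A. if \<alpha> = (\<lambda>_. 0) then c (\<lambda>_. 0) else 0)"
      by (intro sum.cong) (auto simp: xi_poly_at_0)
    also have "\<dots> = c (\<lambda>_. 0)" using less.prems by simp
    finally show ?thesis using less.prems True by simp
  next
    case False
    then obtain j where j: "\<alpha> j \<noteq> 0" by auto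
    let ?d = "\<lambda>\<beta>. (- 1) ^ (\<Sum>i | i < j. \<beta> i) * of_nat (Suc (\<beta> j)) * c (incr j \<beta>)"
    let ?\<beta> = "\<alpha>(j := \<alpha> j - 1)"
    have "(\<Sum>i\<in>UNIV. ?\<beta> i) < (\<Sum>i\<in>UNIV. \<alpha> i)"
      using j by (intro sum_strict_mono_ex1) auto
    moreover have "fin_supp ?d"
      by (rule finite_subset [OF _ finite_incr [OF less.prems(1), of j]]) auto
    moreover have "poly_of ?d = (\<lambda>_. 0)"
      unfolding partial_poly_of [OF less.prems(1), symmetric] less.prems(2)
      by (simp add: partial_def fwd_diff_def bwd_diff_def)
    ultimately have "?d ?\<beta> = 0" by (rule less.hyps)
    then show ?thesis using incr_pred [of \<alpha> j, OF j]
      by (simp add: minus_one_power_mult_eq_0_iff of_nat_mult_cliff_eq_0_iff mult.assoc del: of_nat_Suc)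
  qed
qed

lemma poly_of_inject:
  assumes "fin_supp c" "fin_supp d" "poly_of c = poly_of d"
  shows "c = d"
proof
  fix \<alpha>
  let ?A = "{\<alpha>. c \<alpha> \<noteq> 0} \<union> {\<alpha>. d \<alpha> \<noteq> 0}"
  have "poly_of (\<lambda>\<alpha>. c \<alpha> - d \<alpha>) x = poly_of c x - poly_of d x" for x
    using assms by (subst (1 2 3) poly_of_superset [of ?A]) (auto simp: sum_subtractf right_diff_distrib)
  then have "poly_of (\<lambda>\<alpha>. c \<alpha> - d \<alpha>) = (\<lambda>_. 0)" using assms(3) by auto
  moreover have "fin_supp (\<lambda>\<alpha>. c \<alpha> - d \<alpha>)"
    by (rule finite_subset [of _ ?A]) (use assms in auto)
  ultimately have "c \<alpha> - d \<alpha> = 0" by (intro poly_of_eq_0 [of "\<lambda>\<alpha>. c \<alpha> - d \<alpha>"])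
  then show "c \<alpha> = d \<alpha>" by simp
qed

lemma poly_coeff_poly_of: "fin_supp c \<Longrightarrow> poly_coeff (poly_of c) = c"
  unfolding poly_coeff_def by (rule the_equality) (auto intro: poly_of_inject)

lemma right_linear_poly_of:
  assumes "finite A" "{\<alpha>. c \<alpha> \<noteq> 0} \<subseteq> A"
  shows "right_linear T (poly_of c) x = (\<Sum>\<alpha>\<in>A. T \<alpha> x * c \<alpha>)"
proof -
  have "poly_coeff (poly_of c) = c"
    using assms by (intro poly_coeff_poly_of) (rule finite_subset)
  then show ?thesis
    unfolding right_linear_def using assms by (auto intro: sum.mono_neutral_left)
qed


section \<open>Commuting variables\<close>

text \<open>
  The operators \<open>u\<^sub>j = R\<^sub>j \<xi>\<^sub>j\<close> commute with each other and with all \<open>R\<^sub>k\<close>. In the basis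
  \<open>u\<^sup>\<alpha>[1] = \<xi>\<^sup>\<alpha>[1] * e_mono \<alpha>\<close> the operator \<open>R\<^sub>j\<close> is left multiplication of the coefficients by
  \<open>e_vec j\<close>, and \<open>u\<^sub>j\<close> is a shift of the index.
\<close>

definition e_mono :: "('n::{finite,linorder} \<Rightarrow> nat) \<Rightarrow> 'n cliff" where
  "e_mono \<alpha> = prod_list (map (\<lambda>i. e_vec i ^ \<alpha> i) (rev (sorted_list_of_set UNIV)))"

definition e_mono_inv :: "('n::{finite,linorder} \<Rightarrow> nat) \<Rightarrow> 'n cliff" where
  "e_mono_inv \<alpha> = prod_list (map (\<lambda>i. e_vec i ^ \<alpha> i) (sorted_list_of_set UNIV))"

definition pol :: "(('n::{finite,linorder} \<Rightarrow> nat) \<Rightarrow> 'n cliff) \<Rightarrow> 'n dfun" where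
  "pol c = poly_of (\<lambda>\<alpha>. e_mono \<alpha> * c \<alpha>)"

definition lmul :: "'b \<Rightarrow> ('a \<Rightarrow> 'b::times) \<Rightarrow> 'a \<Rightarrow> 'b" where
  "lmul a c = (\<lambda>\<alpha>. a * c \<alpha>)"

definition shift :: "'n \<Rightarrow> (('n \<Rightarrow> nat) \<Rightarrow> 'b::zero) \<Rightarrow> ('n \<Rightarrow> nat) \<Rightarrow> 'b" where
  "shift j c = (\<lambda>\<beta>. if \<beta> j = 0 then 0 else c (\<beta>(j := \<beta> j - 1)))"

lemma prod_list_involutions:
  fixes F :: "'a \<Rightarrow> 'b::monoid_mult"
  assumes "\<And>i. F i * F i = 1"
  shows "prod_list (map F l) * prod_list (map F (rev l)) = 1"
proof (induction l)
  case (Cons i l)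
  have "prod_list (map F (i # l)) * prod_list (map F (rev (i # l)))
      = F i * (prod_list (map F l) * prod_list (map F (rev l))) * F i"
    by (simp add: mult.assoc)
  then show ?case by (simp only: Cons mult_1_right assms)
qed simp

lemma e_vec_power_sq: "e_vec j ^ n * e_vec j ^ n = 1"
  by (metis e_vec_sq power2_eq_square power_mult_distrib power_mult mult.commute power_one)

lemma e_mono_inv_right [simp]: "e_mono \<alpha> * e_mono_inv \<alpha> = 1"
  using prod_list_involutions [of "\<lambda>i. e_vec i ^ \<alpha> i" "rev (sorted_list_of_set UNIV)"]
  by (simp add: e_mono_def e_mono_inv_def e_vec_power_sq)

lemma e_mono_inv_left [simp]: "e_mono_inv \<alpha> * e_mono \<alpha> = 1"
  using prod_list_involutions [of "\<lambda>i. e_vec i ^ \<alpha> i" "sorted_list_of_set UNIV"]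
  by (simp add: e_mono_def e_mono_inv_def e_vec_power_sq)

lemma e_mono_0 [simp]: "e_mono (\<lambda>_. 0) = 1"
proof -
  have "prod_list (map (\<lambda>i. 1 :: 'a cliff) l) = 1" for l :: "'a list" by (induction l) auto
  then show ?thesis by (simp add: e_mono_def)
qed

lemma e_mono_mult_eq_0_iff [simp]: "e_mono \<alpha> * x = 0 \<longleftrightarrow> x = 0"
  by (metis e_mono_inv_left mult.assoc mult_1_left mult_zero_right)

lemma e_vec_pass_power:
  "i \<noteq> j \<Longrightarrow> e_vec j * e_vec i ^ k = (- 1) ^ k * (e_vec i ^ k * e_vec j)"
proof (induction k)
  case (Suc k)
  have "e_vec j * e_vec i ^ Suc k = - (e_vec i * (e_vec j * e_vec i ^ k))"
    using e_vec_anticomm [of j i] Suc.prems by (simp flip: mult.assoc)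
  also have "\<dots> = (- 1) ^ Suc k * (e_vec i ^ Suc k * e_vec j)"
    using Suc by (cases "even k") (simp_all add: mult.assoc)
  finally show ?case .
qed simp

text \<open>In \<open>e_mono\<close> the indices decrease, so \<open>e_vec j\<close> passes exactly
  the factors of larger index before it joins its own power.\<close>

lemma e_vec_e_mono:
  "e_vec j * e_mono \<alpha> = (- 1) ^ (\<Sum>i | j < i. \<alpha> i) * e_mono (incr j \<alpha>)"
proof -
  obtain l1 l2 where l: "sorted_list_of_set UNIV = l1 @ j # l2"
    "set l1 = {i. i < j}" "set l2 = {i. j < i}" "distinct l1" "distinct l2"
    by (rule sorted_UNIV_split)
  let ?F = "\<lambda>i. e_vec i ^ \<alpha> i" and ?F' = "\<lambda>i. e_vec i ^ incr j \<alpha> i"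
  have "e_vec j * prod_list (map ?F (rev l2))
      = (- 1) ^ sum_list (map \<alpha> (rev l2)) * (prod_list (map ?F (rev l2)) * e_vec j)"
    using l by (intro prod_list_pass e_vec_pass_power) auto
  moreover have "sum_list (map \<alpha> (rev l2)) = (\<Sum>i | j < i. \<alpha> i)"
    using l by (subst sum_list_distinct_conv_sum_set) auto
  moreover have maps: "map ?F' (rev l2) = map ?F (rev l2)" "map ?F' (rev l1) = map ?F (rev l1)"
    using l by (auto simp: incr_other)
  moreover have "rev (l1 @ j # l2) = rev l2 @ j # rev l1" by simp
  ultimately show ?thesis
    unfolding e_mono_def l(1) by (simp only: map_append list.map prod_list.append prod_list.Cons)
      (simp add: mult.assoc [symmetric])
qed

text \<open>This is the sign in the definition of \<open>R_op\<close>. The two cancel, and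
  \<open>R_op j\<close> becomes a left multiplication of the coefficients.\<close>

lemma e_mono_pass:
  "e_vec j * e_mono \<alpha> = (- 1) ^ (\<Sum>i | i \<noteq> j. \<alpha> i) * (e_mono \<alpha> * e_vec j)"
proof -
  let ?l = "rev (sorted_list_of_set (UNIV :: 'a set))"
  let ?n = "\<lambda>i. if i = j then 0 else \<alpha> i"
  have "e_vec j * e_mono \<alpha> = (- 1) ^ sum_list (map ?n ?l) * (e_mono \<alpha> * e_vec j)"
    unfolding e_mono_def
  proof (rule prod_list_pass)
    fix i
    show "e_vec j * e_vec i ^ \<alpha> i = (- 1) ^ ?n i * (e_vec i ^ \<alpha> i * e_vec j)"
      using e_vec_pass_power [of i j] by (simp add: power_commutes)
  qed
  moreover have "sum_list (map ?n ?l) = sum ?n UNIV"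
    by (subst sum_list_distinct_conv_sum_set) auto
  moreover have "sum ?n UNIV = (\<Sum>i | i \<noteq> j. \<alpha> i)"
    by (rule sum.mono_neutral_cong_right) auto
  ultimately show ?thesis by simp
qed

text \<open>Moving \<open>e_vec j\<close> from the left into its place or all the way to the right
  costs signs that differ by the exponents below j. That difference is the sign in the definition of
  \<open>xi\<close>, so it cancels there.\<close>

lemma e_mono_incr: "e_mono (incr j \<alpha>) * e_vec j = (- 1) ^ (\<Sum>i | i < j. \<alpha> i) * e_mono \<alpha>"
proof -
  let ?l = "\<Sum>i | i < j. \<alpha> i" and ?g = "\<Sum>i | j < i. \<alpha> i"
  have "sum \<alpha> ({i. i < j} \<union> {i. j < i}) = ?l + ?g"
    by (rule sum.union_disjoint) auto
  moreover have "{i. i < j} \<union> {i. j < i} = {i. i \<noteq> j}" by auto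
  ultimately have n: "(\<Sum>i | i \<noteq> j. \<alpha> i) = ?l + ?g" by metis
  have "(- 1) ^ ?g * e_mono (incr j \<alpha>) = (- 1) ^ (?l + ?g) * (e_mono \<alpha> * e_vec j)"
    using e_vec_e_mono [of j \<alpha>] e_mono_pass [of j \<alpha>] n by simp
  then have "e_mono (incr j \<alpha>) = (- 1) ^ ?l * (e_mono \<alpha> * e_vec j)"
    by (cases "even ?g"; cases "even ?l") (simp_all add: neg_eq_iff_add_eq_0 eq_neg_iff_add_eq_0)
  then show ?thesis by (simp add: mult.assoc e_vec_sq)
qed

section \<open>Operators on coefficient families\<close>

lemma pol_superset:
  assumes "finite A" "{\<alpha>. c \<alpha> \<noteq> 0} \<subseteq> A"
  shows "pol c x = (\<Sum>\<alpha>\<in>A. xi_poly \<alpha> x * (e_mono \<alpha> * c \<alpha>))"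
  unfolding pol_def using assms by (intro poly_of_superset) auto

lemma right_linear_pol:
  assumes "finite A" "{\<alpha>. c \<alpha> \<noteq> 0} \<subseteq> A"
  shows "right_linear T (pol c) x = (\<Sum>\<alpha>\<in>A. T \<alpha> x * (e_mono \<alpha> * c \<alpha>))"
  unfolding pol_def using assms by (intro right_linear_poly_of) auto

text \<open>Every \<open>e_mono \<alpha>\<close> is invertible, so both expansions describe the same
  functions.\<close>

lemma dpolys_iff_pol: "f \<in> dpolys \<longleftrightarrow> (\<exists>c. fin_supp c \<and> f = pol c)"
proof
  assume "f \<in> dpolys"
  then obtain c where c: "fin_supp c" "f = poly_of c" by (auto simp: dpolys_def)
  have "e_mono_inv \<alpha> * x = 0 \<longleftrightarrow> x = 0" for \<alpha> and x :: "'a cliff"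
    by (metis e_mono_inv_right mult.assoc mult_1_left mult_zero_right)
  then have "fin_supp (\<lambda>\<alpha>. e_mono_inv \<alpha> * c \<alpha>)" using c by simp
  moreover have "f = pol (\<lambda>\<alpha>. e_mono_inv \<alpha> * c \<alpha>)" using c by (simp add: pol_def flip: mult.assoc)
  ultimately show "\<exists>c. fin_supp c \<and> f = pol c" by (intro exI conjI)
qed (auto simp: dpolys_def pol_def)

lemma pol_inject:
  assumes "fin_supp c" "fin_supp d" "pol c = pol d"
  shows "c = d"
proof
  fix \<alpha>
  have "(\<lambda>\<alpha>. e_mono \<alpha> * c \<alpha>) = (\<lambda>\<alpha>. e_mono \<alpha> * d \<alpha>)"
    using assms unfolding pol_def by (intro poly_of_inject) auto
  then have "e_mono \<alpha> * (c \<alpha> - d \<alpha>) = 0" by (simp add: right_diff_distrib fun_eq_iff)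
  then show "c \<alpha> = d \<alpha>" by simp
qed

lemma fin_supp_add: "fin_supp c \<Longrightarrow> fin_supp d \<Longrightarrow> fin_supp (\<lambda>\<alpha>. c \<alpha> + d \<alpha> :: 'b::monoid_add)"
  by (rule finite_subset [of _ "{\<alpha>. c \<alpha> \<noteq> 0} \<union> {\<alpha>. d \<alpha> \<noteq> 0}"]) auto

lemma fin_supp_sum:
  "(\<And>i. i \<in> I \<Longrightarrow> fin_supp (c i)) \<Longrightarrow> fin_supp (\<lambda>\<alpha>. \<Sum>i\<in>I. c i \<alpha> :: 'b::comm_monoid_add)"
  by (induction I rule: infinite_finite_induct) (auto intro: fin_supp_add)

lemma fin_supp_lmul: "fin_supp c \<Longrightarrow> fin_supp (lmul (a::'b::mult_zero) c)"
  by (rule finite_subset [of _ "{\<alpha>. c \<alpha> \<noteq> 0}"]) (auto simp: lmul_def)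

lemma fin_supp_scaleC: "fin_supp c \<Longrightarrow> fin_supp (\<lambda>\<alpha>. k *\<^sub>C c \<alpha>)"
  by (rule finite_subset [of _ "{\<alpha>. c \<alpha> \<noteq> 0}"]) auto

lemma supp_shift: "{\<alpha>. shift j c \<alpha> \<noteq> 0} \<subseteq> incr j ` {\<alpha>. c \<alpha> \<noteq> 0}"
  by (auto simp: shift_def intro!: in_incr_image split: if_splits)

lemma fin_supp_shift: "fin_supp c \<Longrightarrow> fin_supp (shift j c)"
  by (rule finite_subset [OF supp_shift]) simp

lemma pol_add:
  assumes "fin_supp c" "fin_supp d"
  shows "pol (\<lambda>\<alpha>. c \<alpha> + d \<alpha>) x = pol c x + pol d x"
  using assms by (subst (1 2 3) pol_superset [of "{\<alpha>. c \<alpha> \<noteq> 0} \<union> {\<alpha>. d \<alpha> \<noteq> 0}"])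
    (auto simp: distrib_left sum.distrib)

lemma pol_0 [simp]: "pol (\<lambda>_. 0) x = 0"
  by (subst pol_superset [of "{}"]) auto

lemma pol_sum:
  "(\<And>i. i \<in> I \<Longrightarrow> fin_supp (c i)) \<Longrightarrow> pol (\<lambda>\<alpha>. \<Sum>i\<in>I. c i \<alpha>) x = (\<Sum>i\<in>I. pol (c i) x)"
  by (induction I rule: infinite_finite_induct) (simp_all add: pol_add fin_supp_sum)

lemma pol_scaleC: "fin_supp c \<Longrightarrow> pol (\<lambda>\<alpha>. k *\<^sub>C c \<alpha>) x = k *\<^sub>C pol c x"
  by (subst (1 2) pol_superset [of "{\<alpha>. c \<alpha> \<noteq> 0}"]) (auto simp: scaleC_sum)

lemma pol_mult_right: "fin_supp c \<Longrightarrow> pol (\<lambda>\<alpha>. c \<alpha> * d) x = pol c x * d"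
  by (subst (1 2) pol_superset [of "{\<alpha>. c \<alpha> \<noteq> 0}"]) (auto simp: sum_distrib_right mult.assoc)

definition delta :: "'b \<Rightarrow> ('n \<Rightarrow> nat) \<Rightarrow> 'b::zero" where
  "delta c = (\<lambda>\<alpha>. if \<alpha> = (\<lambda>_. 0) then c else 0)"

lemma supp_delta: "{\<alpha>. delta c \<alpha> \<noteq> 0} \<subseteq> {\<lambda>_. 0}"
  by (auto simp: delta_def)

lemma fin_supp_delta [simp]: "fin_supp (delta c)"
  by (rule finite_subset [OF supp_delta]) simp

lemma pol_delta: "pol (delta c) = (\<lambda>_. c)"
  by (rule ext, subst pol_superset [OF _ supp_delta]) (simp_all add: delta_def)

lemma lmul_delta: "lmul (a::'b::mult_zero) (delta c) = delta (a * c)"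
  by (auto simp: lmul_def delta_def)

lemma R_op_pol:
  assumes "fin_supp c"
  shows "R_op j (pol c) = pol (lmul (e_vec j) c)"
proof
  fix x
  let ?A = "{\<alpha>. c \<alpha> \<noteq> 0}"
  have "R_op j (pol c) x = (\<Sum>\<alpha>\<in>?A. (- 1) ^ (\<Sum>i | i \<noteq> j. \<alpha> i) * xi_poly \<alpha> x * e_vec j * (e_mono \<alpha> * c \<alpha>))"
    unfolding R_op_def using assms by (subst right_linear_pol [of ?A]) auto
  also have "\<dots> = (\<Sum>\<alpha>\<in>?A. xi_poly \<alpha> x * (e_mono \<alpha> * (e_vec j * c \<alpha>)))"
  proof (rule sum.cong [OF refl])
    fix \<alpha>
    have "xi_poly \<alpha> x * (e_vec j * e_mono \<alpha>) * c \<alpha>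
        = xi_poly \<alpha> x * ((- 1) ^ (\<Sum>i | i \<noteq> j. \<alpha> i) * (e_mono \<alpha> * e_vec j)) * c \<alpha>"
      by (simp only: e_mono_pass)
    then show "(- 1) ^ (\<Sum>i | i \<noteq> j. \<alpha> i) * xi_poly \<alpha> x * e_vec j * (e_mono \<alpha> * c \<alpha>)
        = xi_poly \<alpha> x * (e_mono \<alpha> * (e_vec j * c \<alpha>))"
      by (cases "even (\<Sum>i | i \<noteq> j. \<alpha> i)") (simp_all add: mult.assoc)
  qed
  also have "\<dots> = pol (lmul (e_vec j) c) x"
    using assms by (subst pol_superset [of ?A]) (auto simp: lmul_def)
  finally show "R_op j (pol c) x = pol (lmul (e_vec j) c) x" .
qed

text \<open>The coefficient form of xi_j = R_j u_j, the shift being u_j.\<close>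

lemma xi_pol:
  assumes "fin_supp c"
  shows "xi j (pol c) = pol (shift j (lmul (e_vec j) c))"
proof
  fix x
  let ?A = "{\<alpha>. c \<alpha> \<noteq> 0}"
  have "xi j (pol c) x
      = (\<Sum>\<alpha>\<in>?A. (- 1) ^ (\<Sum>i | i < j. \<alpha> i) * xi_poly (incr j \<alpha>) x * (e_mono \<alpha> * c \<alpha>))"
    unfolding xi_def using assms by (subst right_linear_pol [of ?A]) (auto simp: incr_def)
  also have "\<dots> = (\<Sum>\<alpha>\<in>?A. xi_poly (incr j \<alpha>) x * (e_mono (incr j \<alpha>) * (e_vec j * c \<alpha>)))"
  proof (rule sum.cong [OF refl])
    fix \<alpha>
    have "xi_poly (incr j \<alpha>) x * (e_mono (incr j \<alpha>) * e_vec j) * c \<alpha>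
        = xi_poly (incr j \<alpha>) x * ((- 1) ^ (\<Sum>i | i < j. \<alpha> i) * e_mono \<alpha>) * c \<alpha>"
      by (simp only: e_mono_incr)
    then show "(- 1) ^ (\<Sum>i | i < j. \<alpha> i) * xi_poly (incr j \<alpha>) x * (e_mono \<alpha> * c \<alpha>)
        = xi_poly (incr j \<alpha>) x * (e_mono (incr j \<alpha>) * (e_vec j * c \<alpha>))"
      by (cases "even (\<Sum>i | i < j. \<alpha> i)") (simp_all add: mult.assoc)
  qed
  also have "\<dots> = (\<Sum>\<beta>\<in>incr j ` ?A. xi_poly \<beta> x * (e_mono \<beta> * shift j (lmul (e_vec j) c) \<beta>))"
    using inj_incr [of j] by (subst sum.reindex) (auto intro: inj_on_subset simp: shift_def lmul_def)
  also have "\<dots> = pol (shift j (lmul (e_vec j) c)) x"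
  proof (rule pol_superset [symmetric])
    have "{\<alpha>. lmul (e_vec j) c \<alpha> \<noteq> 0} \<subseteq> ?A" by (auto simp: lmul_def)
    then show "{\<alpha>. shift j (lmul (e_vec j) c) \<alpha> \<noteq> 0} \<subseteq> incr j ` ?A"
      using supp_shift [of j "lmul (e_vec j) c"] by blast
  qed (use assms in simp)
  finally show "xi j (pol c) x = pol (shift j (lmul (e_vec j) c)) x" .
qed

section \<open>The Clifford algebra as a Banach algebra\<close>

lemma cmod_coeff_le: "cmod (coeff x A) \<le> norm (x :: 'n::{finite,linorder} cliff)"
  unfolding norm_cliff_def by (rule member_le_sum) auto

lemma norm_scaleC: "norm (c *\<^sub>C (x :: 'n::{finite,linorder} cliff)) = cmod c * norm x"
  by (simp add: norm_cliff_def norm_mult sum_distrib_left)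

lemma bounded_linear_coeff: "bounded_linear (\<lambda>x :: 'n::{finite,linorder} cliff. coeff x A)"
  by (rule bounded_linear_intro [where K = 1]) (auto simp: cmod_coeff_le scaleR_conv_of_real [where 'a = complex])

lemma bounded_linear_scaleC_left: "bounded_linear (\<lambda>c. c *\<^sub>C (x :: 'n::{finite,linorder} cliff))"
  by (rule bounded_linear_intro [where K = "norm x"])
    (auto simp: scaleC_add_left norm_scaleC scaleR_eq_scaleC scaleR_conv_of_real [where 'a = complex])

text \<open>Convergence in the l1 norm is coordinatewise. Completeness gives the convergence of
  \<open>exp\<close>.\<close>

instance cliff :: ("{finite,linorder}") banach
proof
  fix X :: "nat \<Rightarrow> 'a cliff" assume X: "Cauchy X"
  have "Cauchy (\<lambda>n. coeff (X n) A)" for A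
    by (rule bounded_linear.Cauchy [OF bounded_linear_coeff X])
  then have "\<forall>A. \<exists>l. (\<lambda>n. coeff (X n) A) \<longlonglongrightarrow> l"
    using Cauchy_convergent by (auto simp: convergent_def)
  then obtain l where l: "\<And>A. (\<lambda>n. coeff (X n) A) \<longlonglongrightarrow> l A" by metis
  have "(\<lambda>n. \<Sum>A\<in>UNIV. cmod (coeff (X n) A - l A)) \<longlonglongrightarrow> (\<Sum>A::('a + 'a) set\<in>UNIV. 0)"
    using l by (intro tendsto_sum) (simp add: tendsto_norm_zero_iff LIM_zero_iff)
  then have "(\<lambda>n. norm (X n - Cliff l)) \<longlonglongrightarrow> 0" by (simp add: norm_cliff_def)
  then have "X \<longlonglongrightarrow> Cliff l" by (simp add: tendsto_norm_zero_iff LIM_zero_iff)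
  then show "convergent X" by (auto simp: convergent_def)
qed

lemma exp_eigenvector:
  fixes b c :: "'n::{finite,linorder} cliff"
  assumes "b * c = l *\<^sub>C c"
  shows "exp b * c = exp l *\<^sub>C c"
proof -
  have "b ^ k * c = (l ^ k) *\<^sub>C c" for k
    by (induction k) (simp_all add: assms mult.assoc mult.commute)
  moreover have "(\<lambda>k. (b ^ k /\<^sub>R fact k) * c) sums (exp b * c)"
    by (intro sums_mult2 exp_converges)
  moreover have "(\<lambda>k. (l ^ k /\<^sub>R fact k) *\<^sub>C c) sums (exp l *\<^sub>C c)"
    by (rule bounded_linear.sums [OF bounded_linear_scaleC_left exp_converges])
  ultimately show ?thesis
    by (simp add: scaleR_eq_scaleC scaleR_conv_of_real [where 'a = complex] sums_unique2)
qed

text \<open>To be used with a and b differing by a scalar, which turns a commutator relation into a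
  relation for the exponential.\<close>

lemma exp_intertwine:
  fixes a b z :: "'a::{real_normed_algebra_1,banach}"
  assumes "b * z = z * a"
  shows "exp b * z = z * exp a"
proof -
  have "b ^ k * z = z * a ^ k" for k
  proof (induction k)
    case (Suc k)
    have "b ^ Suc k * z = b * (b ^ k * z)" by (simp add: mult.assoc)
    also have "\<dots> = (b * z) * a ^ k" by (simp add: Suc mult.assoc)
    finally show ?case by (simp add: assms mult.assoc)
  qed simp
  moreover have "(\<lambda>k. (b ^ k /\<^sub>R fact k) * z) sums (exp b * z)"
    by (intro sums_mult2 exp_converges)
  moreover have "(\<lambda>k. z * (a ^ k /\<^sub>R fact k)) sums (z * exp a)"
    by (intro sums_mult exp_converges)
  ultimately show ?thesis by (simp add: sums_unique2)
qed


section \<open>The torus\<close>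

lemma lmul_lmul: "lmul (a::'b::semigroup_mult) (lmul b c) = lmul (a * b) c"
  by (simp add: lmul_def mult.assoc)

lemma pol_scaleR: "fin_supp c \<Longrightarrow> pol (\<lambda>\<alpha>. r *\<^sub>R c \<alpha>) x = r *\<^sub>R pol c x"
  by (simp add: scaleR_eq_scaleC pol_scaleC)

lemma fin_supp_scaleR: "fin_supp c \<Longrightarrow> fin_supp (\<lambda>\<alpha>. r *\<^sub>R (c \<alpha> :: 'b::real_vector))"
  by (rule finite_subset [of _ "{\<alpha>. c \<alpha> \<noteq> 0}"]) auto

text \<open>A polynomial has finitely many coefficients, so the pointwise operator series is a
  finite sum of exponential series, each multiplied by constants from the left and right.\<close>

lemma op_exp_pol:
  assumes X: "\<And>c. fin_supp c \<Longrightarrow> X (pol c) = pol (lmul b c)" and c: "fin_supp c"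
  shows "op_exp X (pol c) = pol (lmul (exp b) c)"
proof
  fix x
  let ?A = "{\<alpha>. c \<alpha> \<noteq> 0}"
  have pw: "(X ^^ k) (pol c) = pol (lmul (b ^ k) c)" for k
  proof (induction k)
    case 0
    then show ?case by (simp add: lmul_def)
  next
    case (Suc k)
    then show ?case by (simp add: X fin_supp_lmul c lmul_lmul)
  qed
  have ev: "pol (lmul a c) x = (\<Sum>\<alpha>\<in>?A. xi_poly \<alpha> x * (e_mono \<alpha> * (a * c \<alpha>)))" for a
    using c by (subst pol_superset [of ?A]) (auto simp: lmul_def)
  have "(\<lambda>k. \<Sum>\<alpha>\<in>?A. xi_poly \<alpha> x * (e_mono \<alpha> * ((b ^ k /\<^sub>R fact k) * c \<alpha>))) sums pol (lmul (exp b) c) x"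
    unfolding ev by (intro sums_sum sums_mult sums_mult2 exp_converges)
  moreover have "(1 / fact k) *\<^sub>R (X ^^ k) (pol c) x
      = (\<Sum>\<alpha>\<in>?A. xi_poly \<alpha> x * (e_mono \<alpha> * ((b ^ k /\<^sub>R fact k) * c \<alpha>)))" for k
    by (simp add: pw ev scaleR_sum_right inverse_eq_divide)
  ultimately show "op_exp X (pol c) x = pol (lmul (exp b) c) x"
    by (simp add: op_exp_def sums_iff)
qed

text \<open>The bivector of the j-th pair of coordinates; within the range of the torus it squares
  to -1.\<close>

definition rot :: "nat \<Rightarrow> 'n::{finite,linorder} cliff" where
  "rot j = e_vec (nth_index (2 * j)) * e_vec (nth_index (2 * j - 1))"

definition torus_gen :: "(nat \<Rightarrow> real) \<Rightarrow> 'n::{finite,linorder} cliff" where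
  "torus_gen t = (1/2) *\<^sub>R (\<Sum>j = 1..CARD('n) div 2. t j *\<^sub>R rot j)"

lemma torus_elt_pol:
  fixes c :: "('n::{finite,linorder} \<Rightarrow> nat) \<Rightarrow> 'n cliff"
  assumes "fin_supp c"
  shows "torus_elt t (pol c) = pol (lmul (exp (torus_gen t)) c)"
  unfolding torus_elt_def
proof (rule op_exp_pol [OF _ assms], rule ext)
  fix c :: "('n \<Rightarrow> nat) \<Rightarrow> 'n cliff" and x
  assume c: "fin_supp c"
  let ?J = "{1..CARD('n) div 2}"
  have "pol (lmul (torus_gen t) c) x = pol (\<lambda>\<alpha>. (1/2) *\<^sub>R (\<Sum>j\<in>?J. t j *\<^sub>R lmul (rot j) c \<alpha>)) x"
    by (simp add: lmul_def torus_gen_def sum_distrib_right)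
  also have "\<dots> = (1/2) *\<^sub>R (\<Sum>j\<in>?J. t j *\<^sub>R pol (lmul (rot j) c) x)"
    using c by (simp add: pol_scaleR pol_sum fin_supp_sum fin_supp_lmul fin_supp_scaleR del: scaleR_half_double)
  finally show "(1/2) *\<^sub>R (\<Sum>j\<in>?J. t j *\<^sub>R R_op (nth_index (2 * j)) (R_op (nth_index (2 * j - 1)) (pol c)) x)
      = pol (lmul (torus_gen t) c) x"
    using c by (simp add: R_op_pol fin_supp_lmul lmul_lmul rot_def)
qed


section \<open>Conjugation\<close>

definition e_blade :: "'n::{finite,linorder} set \<Rightarrow> 'n cliff" where
  "e_blade A = blade (Inl ` A)"

definition e_blade_rev :: "'n::{finite,linorder} set \<Rightarrow> 'n cliff" where
  "e_blade_rev A = prod_list (map e_vec (rev (sorted_list_of_set A)))"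

lemma prod_list_sorted_e_vec:
  "sorted_wrt (<) l \<Longrightarrow> prod_list (map e_vec l) = e_blade (set l)"
proof (induction l)
  case Nil
  then show ?case by (simp add: e_blade_def one_cliff_def)
next
  case (Cons i l)
  have "blade_sign {Inl i} (Inl ` set l :: ('a + 'a) set) = 1"
    using Cons.prems by (auto simp: blade_sign_def intro!: prod.neutral)
  moreover have "sym_diff {Inl i} (Inl ` set l) = (Inl ` set (i # l) :: ('a + 'a) set)"
    using Cons.prems by auto
  ultimately have "e_vec i * e_blade (set l) = e_blade (set (i # l))"
    by (simp only: e_vec_def e_blade_def blade_mult scaleC_1)
  then show ?case using Cons by simp
qed

lemma e_blade_eq: "e_blade A = prod_list (map e_vec (sorted_list_of_set A))"
  by (simp add: prod_list_sorted_e_vec strict_sorted_list_of_set)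

lemma e_blade_inverse: "e_blade A * e_blade_rev A = 1" "e_blade_rev A * e_blade A = 1"
  using prod_list_involutions [of e_vec "sorted_list_of_set A"]
    prod_list_involutions [of e_vec "rev (sorted_list_of_set A)"]
  by (simp_all add: e_blade_eq e_blade_rev_def e_vec_sq)

lemma R_ops_pol:
  "fin_supp c \<Longrightarrow> foldr (\<circ>) (map R_op l) id (pol c) = pol (lmul (prod_list (map e_vec l)) c)"
  by (induction l) (simp_all add: lmul_def R_op_pol fin_supp_lmul [unfolded lmul_def] mult.assoc)

lemma R_blade_pol: "fin_supp c \<Longrightarrow> R_blade A (pol c) = pol (lmul (e_blade A) c)"
  and R_blade_rev_pol: "fin_supp c \<Longrightarrow> R_blade_rev A (pol c) = pol (lmul (e_blade_rev A) c)"
  by (simp_all add: R_blade_def R_blade_rev_def R_ops_pol e_blade_eq e_blade_rev_def)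

text \<open>The real span of the ordered products of the e_j, the counterpart of the real algebra
  generated by the R_j. Conjugation of operators is defined through real coefficients, so torus
  elements have to be placed in this set.\<close>

definition real_e_alg :: "'n::{finite,linorder} cliff set" where
  "real_e_alg = {x. \<forall>C. coeff x C \<in> \<real> \<and> (\<not> C \<subseteq> range Inl \<longrightarrow> coeff x C = 0)}"

lemma real_e_alg_1: "1 \<in> real_e_alg"
  and real_e_alg_e_vec: "e_vec j \<in> real_e_alg"
  and real_e_alg_0: "0 \<in> real_e_alg"
  and real_e_alg_add: "x \<in> real_e_alg \<Longrightarrow> y \<in> real_e_alg \<Longrightarrow> x + y \<in> real_e_alg"
  and real_e_alg_scaleR: "x \<in> real_e_alg \<Longrightarrow> r *\<^sub>R x \<in> real_e_alg"
  by (auto simp: real_e_alg_def coeff_1 e_vec_def coeff_blade)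

lemma real_e_alg_sum: "(\<And>i. i \<in> I \<Longrightarrow> f i \<in> real_e_alg) \<Longrightarrow> sum f I \<in> real_e_alg"
  by (induction I rule: infinite_finite_induct) (auto simp: real_e_alg_0 real_e_alg_add)

lemma real_e_alg_mult:
  fixes x y :: "'n::{finite,linorder} cliff"
  assumes "x \<in> real_e_alg" "y \<in> real_e_alg"
  shows "x * y \<in> real_e_alg"
  unfolding real_e_alg_def
proof (intro CollectI allI conjI impI)
  fix C :: "('n + 'n) set"
  have "blade_sign A B \<in> \<real>" for A B :: "('n + 'n) set"
    unfolding blade_sign_def by (intro prod_in_Reals) auto
  then show "coeff (x * y) C \<in> \<real>"
    unfolding coeff_mult using assms by (intro sum_in_Reals Reals_mult) (auto simp: real_e_alg_def)
  assume C: "\<not> C \<subseteq> range Inl"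
  have "coeff x A * coeff y (sym_diff A C) = 0" for A
  proof (cases "A \<subseteq> range Inl")
    case True
    then have "\<not> sym_diff A C \<subseteq> range Inl" using C by blast
    then show ?thesis using assms by (simp add: real_e_alg_def)
  next
    case False
    then show ?thesis using assms by (simp add: real_e_alg_def)
  qed
  then show "coeff (x * y) C = 0" unfolding coeff_mult by (simp only: mult.assoc mult_zero_right sum.neutral_const)
qed

lemma real_e_alg_power: "x \<in> real_e_alg \<Longrightarrow> x ^ n \<in> real_e_alg"
  by (induction n) (auto simp: real_e_alg_1 real_e_alg_mult)

text \<open>Membership is a condition on single coordinates, and both being real and being zero pass
  to the limit of the exponential series.\<close>

lemma real_e_alg_exp:
  fixes x :: "'n::{finite,linorder} cliff"
  assumes "x \<in> real_e_alg"
  shows "exp x \<in> real_e_alg"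
  unfolding real_e_alg_def
proof (intro CollectI allI conjI impI)
  fix C :: "('n + 'n) set"
  have "x ^ k /\<^sub>R fact k \<in> real_e_alg" for k
    using assms by (intro real_e_alg_scaleR real_e_alg_power)
  then have V: "coeff (x ^ k /\<^sub>R fact k) C \<in> \<real>"
    "\<not> C \<subseteq> range Inl \<Longrightarrow> coeff (x ^ k /\<^sub>R fact k) C = 0" for k
    unfolding real_e_alg_def by blast+
  have S: "(\<lambda>k. coeff (x ^ k /\<^sub>R fact k) C) sums coeff (exp x) C"
    by (rule bounded_linear.sums [OF bounded_linear_coeff exp_converges])
  have "(\<lambda>k. Im (coeff (x ^ k /\<^sub>R fact k) C)) sums Im (coeff (exp x) C)"
    by (rule sums_Im [OF S])
  moreover have "Im (coeff (x ^ k /\<^sub>R fact k) C) = 0" for k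
    using V(1) complex_is_Real_iff by blast
  ultimately show "coeff (exp x) C \<in> \<real>"
    by (simp add: complex_is_Real_iff sums_iff del: coeff_scaleR)
  show "coeff (exp x) C = 0" if "\<not> C \<subseteq> range Inl"
    using S unfolding V(2) [OF that] by (simp add: sums_iff)
qed

lemma real_e_alg_expand:
  fixes x :: "'n::{finite,linorder} cliff"
  assumes "x \<in> real_e_alg"
  shows "x = (\<Sum>A\<in>UNIV. coeff x (Inl ` A) *\<^sub>C e_blade A)"
proof (rule cliff_eqI)
  fix C :: "('n + 'n) set"
  show "coeff x C = coeff (\<Sum>A\<in>UNIV. coeff x (Inl ` A) *\<^sub>C e_blade A) C"
  proof (cases "C \<subseteq> range Inl")
    case True
    then obtain B where B: "C = Inl ` B" by (auto simp: subset_image_iff)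
    have "coeff (\<Sum>A\<in>UNIV. coeff x (Inl ` A) *\<^sub>C e_blade A) C
        = (\<Sum>A\<in>UNIV. if A = B then coeff x C else 0)"
      unfolding coeff_sum coeff_scaleC e_blade_def coeff_blade B
      by (intro sum.cong) (auto simp: inj_image_eq_iff)
    then show ?thesis by simp
  next
    case False
    then have "coeff (e_blade A) C = 0" for A by (auto simp: e_blade_def coeff_blade)
    then show ?thesis using False assms by (simp add: real_e_alg_def)
  qed
qed

text \<open>Clifford conjugation, made complex linear on all coordinates by discarding those outside
  the products of the e_j; on \<open>real_e_alg\<close> nothing is discarded.\<close>

definition bar :: "'n::{finite,linorder} cliff \<Rightarrow> 'n cliff" where
  "bar x = (\<Sum>A\<in>UNIV. coeff x (Inl ` A) *\<^sub>C (- 1) ^ card A *\<^sub>C e_blade_rev A)"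

lemma bounded_linear_bar: "bounded_linear bar"
  unfolding bar_def
  by (intro bounded_linear_sum bounded_linear_compose [OF bounded_linear_scaleC_left]
      bounded_linear_coeff)

lemma bar_scaleC: "bar (c *\<^sub>C x) = c *\<^sub>C bar x"
  by (simp add: bar_def scaleC_sum mult.assoc)

lemma bar_e_blade: "bar (e_blade A) = (- 1) ^ card A *\<^sub>C e_blade_rev A"
proof -
  have "bar (e_blade A) = (\<Sum>B\<in>UNIV. if B = A then (- 1) ^ card A *\<^sub>C e_blade_rev A else 0)"
    unfolding bar_def
    by (intro sum.cong) (auto simp: e_blade_def coeff_blade inj_image_eq_iff)
  then show ?thesis by simp
qed

text \<open>
  Products reverse because \<open>e_blade_rev A\<close> is the inverse of \<open>e_blade A\<close> and a product of blades is
  a blade up to sign.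
\<close>

lemma bar_e_blade_mult:
  fixes A B :: "'n::{finite,linorder} set"
  shows "bar (e_blade A * e_blade B) = bar (e_blade B) * bar (e_blade A)"
proof -
  let ?D = "sym_diff A B" and ?s = "blade_sign (Inl ` A) (Inl ` B :: ('n + 'n) set)"
  have s: "?s * ?s = 1"
    by (auto simp: blade_sign_def prod.distrib [symmetric] intro!: prod.neutral)
  have D: "sym_diff (Inl ` A) (Inl ` B) = (Inl ` ?D :: ('n + 'n) set)" by auto
  have p: "e_blade A * e_blade B = ?s *\<^sub>C e_blade ?D"
    unfolding e_blade_def blade_mult D ..
  have "?s *\<^sub>C e_blade_rev ?D
      = ?s *\<^sub>C (e_blade_rev ?D * (e_blade A * (e_blade B * e_blade_rev B) * e_blade_rev A))"
    by (simp add: e_blade_inverse)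
  also have "\<dots> = ?s *\<^sub>C (e_blade_rev ?D * (e_blade A * e_blade B) * (e_blade_rev B * e_blade_rev A))"
    by (simp only: mult.assoc)
  also have "\<dots> = e_blade_rev B * e_blade_rev A"
    unfolding p by (simp add: e_blade_inverse s)
  finally have r: "?s *\<^sub>C e_blade_rev ?D = e_blade_rev B * e_blade_rev A" .
  \<comment> \<open>The cardinality of a symmetric difference has the parity of the sum of the two
    cardinalities.\<close>
  have "(\<Prod>i\<in>?D. - 1 :: complex) = (\<Prod>i\<in>A. - 1) * (\<Prod>i\<in>B. - 1)"
    by (rule sign_cancel) auto
  then have c: "(- 1 :: complex) ^ card ?D = (- 1) ^ card A * (- 1) ^ card B" by simp
  have "bar (e_blade A * e_blade B) = (- 1) ^ card ?D *\<^sub>C ?s *\<^sub>C e_blade_rev ?D"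
    unfolding p bar_scaleC bar_e_blade by (simp add: mult.commute)
  then show ?thesis
    unfolding r c by (simp add: bar_e_blade mult.commute)
qed

lemma bar_mult:
  assumes x: "x \<in> real_e_alg" and y: "y \<in> real_e_alg"
  shows "bar (x * y) = bar y * bar x"
proof -
  let ?x = "\<lambda>A. coeff x (Inl ` A)" and ?y = "\<lambda>A. coeff y (Inl ` A)"
  have sum: "bar (sum f I) = (\<Sum>i\<in>I. bar (f i))" for f :: "'b \<Rightarrow> 'a cliff" and I
    by (rule linear_sum [OF bounded_linear.linear [OF bounded_linear_bar]])
  have ex: "bar z = (\<Sum>A\<in>UNIV. coeff z (Inl ` A) *\<^sub>C bar (e_blade A))" for z :: "'a cliff"
    unfolding bar_e_blade by (rule bar_def)
  have "x * y = (\<Sum>A\<in>UNIV. ?x A *\<^sub>C e_blade A) * (\<Sum>B\<in>UNIV. ?y B *\<^sub>C e_blade B)"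
    using real_e_alg_expand [OF x] real_e_alg_expand [OF y] by simp
  also have "\<dots> = (\<Sum>A\<in>UNIV. \<Sum>B\<in>UNIV. ?x A *\<^sub>C ?y B *\<^sub>C (e_blade A * e_blade B))"
    by (simp add: sum_product mult.commute)
  finally have "bar (x * y) = (\<Sum>A\<in>UNIV. \<Sum>B\<in>UNIV. ?x A *\<^sub>C ?y B *\<^sub>C (bar (e_blade B) * bar (e_blade A)))"
    by (simp only: sum bar_scaleC bar_e_blade_mult)
  also have "\<dots> = (\<Sum>B\<in>UNIV. \<Sum>A\<in>UNIV. ?x A *\<^sub>C ?y B *\<^sub>C (bar (e_blade B) * bar (e_blade A)))"
    by (rule sum.swap)
  also have "\<dots> = bar y * bar x"
    unfolding ex [of y] ex [of x] sum_product by (simp add: mult.commute)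
  finally show ?thesis .
qed

lemma bar_1: "bar 1 = 1"
  using bar_e_blade [of "{}"] by (simp add: e_blade_rev_def e_blade_eq)

lemma bar_e_vec: "bar (e_vec j) = - e_vec j"
  using bar_e_blade [of "{j}"] by (simp add: e_blade_rev_def e_blade_eq)

lemma bar_exp:
  assumes x: "x \<in> real_e_alg" and bar: "bar x = - x"
  shows "bar (exp x) = exp (- x)"
proof -
  have p: "bar (x ^ k) = (- x) ^ k" for k
  proof (induction k)
    case (Suc k)
    then show ?case
      by (simp add: bar_mult x real_e_alg_power bar power_commutes del: mult_minus_left mult_minus_right)
  qed (simp add: bar_1)
  have "(\<lambda>k. bar (x ^ k /\<^sub>R fact k)) sums bar (exp x)"
    by (rule bounded_linear.sums [OF bounded_linear_bar exp_converges])
  then have "(\<lambda>k. (- x) ^ k /\<^sub>R fact k) sums bar (exp x)"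
    by (simp add: linear_scale [OF bounded_linear.linear [OF bounded_linear_bar]] p)
  then show ?thesis using exp_converges [of "- x"] by (simp add: sums_unique2)
qed

section \<open>Conjugation of operators on polynomials\<close>

lemma op_coeff_eq:
  fixes s :: "'n::{finite,linorder} opr"
  assumes s: "\<And>c. fin_supp c \<Longrightarrow> s (pol c) = pol (lmul \<sigma> c)" and V: "\<sigma> \<in> real_e_alg"
  shows "op_coeff s = (\<lambda>A. Re (coeff \<sigma> (Inl ` A)))"
  unfolding op_coeff_def
proof (rule the_equality)
  have re: "of_real (Re (coeff \<sigma> C)) = coeff \<sigma> C" for C
    using V by (simp add: real_e_alg_def complex_is_Real_iff complex_eq_iff)
  have ex: "\<sigma> = (\<Sum>A\<in>UNIV. Re (coeff \<sigma> (Inl ` A)) *\<^sub>R e_blade A)"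
    using real_e_alg_expand [OF V] by (simp add: scaleR_eq_scaleC re)
  show "\<forall>f\<in>dpolys. s f = (\<lambda>x. \<Sum>A\<in>UNIV. Re (coeff \<sigma> (Inl ` A)) *\<^sub>R R_blade A f x)"
  proof (intro ballI ext)
    fix f :: "'n dfun" and x assume "f \<in> dpolys"
    then obtain c where c: "fin_supp c" "f = pol c" by (auto simp: dpolys_iff_pol)
    have "s f x = pol (\<lambda>\<alpha>. \<Sum>A\<in>UNIV. Re (coeff \<sigma> (Inl ` A)) *\<^sub>R lmul (e_blade A) c \<alpha>) x"
      unfolding c(2) s [OF c(1)] lmul_def by (subst ex) (simp add: sum_distrib_right)
    also have "\<dots> = (\<Sum>A\<in>UNIV. Re (coeff \<sigma> (Inl ` A)) *\<^sub>R R_blade A f x)"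
      using c by (simp add: pol_sum pol_scaleR fin_supp_scaleR fin_supp_lmul R_blade_pol)
    finally show "s f x = (\<Sum>A\<in>UNIV. Re (coeff \<sigma> (Inl ` A)) *\<^sub>R R_blade A f x)" .
  qed
next
  fix a assume a: "\<forall>f\<in>dpolys. s f = (\<lambda>x. \<Sum>A\<in>UNIV. a A *\<^sub>R R_blade A f x)"
  \<comment> \<open>For uniqueness the constant function 1 suffices: there the operator identity
    becomes an expansion of \<sigma> in linearly independent blades.\<close>
  have "pol (delta 1) \<in> (dpolys :: 'n dfun set)" by (auto simp: dpolys_iff_pol intro!: exI [of _ "delta 1"])
  from a [rule_format, OF this] have 1: "s (pol (delta 1)) x = (\<Sum>A\<in>UNIV. a A *\<^sub>R R_blade A (pol (delta 1)) x)" for x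
    by (simp only:)
  have 2: "s (pol (delta 1)) = (\<lambda>_. \<sigma>)"
    by (subst s [OF fin_supp_delta]) (simp only: lmul_delta pol_delta mult_1_right)
  have 3: "R_blade A (pol (delta 1)) = (\<lambda>_. e_blade A)" for A :: "'n set"
    by (subst R_blade_pol [OF fin_supp_delta]) (simp only: lmul_delta pol_delta mult_1_right)
  have e: "\<sigma> = (\<Sum>A\<in>UNIV. a A *\<^sub>R e_blade A)" by (rule 1 [unfolded 2 3])
  show "a = (\<lambda>A. Re (coeff \<sigma> (Inl ` A)))"
  proof
    fix B
    have "coeff \<sigma> (Inl ` B) = (\<Sum>A\<in>UNIV. if A = B then of_real (a B) else 0)"
      unfolding e coeff_sum coeff_scaleR e_blade_def coeff_blade
      by (intro sum.cong) (auto simp: inj_image_eq_iff)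
    then show "a B = Re (coeff \<sigma> (Inl ` B))" by simp
  qed
qed

lemma op_conj_pol:
  fixes s :: "'n::{finite,linorder} opr"
  assumes s: "\<And>c. fin_supp c \<Longrightarrow> s (pol c) = pol (lmul \<sigma> c)" and V: "\<sigma> \<in> real_e_alg"
    and c: "fin_supp c"
  shows "op_conj s (pol c) = pol (lmul (bar \<sigma>) c)"
proof
  fix x
  have re: "of_real (Re (coeff \<sigma> C)) = coeff \<sigma> C" for C
    using V by (simp add: real_e_alg_def complex_is_Real_iff complex_eq_iff)
  let ?a = "\<lambda>A. Re (coeff \<sigma> (Inl ` A)) * (- 1) ^ card A"
  have "bar \<sigma> = (\<Sum>A\<in>UNIV. ?a A *\<^sub>R e_blade_rev A)"
    by (simp add: bar_def scaleR_eq_scaleC re)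
  then have "pol (lmul (bar \<sigma>) c) x = pol (\<lambda>\<alpha>. \<Sum>A\<in>UNIV. ?a A *\<^sub>R lmul (e_blade_rev A) c \<alpha>) x"
    by (simp add: lmul_def sum_distrib_right)
  also have "\<dots> = (\<Sum>A\<in>UNIV. ?a A *\<^sub>R pol (lmul (e_blade_rev A) c) x)"
    using c by (simp add: pol_sum pol_scaleR fin_supp_scaleR fin_supp_lmul)
  finally show "op_conj s (pol c) x = pol (lmul (bar \<sigma>) c) x"
    using c by (simp add: op_conj_def op_coeff_eq [OF s V] R_blade_rev_pol)
qed

section \<open>Rotation of the variables\<close>

lemma nth_index_inject:
  assumes "1 \<le> i" "i \<le> CARD('n)" "1 \<le> j" "j \<le> CARD('n)"
  shows "(nth_index i :: 'n::{finite,linorder}) = nth_index j \<longleftrightarrow> i = j"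
proof -
  have "distinct (sorted_list_of_set (UNIV :: 'n set))" by simp
  then show ?thesis
    unfolding nth_index_def using assms by (subst nth_eq_iff_index_eq) auto
qed

lemma rot_mult:
  fixes j :: nat
  assumes "1 \<le> j" "j \<le> CARD('n) div 2"
  defines "A \<equiv> e_vec (nth_index (2 * j - 1)) :: 'n::{finite,linorder} cliff"
    and "B \<equiv> e_vec (nth_index (2 * j))"
  shows "A * rot j = - B" "rot j * A = B" "B * rot j = A" "rot j * B = - A"
    "rot j * rot j = (- 1 :: 'n cliff)"
    "A * B = - rot j"
proof -
  have "(nth_index (2 * j - 1) :: 'n) \<noteq> nth_index (2 * j)"
    using assms by (subst nth_index_inject) auto
  then have AB: "A * B = - (B * A)" unfolding A_def B_def by (rule e_vec_anticomm)
  have sq: "A * A = 1" "B * B = 1" by (simp_all add: A_def B_def e_vec_sq)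
  have rot: "rot j = B * A" by (simp add: rot_def A_def B_def)
  have "A * rot j = (A * B) * A" by (simp only: rot mult.assoc)
  also have "\<dots> = - (B * (A * A))" by (simp only: AB mult.assoc mult_minus_left)
  finally show "A * rot j = - B" by (simp only: sq mult_1_right)
  show "rot j * A = B" by (simp only: rot mult.assoc sq mult_1_right)
  have "B * rot j = (B * B) * A" by (simp only: rot mult.assoc)
  then show "B * rot j = A" by (simp only: sq mult_1_left)
  have "rot j * B = B * (A * B)" by (simp only: rot mult.assoc)
  also have "\<dots> = - ((B * B) * A)" by (simp only: AB mult.assoc mult_minus_right)
  finally show 4: "rot j * B = - A" by (simp only: sq mult_1_left)
  have "rot j * rot j = (rot j * B) * A" by (simp only: rot mult.assoc)
  then show "rot j * rot j = (- 1 :: 'n cliff)" by (simp only: 4 sq mult_minus_left)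
  show "A * B = - rot j" by (simp only: AB rot)
qed

lemma commute_anticommuting_product:
  fixes x :: "'a::ring_1"
  assumes "x * y = - (y * x)" "x * z = - (z * x)"
  shows "x * (y * z) = y * z * x"
proof -
  have "x * (y * z) = - (y * (x * z))" using assms(1) by (simp flip: mult.assoc)
  then show ?thesis using assms(2) by (simp add: mult.assoc)
qed

lemma e_vec_rot_commute:
  "x \<noteq> nth_index (2 * j - 1) \<Longrightarrow> x \<noteq> nth_index (2 * j) \<Longrightarrow> e_vec x * rot j = rot j * e_vec x"
  unfolding rot_def by (intro commute_anticommuting_product e_vec_anticomm)

lemma e_perp_rot_commute: "e_perp x * rot j = rot j * e_perp x"
  unfolding rot_def by (intro commute_anticommuting_product) (simp_all add: e_vec_e_perp_anticomm)

text \<open>The other bivectors share no index with A and B and commute with them. For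
  \<open>rot 1\<close> the commutator doubles the product, which cancels the factor 1/2 in
  \<open>torus_gen\<close>.\<close>

lemma torus_gen_commutator:
  fixes t :: "nat \<Rightarrow> real"
  assumes card: "CARD('n::{finite,linorder}) \<ge> 2"
  defines "A \<equiv> e_vec (nth_index 1) :: 'n cliff" and "B \<equiv> e_vec (nth_index 2)"
  shows "torus_gen t * A = A * torus_gen t + t 1 *\<^sub>R B"
    and "torus_gen t * B = B * torus_gen t - t 1 *\<^sub>R A"
proof -
  let ?J = "{1..CARD('n) div 2}"
  have com: "torus_gen t * x = x * torus_gen t + t 1 *\<^sub>R y"
    if 1: "rot 1 * x - x * rot 1 = y + y"
      and other: "\<And>j. j \<in> ?J - {1} \<Longrightarrow> rot j * x = x * rot j" for x y :: "'n cliff"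
  proof -
    have "torus_gen t * x - x * torus_gen t
        = (1/2) *\<^sub>R (\<Sum>j\<in>?J. t j *\<^sub>R (rot j * x - x * rot j))"
      by (simp add: torus_gen_def sum_distrib_left sum_distrib_right sum_subtractf
          scaleR_diff_right)
    also have "(\<Sum>j\<in>?J. t j *\<^sub>R (rot j * x - x * rot j)) = (\<Sum>j\<in>{1}. t j *\<^sub>R (rot j * x - x * rot j))"
      using card other by (intro sum.mono_neutral_right) auto
    also have "(1/2) *\<^sub>R \<dots> = t 1 *\<^sub>R y" using 1 by (simp flip: scaleR_2)
    finally show ?thesis by (simp add: algebra_simps)
  qed
  have one: "1 \<le> (1::nat)" "1 \<le> CARD('n) div 2" using card by auto
  have r: "A * rot 1 = - B" "rot 1 * A = B" "B * rot 1 = A" "rot 1 * B = - A"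
    using rot_mult [where 'n = 'n, OF one] by (simp_all add: A_def B_def)
  have ne: "(nth_index i :: 'n) \<noteq> nth_index (2 * j - 1)" "(nth_index i :: 'n) \<noteq> nth_index (2 * j)"
    if "i \<in> {1, 2}" "j \<in> ?J - {1}" for i j
    using that by (auto simp: nth_index_inject)
  have AB: "rot j * A = A * rot j" "rot j * B = B * rot j" if "j \<in> ?J - {1}" for j
    using that ne [of 1 j] ne [of 2 j] unfolding A_def B_def
    by (simp_all add: e_vec_rot_commute)
  show "torus_gen t * A = A * torus_gen t + t 1 *\<^sub>R B"
    by (rule com) (simp_all only: r AB diff_minus_eq_add)
  have "torus_gen t * B = B * torus_gen t + t 1 *\<^sub>R (- A)"
    by (rule com) (simp_all only: r AB diff_conv_add_uminus)
  then show "torus_gen t * B = B * torus_gen t - t 1 *\<^sub>R A" by simp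
qed

lemma exp_scaleC_1: "exp (l *\<^sub>C (1 :: 'n::{finite,linorder} cliff)) = exp l *\<^sub>C 1"
  using exp_eigenvector [of "l *\<^sub>C 1" "1 :: 'n cliff" l] by simp

text \<open>The combinations \<open>A \<mp> \<i>B\<close> are eigenvectors of the commutator with the generator of the torus.\<close>

lemma exp_torus_gen_e_vec:
  fixes t :: "nat \<Rightarrow> real"
  assumes card: "CARD('n::{finite,linorder}) \<ge> 2"
  defines "A \<equiv> e_vec (nth_index 1) :: 'n cliff" and "B \<equiv> e_vec (nth_index 2)"
    and "c \<equiv> cos (of_real (t 1)) :: complex" and "s \<equiv> sin (of_real (t 1)) :: complex"
  shows "exp (torus_gen t) * A = (c *\<^sub>C A + s *\<^sub>C B) * exp (torus_gen t)"
    and "exp (torus_gen t) * B = ((- s) *\<^sub>C A + c *\<^sub>C B) * exp (torus_gen t)"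
proof -
  let ?G = "torus_gen t :: 'n cliff"
  note com = torus_gen_commutator [where 'n = 'n, OF card, of t, folded A_def B_def]
  have eig: "exp ?G * z = exp l *\<^sub>C (z * exp ?G)" if "?G * z = z * ?G + l *\<^sub>C z" for z l
  proof -
    \<comment> \<open>The relation says that z turns the generator into itself plus a central
      scalar, whose exponential splits off.\<close>
    have "exp ?G * z = z * exp (?G + l *\<^sub>C 1)"
      using that by (intro exp_intertwine) (simp add: distrib_left)
    also have "exp (?G + l *\<^sub>C 1) = exp ?G * exp (l *\<^sub>C 1)"
      by (rule exp_add_commuting) simp
    finally show ?thesis by (simp add: exp_scaleC_1)
  qed
  have e: "exp (\<i> * of_real (t 1)) = c + \<i> * s" "exp (- \<i> * of_real (t 1)) = c - \<i> * s"
    using exp_Euler [of "of_real (t 1)"] exp_Euler [of "- of_real (t 1)"]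
    by (simp_all add: c_def s_def)
  have "exp ?G * (A + (- \<i>) *\<^sub>C B) = exp (\<i> * of_real (t 1)) *\<^sub>C ((A + (- \<i>) *\<^sub>C B) * exp ?G)"
    by (rule eig, rule cliff_eqI) (simp add: distrib_left distrib_right com algebra_simps)
  moreover have "exp ?G * (A + \<i> *\<^sub>C B) = exp (- \<i> * of_real (t 1)) *\<^sub>C ((A + \<i> *\<^sub>C B) * exp ?G)"
    by (rule eig, rule cliff_eqI) (simp add: distrib_left distrib_right com algebra_simps)
  ultimately have h: "exp ?G * A - \<i> *\<^sub>C (exp ?G * B) = (c + \<i> * s) *\<^sub>C (A * exp ?G - \<i> *\<^sub>C (B * exp ?G))"
    "exp ?G * A + \<i> *\<^sub>C (exp ?G * B) = (c - \<i> * s) *\<^sub>C (A * exp ?G + \<i> *\<^sub>C (B * exp ?G))"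
    unfolding e by (simp_all add: distrib_left distrib_right left_diff_distrib right_diff_distrib)
  have k: "coeff (exp ?G * A) C = coeff ((c *\<^sub>C A + s *\<^sub>C B) * exp ?G) C \<and>
      coeff (exp ?G * B) C = coeff (((- s) *\<^sub>C A + c *\<^sub>C B) * exp ?G) C" for C
  proof -
    \<comment> \<open>Coordinatewise the two eigenvector equations form a linear system over the
      complex numbers; their sum and difference isolate the images of A and B.\<close>
    define ga gb a b where "ga = coeff (exp ?G * A) C" and "gb = coeff (exp ?G * B) C"
      and "a = coeff (A * exp ?G) C" and "b = coeff (B * exp ?G) C"
    have 1: "ga - \<i> * gb = (c + \<i> * s) * (a - \<i> * b)"
      using arg_cong [OF h(1), of "\<lambda>x. coeff x C"] by (simp add: ga_def gb_def a_def b_def)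
    have 2: "ga + \<i> * gb = (c - \<i> * s) * (a + \<i> * b)"
      using arg_cong [OF h(2), of "\<lambda>x. coeff x C"] by (simp add: ga_def gb_def a_def b_def)
    have "2 * ga = (ga - \<i> * gb) + (ga + \<i> * gb)" by simp
    also have "\<dots> = 2 * (c * a + s * b)" unfolding 1 2 by (simp add: algebra_simps)
    finally have "ga = c * a + s * b" by (simp only: mult_cancel_left) simp
    moreover have "2 * gb = - \<i> * ((ga + \<i> * gb) - (ga - \<i> * gb))" by (simp add: algebra_simps)
    then have "2 * gb = 2 * (- s * a + c * b)" unfolding 1 2 by (simp add: algebra_simps)
    then have "gb = - s * a + c * b" by (simp only: mult_cancel_left) simp
    ultimately show ?thesis by (simp add: distrib_right left_diff_distrib ga_def gb_def a_def b_def)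
  qed
  then show "exp ?G * A = (c *\<^sub>C A + s *\<^sub>C B) * exp ?G"
    "exp ?G * B = ((- s) *\<^sub>C A + c *\<^sub>C B) * exp ?G"
    by (auto intro: cliff_eqI)
qed

lemma rot_in_real_e_alg: "rot j \<in> real_e_alg"
  unfolding rot_def by (intro real_e_alg_mult real_e_alg_e_vec)

lemma torus_gen_in_real_e_alg: "torus_gen t \<in> real_e_alg"
  unfolding torus_gen_def by (intro real_e_alg_scaleR real_e_alg_sum rot_in_real_e_alg)

lemma bar_torus_gen: "bar (torus_gen t :: 'n::{finite,linorder} cliff) = - torus_gen t"
proof -
  have lin: "linear (bar :: 'n cliff \<Rightarrow> _)" by (rule bounded_linear.linear [OF bounded_linear_bar])
  have "bar (rot j) = - (rot j :: 'n cliff)" if "j \<in> {1..CARD('n) div 2}" for j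
  proof -
    have "bar (rot j :: 'n cliff) = e_vec (nth_index (2 * j - 1)) * e_vec (nth_index (2 * j))"
      by (simp add: rot_def bar_mult real_e_alg_e_vec bar_e_vec)
    then show ?thesis using that rot_mult(6) [where 'n = 'n, of j] by simp
  qed
  then show ?thesis
    by (simp add: torus_gen_def linear_scale [OF lin] linear_sum [OF lin] sum_negf
        del: scaleR_half_double)
qed

text \<open>Conjugation reverses each bivector and so negates it; the conjugate of a torus element
  is therefore its inverse.\<close>

lemma op_conj_torus_elt_pol:
  "fin_supp c \<Longrightarrow> op_conj (torus_elt t) (pol c) = pol (lmul (exp (- torus_gen t)) c)"
  by (simp add: op_conj_pol [OF torus_elt_pol real_e_alg_exp] torus_gen_in_real_e_alg
      bar_exp bar_torus_gen)


section \<open>Linear combinations of shifts\<close>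

text \<open>The sum over l of u_l times left multiplication by \<open>p l\<close>, the form of every
  operator here that is linear in xi.\<close>

definition shifts :: "('n::{finite,linorder} \<Rightarrow> 'n cliff) \<Rightarrow> (('n \<Rightarrow> nat) \<Rightarrow> 'n cliff) \<Rightarrow> ('n \<Rightarrow> nat) \<Rightarrow> 'n cliff" where
  "shifts p c = (\<lambda>\<alpha>. \<Sum>l\<in>UNIV. shift l (lmul (p l) c) \<alpha>)"

lemma fin_supp_shifts: "fin_supp c \<Longrightarrow> fin_supp (shifts p c)"
  unfolding shifts_def by (intro fin_supp_sum fin_supp_shift fin_supp_lmul)

lemma lmul_shifts: "lmul a (shifts p c) = shifts (\<lambda>l. a * p l) c"
  by (rule ext) (simp add: shifts_def lmul_def shift_def sum_distrib_left mult.assoc if_distrib cong: if_cong)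

lemma shifts_lmul: "shifts p (lmul a c) = shifts (\<lambda>l. p l * a) c"
  by (simp add: shifts_def lmul_lmul)

lemma xi_sum_pol: "fin_supp c \<Longrightarrow> xi_sum (pol c) = pol (shifts e_vec c)"
  by (rule ext) (simp add: xi_sum_def xi_pol shifts_def pol_sum fin_supp_shift fin_supp_lmul)

lemma bracket_pol:
  assumes X: "\<And>c. fin_supp c \<Longrightarrow> X (pol c) = pol (shifts p c)"
    and Y: "\<And>c. fin_supp c \<Longrightarrow> Y (pol c) = pol (lmul z c)" and c: "fin_supp c"
  shows "bracket X Y (pol c) = pol (shifts (\<lambda>l. (1/2) *\<^sub>C (p l * z + z * p l)) c)"
proof
  fix x
  have "bracket X Y (pol c) x = (1/2) *\<^sub>C (pol (shifts (\<lambda>l. p l * z) c) x + pol (shifts (\<lambda>l. z * p l) c) x)"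
    using c by (simp add: bracket_def X Y fin_supp_shifts fin_supp_lmul shifts_lmul lmul_shifts)
  also have "\<dots> = pol (\<lambda>\<alpha>. (1/2) *\<^sub>C (shifts (\<lambda>l. p l * z) c \<alpha> + shifts (\<lambda>l. z * p l) c \<alpha>)) x"
    using c by (simp add: pol_scaleC pol_add fin_supp_shifts fin_supp_add)
  also have "(\<lambda>\<alpha>. (1/2) *\<^sub>C (shifts (\<lambda>l. p l * z) c \<alpha> + shifts (\<lambda>l. z * p l) c \<alpha>))
      = shifts (\<lambda>l. (1/2) *\<^sub>C (p l * z + z * p l)) c"
    unfolding shifts_def sum.distrib [symmetric] scaleC_sum
    by (intro ext sum.cong) (auto simp: shift_def lmul_def distrib_right)
  finally show "bracket X Y (pol c) x = pol (shifts (\<lambda>l. (1/2) *\<^sub>C (p l * z + z * p l)) c) x" .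
qed

text \<open>Multiplication by the scalar linear form p u_i + q u_j. Its coefficients being complex
  numbers, it commutes with left multiplications and with its own kind, unlike
  \<open>shifts\<close>.\<close>

definition shift2 :: "'n \<Rightarrow> 'n \<Rightarrow> complex \<Rightarrow> complex \<Rightarrow> (('n::{finite,linorder} \<Rightarrow> nat) \<Rightarrow> 'n cliff)
    \<Rightarrow> ('n \<Rightarrow> nat) \<Rightarrow> 'n cliff" where
  "shift2 i j p q c = (\<lambda>\<alpha>. p *\<^sub>C shift i c \<alpha> + q *\<^sub>C shift j c \<alpha>)"

lemma shifts_eq_shift2:
  assumes "i \<noteq> j" "\<And>l. P l = (if l = i then p else if l = j then q else 0) *\<^sub>C 1"
  shows "shifts P c = shift2 i j p q c"
proof
  fix \<alpha>
  have "shifts P c \<alpha> = (\<Sum>l\<in>{i, j}. shift l (lmul (P l) c) \<alpha>)"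
    unfolding shifts_def using assms by (intro sum.mono_neutral_right) (auto simp: shift_def lmul_def)
  then show "shifts P c \<alpha> = shift2 i j p q c \<alpha>"
    using assms by (simp add: shift2_def shift_def lmul_def)
qed

lemma fin_supp_shift2: "fin_supp c \<Longrightarrow> fin_supp (shift2 i j p q c)"
  unfolding shift2_def by (intro fin_supp_add fin_supp_scaleC fin_supp_shift)

lemma lmul_shift2: "lmul a (shift2 i j p q c) = shift2 i j p q (lmul a c)"
  by (rule ext) (simp add: lmul_def shift2_def shift_def distrib_left)

lemma shift2_mult_right: "shift2 i j p q (\<lambda>\<alpha>. c \<alpha> * d) = (\<lambda>\<alpha>. shift2 i j p q c \<alpha> * d)"
  by (rule ext) (simp add: shift2_def shift_def distrib_right)

lemma shift2_add: "shift2 i j p q (\<lambda>\<alpha>. c \<alpha> + d \<alpha>) = (\<lambda>\<alpha>. shift2 i j p q c \<alpha> + shift2 i j p q d \<alpha>)"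
  by (rule ext) (simp add: shift2_def shift_def scaleC_add algebra_simps)

lemma shift2_scaleC: "shift2 i j p q (\<lambda>\<alpha>. k *\<^sub>C c \<alpha>) = (\<lambda>\<alpha>. k *\<^sub>C shift2 i j p q c \<alpha>)"
  by (rule ext) (simp add: shift2_def shift_def scaleC_add mult.commute)

lemma shift2_0: "shift2 i j p q (\<lambda>\<alpha>. 0) = (\<lambda>\<alpha>. 0)"
  by (rule ext) (simp add: shift2_def shift_def)

lemma shift2_sum:
  "shift2 i j p q (\<lambda>\<alpha>. \<Sum>l\<in>L. c l \<alpha>) = (\<lambda>\<alpha>. \<Sum>l\<in>L. shift2 i j p q (c l) \<alpha>)"
  by (induction L rule: infinite_finite_induct) (simp_all add: shift2_0 shift2_add)

lemma shift_commute: "shift i (shift j c) = shift j (shift i c)"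
  by (cases "i = j") (auto simp: shift_def fun_upd_twist)

lemma shift2_commute: "shift2 i j p q (shift2 i j p' q' c) = shift2 i j p' q' (shift2 i j p q c)"
proof
  fix \<alpha>
  have "shift l (shift2 i j p q c) \<alpha> = p *\<^sub>C shift l (shift i c) \<alpha> + q *\<^sub>C shift l (shift j c) \<alpha>" for l p q
    by (simp add: shift2_def shift_def)
  then show "shift2 i j p q (shift2 i j p' q' c) \<alpha> = shift2 i j p' q' (shift2 i j p q c) \<alpha>"
    using shift_commute [of i j c]
    by (simp add: shift2_def [of _ _ _ _ "shift2 _ _ _ _ _"] scaleC_add algebra_simps)
qed

lemma funpow_fin_supp:
  fixes w :: "('a \<Rightarrow> 'b::zero) \<Rightarrow> ('a \<Rightarrow> 'b)"
  assumes "\<And>c. fin_supp c \<Longrightarrow> fin_supp (w c)" "fin_supp c"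
  shows "fin_supp ((w ^^ k) c)"
  by (induction k) (simp_all add: assms)

lemma funpow_commute:
  assumes "\<And>c. h (w c) = w (h c)"
  shows "h ((w ^^ k) c) = (w ^^ k) (h c)"
  by (induction k) (auto simp: assms)

lemma funpow_shift2_add: "(shift2 i j p q ^^ k) (\<lambda>\<alpha>. c \<alpha> + d \<alpha>)
    = (\<lambda>\<alpha>. (shift2 i j p q ^^ k) c \<alpha> + (shift2 i j p q ^^ k) d \<alpha>)"
  by (induction k) (simp_all add: shift2_add)

lemma funpow_shift2_scaleC:
  "(shift2 i j p q ^^ k) (\<lambda>\<alpha>. r *\<^sub>C c \<alpha>) = (\<lambda>\<alpha>. r *\<^sub>C (shift2 i j p q ^^ k) c \<alpha>)"
  by (induction k) (simp_all add: shift2_scaleC)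

lemma funpow_shift2_mult_right:
  "(shift2 i j p q ^^ k) (\<lambda>\<alpha>. c \<alpha> * d) = (\<lambda>\<alpha>. (shift2 i j p q ^^ k) c \<alpha> * d)"
  by (induction k) (simp_all add: shift2_mult_right)

lemma funpow_shift2_0: "(shift2 i j p q ^^ k) (\<lambda>_. 0) = (\<lambda>_. 0)"
  by (induction k) (simp_all add: shift2_0)

lemma fin_supp_funpow_shift2: "fin_supp c \<Longrightarrow> fin_supp ((shift2 i j p q ^^ k) c)"
  by (rule funpow_fin_supp [OF fin_supp_shift2])

lemma lmul_funpow_shift2: "lmul a ((shift2 i j p q ^^ k) c) = (shift2 i j p q ^^ k) (lmul a c)"
  by (rule funpow_commute) (rule lmul_shift2)

lemma delta_add: "delta (c + d :: 'b::monoid_add) = (\<lambda>\<alpha>. delta c \<alpha> + delta d \<alpha>)"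
  and delta_scaleC: "delta (r *\<^sub>C x) = (\<lambda>\<alpha>. r *\<^sub>C delta x \<alpha>)"
  and delta_mult_right: "delta (u * v :: 'a::{finite,linorder} cliff) = (\<lambda>\<alpha>. delta u \<alpha> * v)"
  and delta_0: "delta 0 = (\<lambda>_. 0)"
  by (auto simp: delta_def)

text \<open>
  \<open>rot_mono i j c s \<alpha> d\<close> is \<open>u\<^sup>\<alpha>[1] d\<close> after rotating \<open>(u\<^sub>i, u\<^sub>j)\<close>, for \<open>\<alpha>\<close> supported on \<open>{i, j}\<close>, and
  \<open>rot_subst\<close> is the resulting substitution on polynomials in \<open>u\<^sub>i\<close> and \<open>u\<^sub>j\<close>.
\<close>

definition rot_mono :: "'n \<Rightarrow> 'n \<Rightarrow> complex \<Rightarrow> complex \<Rightarrow> ('n::{finite,linorder} \<Rightarrow> nat) \<Rightarrow> 'n cliff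
    \<Rightarrow> ('n \<Rightarrow> nat) \<Rightarrow> 'n cliff" where
  "rot_mono i j c s \<alpha> d = (shift2 i j c s ^^ \<alpha> i) ((shift2 i j (- s) c ^^ \<alpha> j) (delta d))"

definition rot_subst :: "'n \<Rightarrow> 'n \<Rightarrow> complex \<Rightarrow> complex \<Rightarrow> (('n::{finite,linorder} \<Rightarrow> nat) \<Rightarrow> 'n cliff)
    \<Rightarrow> ('n \<Rightarrow> nat) \<Rightarrow> 'n cliff" where
  "rot_subst i j c s f = (\<lambda>\<beta>. \<Sum>\<alpha> | f \<alpha> \<noteq> 0. rot_mono i j c s \<alpha> (f \<alpha>) \<beta>)"

lemma rot_mono_add: "rot_mono i j c s \<alpha> (d + d') \<beta> = rot_mono i j c s \<alpha> d \<beta> + rot_mono i j c s \<alpha> d' \<beta>"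
  and rot_mono_scaleC: "rot_mono i j c s \<alpha> (r *\<^sub>C d) \<beta> = r *\<^sub>C rot_mono i j c s \<alpha> d \<beta>"
  and rot_mono_mult_right: "rot_mono i j c s \<alpha> (u * v) \<beta> = rot_mono i j c s \<alpha> u \<beta> * v"
  and rot_mono_0: "rot_mono i j c s \<alpha> 0 \<beta> = 0"
  by (simp_all add: rot_mono_def delta_add delta_scaleC delta_mult_right delta_0 funpow_shift2_add
      funpow_shift2_scaleC funpow_shift2_mult_right funpow_shift2_0)

lemma fin_supp_rot_mono: "fin_supp (rot_mono i j c s \<alpha> d)"
  unfolding rot_mono_def by (intro fin_supp_funpow_shift2 fin_supp_delta)

lemma rot_mono_incr:
  assumes "i \<noteq> j"
  shows "rot_mono i j c s (incr i \<alpha>) d = shift2 i j c s (rot_mono i j c s \<alpha> d)"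
    and "rot_mono i j c s (incr j \<alpha>) d = shift2 i j (- s) c (rot_mono i j c s \<alpha> d)"
  using assms by (simp_all add: rot_mono_def incr_other
      funpow_commute [of "shift2 i j (- s) c" "shift2 i j c s", OF shift2_commute])

lemma rot_subst_superset:
  assumes "finite A" "{\<alpha>. f \<alpha> \<noteq> 0} \<subseteq> A"
  shows "rot_subst i j c s f \<beta> = (\<Sum>\<alpha>\<in>A. rot_mono i j c s \<alpha> (f \<alpha>) \<beta>)"
  unfolding rot_subst_def using assms by (intro sum.mono_neutral_left) (auto simp: rot_mono_0)

lemma rot_subst_delta: "rot_subst i j c s (delta d) = delta d"
  by (rule ext, subst rot_subst_superset [OF _ supp_delta]) (simp_all add: delta_def rot_mono_def)

lemma rot_subst_shift:
  assumes B: "finite B" "incr l ` {\<alpha>. f \<alpha> \<noteq> 0} \<subseteq> B"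
    and w: "\<And>\<alpha> d. rot_mono i j c s (incr l \<alpha>) d = w (rot_mono i j c s \<alpha> d)"
    and w_def: "w = shift2 i j p q"
  shows "(\<Sum>\<alpha>\<in>B. rot_mono i j c s \<alpha> (shift l f \<alpha>) \<beta>) = w (rot_subst i j c s f) \<beta>"
proof -
  let ?A = "{\<alpha>. f \<alpha> \<noteq> 0}"
  have "(\<Sum>\<alpha>\<in>B. rot_mono i j c s \<alpha> (shift l f \<alpha>) \<beta>)
      = (\<Sum>\<alpha>\<in>incr l ` ?A. rot_mono i j c s \<alpha> (shift l f \<alpha>) \<beta>)"
  proof (rule sum.mono_neutral_right [OF B])
    have "shift l f \<alpha> = 0" if "\<alpha> \<notin> incr l ` ?A" for \<alpha>
      using supp_shift [of l f] that by blast
    then show "\<forall>\<alpha>\<in>B - incr l ` ?A. rot_mono i j c s \<alpha> (shift l f \<alpha>) \<beta> = 0"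
      by (simp add: rot_mono_0)
  qed
  also have "\<dots> = (\<Sum>\<alpha>\<in>?A. w (rot_mono i j c s \<alpha> (f \<alpha>)) \<beta>)"
    using inj_incr [of l] by (subst sum.reindex) (auto intro: inj_on_subset simp: shift_def w)
  also have "\<dots> = w (rot_subst i j c s f) \<beta>"
    by (simp add: rot_subst_def w_def shift2_sum)
  finally show ?thesis .
qed

text \<open>The substitution respects multiplication by the variables: u_i goes to c u_i + s u_j,
  and u_j to -s u_i + c u_j. Since the linear forms commute, a new factor can join the power to
  which it belongs.\<close>

lemma rot_subst_shift2:
  assumes ij: "i \<noteq> j" and f: "fin_supp f"
  shows "rot_subst i j c s (shift2 i j p q f) = (\<lambda>\<beta>. p *\<^sub>C shift2 i j c s (rot_subst i j c s f) \<beta>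
    + q *\<^sub>C shift2 i j (- s) c (rot_subst i j c s f) \<beta>)"
proof
  fix \<beta>
  let ?A = "{\<alpha>. f \<alpha> \<noteq> 0}"
  let ?B = "incr i ` ?A \<union> incr j ` ?A"
  have "{\<alpha>. shift2 i j p q f \<alpha> \<noteq> 0} \<subseteq> {\<alpha>. shift i f \<alpha> \<noteq> 0} \<union> {\<alpha>. shift j f \<alpha> \<noteq> 0}"
    by (auto simp: shift2_def)
  then have "{\<alpha>. shift2 i j p q f \<alpha> \<noteq> 0} \<subseteq> ?B" using supp_shift [of i f] supp_shift [of j f] by blast
  then have "rot_subst i j c s (shift2 i j p q f) \<beta>
      = (\<Sum>\<alpha>\<in>?B. rot_mono i j c s \<alpha> (shift2 i j p q f \<alpha>) \<beta>)"
    using f by (intro rot_subst_superset) auto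
  also have "\<dots> = p *\<^sub>C (\<Sum>\<alpha>\<in>?B. rot_mono i j c s \<alpha> (shift i f \<alpha>) \<beta>)
      + q *\<^sub>C (\<Sum>\<alpha>\<in>?B. rot_mono i j c s \<alpha> (shift j f \<alpha>) \<beta>)"
    by (simp add: shift2_def rot_mono_add rot_mono_scaleC sum.distrib scaleC_sum)
  also have "(\<Sum>\<alpha>\<in>?B. rot_mono i j c s \<alpha> (shift i f \<alpha>) \<beta>) = shift2 i j c s (rot_subst i j c s f) \<beta>"
    using f by (intro rot_subst_shift rot_mono_incr(1) [OF ij]) auto
  also have "(\<Sum>\<alpha>\<in>?B. rot_mono i j c s \<alpha> (shift j f \<alpha>) \<beta>) = shift2 i j (- s) c (rot_subst i j c s f) \<beta>"
    using f by (intro rot_subst_shift rot_mono_incr(2) [OF ij]) auto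
  finally show "rot_subst i j c s (shift2 i j p q f) \<beta> = p *\<^sub>C shift2 i j c s (rot_subst i j c s f) \<beta>
    + q *\<^sub>C shift2 i j (- s) c (rot_subst i j c s f) \<beta>" .
qed

text \<open>The variable \<open>u\<^sub>i - \<i>u\<^sub>j\<close> is an eigenvector of the rotation.\<close>

lemma rot_subst_power:
  fixes d :: "'n::{finite,linorder} cliff" and i j :: 'n
  assumes ij: "i \<noteq> j"
  defines "D \<equiv> shift2 i j (1/2) (- \<i>/2) :: (('n \<Rightarrow> nat) \<Rightarrow> 'n cliff) \<Rightarrow> _"
  shows "rot_subst i j c s ((D ^^ k) (delta d)) = (\<lambda>\<beta>. (c + \<i> * s) ^ k *\<^sub>C (D ^^ k) (delta d) \<beta>)"
proof (induction k)
  case 0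
  show ?case by (simp add: rot_subst_delta)
next
  case (Suc k)
  let ?f = "(D ^^ k) (delta d)"
  have f: "fin_supp ?f" unfolding D_def by (intro fin_supp_funpow_shift2 fin_supp_delta)
  have "rot_subst i j c s (D ?f) = (\<lambda>\<beta>. (c + \<i> * s) *\<^sub>C D (rot_subst i j c s ?f) \<beta>)"
    unfolding D_def rot_subst_shift2 [OF ij f [unfolded D_def]]
  proof (rule ext, rule cliff_eqI)
    fix \<beta> C
    define h where "h = rot_subst i j c s ((shift2 i j (1/2) (- \<i>/2) ^^ k) (delta d))"
    \<comment> \<open>The coefficient at i is (c + \<i> s)/2, and the one at j is (s - \<i> c)/2,
      which is -\<i> times the former.\<close>
    show "coeff ((1/2) *\<^sub>C shift2 i j c s h \<beta> + (- \<i>/2) *\<^sub>C shift2 i j (- s) c h \<beta>) C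
        = coeff ((c + \<i> * s) *\<^sub>C shift2 i j (1/2) (- \<i>/2) h \<beta>) C"
      by (simp add: shift2_def field_simps)
  qed
  moreover have "D (\<lambda>\<beta>. r *\<^sub>C g \<beta>) = (\<lambda>\<beta>. r *\<^sub>C D g \<beta>)" for r g
    unfolding D_def by (rule shift2_scaleC)
  ultimately show ?case by (simp add: Suc)
qed

section \<open>The components of the rotated variable\<close>

lemma eta_torus_elt_pol:
  assumes "fin_supp f"
  shows "eta (torus_elt t) (pol f)
    = pol (shifts (\<lambda>l. exp (- torus_gen t) * (e_vec l * exp (torus_gen t))) f)"
  using assms
  by (simp add: eta_def torus_elt_pol xi_sum_pol op_conj_torus_elt_pol fin_supp_lmul fin_supp_shifts
      shifts_lmul lmul_shifts)

text \<open>By \<open>rot\<close>, moving \<open>e_vec k\<close> across the exponentials replaces it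
  by y, a combination of \<open>e_vec i\<close> and \<open>e_vec j\<close>. What remains between the
  exponentials is the anticommutator of \<open>e_vec l\<close> with y, a scalar, so the exponentials
  cancel.\<close>

lemma eta_comp_pol:
  fixes f :: "('n::{finite,linorder} \<Rightarrow> nat) \<Rightarrow> 'n cliff" and i j k :: 'n
  assumes ij: "i \<noteq> j" and f: "fin_supp f"
    and rot: "exp (torus_gen t) * e_vec k = (p *\<^sub>C e_vec i + q *\<^sub>C e_vec j) * exp (torus_gen t)"
  shows "eta_comp (torus_elt t) k (pol f) = pol (shift2 i j p q (lmul (e_vec k) f))"
proof -
  define E E' y where "E = exp (torus_gen t :: 'n cliff)" and "E' = exp (- torus_gen t :: 'n cliff)"
    and "y = p *\<^sub>C e_vec i + q *\<^sub>C e_vec j"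
  have EE: "E * E' = 1" "E' * E = 1"
    using exp_minus_inverse [of "torus_gen t :: 'n cliff"] exp_minus_inverse [of "- torus_gen t :: 'n cliff"]
    by (simp_all add: E_def E'_def)
  have "e_vec k * E' = (E' * E) * e_vec k * E'" by (simp only: EE mult_1_left)
  also have "\<dots> = E' * (E * e_vec k) * E'" by (simp only: mult.assoc)
  also have "\<dots> = E' * y * (E * E')" using rot by (simp only: E_def y_def mult.assoc)
  finally have k: "e_vec k * E' = E' * y" by (simp only: EE mult_1_right)
  have ky: "E * e_vec k = y * E" using rot by (simp only: E_def y_def)
  have "(1/2) *\<^sub>C (E' * (e_vec l * E) * e_vec k + e_vec k * (E' * (e_vec l * E)))
      = (if l = i then p else if l = j then q else 0) *\<^sub>C 1" for l
  proof -
    have "E' * (e_vec l * E) * e_vec k + e_vec k * (E' * (e_vec l * E))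
        = E' * (e_vec l * (E * e_vec k)) + (e_vec k * E') * (e_vec l * E)"
      by (simp only: mult.assoc)
    also have "\<dots> = E' * ((e_vec l * y + y * e_vec l) * E)"
      by (simp only: k ky distrib_left distrib_right mult.assoc)
    also have "e_vec l * y + y * e_vec l
        = p *\<^sub>C (e_vec l * e_vec i + e_vec i * e_vec l) + q *\<^sub>C (e_vec l * e_vec j + e_vec j * e_vec l)"
      by (rule cliff_eqI) (simp add: y_def distrib_left distrib_right algebra_simps)
    also have "\<dots> = (2 * (if l = i then p else if l = j then q else 0)) *\<^sub>C 1"
      unfolding e_relations using ij by (intro cliff_eqI) (auto simp: coeff_2 coeff_1)
    also have "E' * (\<dots> * E) = (2 * (if l = i then p else if l = j then q else 0)) *\<^sub>C 1"
      by (simp add: EE)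
    finally show ?thesis by simp
  qed
  note shifts_eq_shift2 [OF ij, of "\<lambda>l. (1/2) *\<^sub>C (E' * (e_vec l * E) * e_vec k + e_vec k * (E' * (e_vec l * E)))", OF this]
  then show ?thesis
    using f by (simp add: eta_comp_def R_op_pol fin_supp_lmul
        bracket_pol [OF eta_torus_elt_pol R_op_pol] E_def E'_def)
qed

lemma funpow_pol:
  assumes X: "\<And>c. fin_supp c \<Longrightarrow> X (pol c) = pol (shift2 i j p q (lmul e c))" and c: "fin_supp c"
  shows "(X ^^ k) (pol c) = pol ((shift2 i j p q ^^ k) (lmul (e ^ k) c))"
proof (induction k)
  case 0
  show ?case by (simp add: lmul_def)
next
  case (Suc k)
  have "(X ^^ Suc k) (pol c) = pol (shift2 i j p q (lmul e ((shift2 i j p q ^^ k) (lmul (e ^ k) c))))"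
    using c by (simp add: Suc X fin_supp_funpow_shift2 fin_supp_lmul)
  then show ?case by (simp add: lmul_funpow_shift2 lmul_lmul)
qed

lemma sorted_UNIV_eq:
  assumes "CARD('n::{finite,linorder}) \<ge> 2"
  obtains l where "sorted_list_of_set (UNIV :: 'n set) = nth_index 1 # nth_index 2 # l"
    "nth_index 1 \<notin> set l" "nth_index 2 \<notin> set l"
proof -
  let ?l = "sorted_list_of_set (UNIV :: 'n set)"
  have "length ?l \<ge> 2" using assms by simp
  then obtain x y l where l: "?l = x # y # l"
    by (metis One_nat_def Suc_1 Suc_le_length_iff)
  moreover have "x = nth_index 1" "y = nth_index 2" by (simp_all add: nth_index_def l)
  moreover have "distinct (x # y # l)" by (metis l distinct_sorted_list_of_set)
  ultimately show thesis using that by auto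
qed

text \<open>Each component contributes a rotated linear form and a factor \<open>e_vec\<close>. The
  linear forms commute with these factors, which therefore collect, in increasing order of the
  index, into \<open>e_mono_inv \<alpha>\<close>.\<close>

lemma op_monomial_eta_pol:
  fixes \<alpha> :: "'n::{finite,linorder} \<Rightarrow> nat"
  assumes card: "CARD('n) \<ge> 2" and \<alpha>: "\<And>l. l \<noteq> nth_index 1 \<Longrightarrow> l \<noteq> nth_index 2 \<Longrightarrow> \<alpha> l = 0"
  shows "op_monomial (eta_comp (torus_elt t)) \<alpha> (\<lambda>_. 1)
    = pol (rot_mono (nth_index 1) (nth_index 2) (cos (of_real (t 1))) (sin (of_real (t 1))) \<alpha> (e_mono_inv \<alpha>))"
proof -
  obtain l where l: "sorted_list_of_set (UNIV :: 'n set) = nth_index 1 # nth_index 2 # l"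
    "nth_index 1 \<notin> set l" "nth_index 2 \<notin> set l"
    using sorted_UNIV_eq [OF card] by blast
  have l0: "\<alpha> x = 0" if "x \<in> set l" for x
    using that l \<alpha> by metis
  let ?i = "nth_index 1 :: 'n" and ?j = "nth_index 2 :: 'n"
  let ?c = "cos (of_real (t 1)) :: complex" and ?s = "sin (of_real (t 1)) :: complex"
  let ?X = "eta_comp (torus_elt t) :: 'n \<Rightarrow> 'n opr"
  have ij: "?i \<noteq> ?j" using card by (subst nth_index_inject) auto
  have id: "foldr (\<circ>) (map (\<lambda>x. ?X x ^^ \<alpha> x) l) id = id"
    using l0 by (induction l) auto
  have one: "prod_list (map (\<lambda>x. e_vec x ^ \<alpha> x) l) = 1"
    using l0 by (induction l) auto
  have 1: "?X ?i (pol f) = pol (shift2 ?i ?j ?c ?s (lmul (e_vec ?i) f))" if "fin_supp f" for f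
    by (rule eta_comp_pol [OF ij that exp_torus_gen_e_vec(1) [OF card]])
  have 2: "?X ?j (pol f) = pol (shift2 ?i ?j (- ?s) ?c (lmul (e_vec ?j) f))" if "fin_supp f" for f
    by (rule eta_comp_pol [OF ij that exp_torus_gen_e_vec(2) [OF card]])
  have "op_monomial ?X \<alpha> (\<lambda>_. 1) = (?X ?i ^^ \<alpha> ?i) ((?X ?j ^^ \<alpha> ?j) (pol (delta 1)))"
    by (simp only: op_monomial_def l(1) list.map foldr.simps o_apply id id_apply pol_delta)
  also have "\<dots> = pol ((shift2 ?i ?j ?c ?s ^^ \<alpha> ?i) (lmul (e_vec ?i ^ \<alpha> ?i)
      ((shift2 ?i ?j (- ?s) ?c ^^ \<alpha> ?j) (lmul (e_vec ?j ^ \<alpha> ?j) (delta 1)))))"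
    by (simp only: funpow_pol [OF 2] funpow_pol [OF 1] fin_supp_delta fin_supp_funpow_shift2 fin_supp_lmul)
  also have "\<dots> = pol (rot_mono ?i ?j ?c ?s \<alpha> (e_vec ?i ^ \<alpha> ?i * e_vec ?j ^ \<alpha> ?j))"
    by (simp only: lmul_funpow_shift2 lmul_delta rot_mono_def mult_1_right)
  also have "e_vec ?i ^ \<alpha> ?i * e_vec ?j ^ \<alpha> ?j = e_mono_inv \<alpha>"
    by (simp only: e_mono_inv_def l(1) list.map prod_list.Cons one mult_1_right)
  finally show ?thesis .
qed

text \<open>The factor \<open>e_mono_inv \<alpha>\<close> from the monomial meets
  \<open>e_mono \<alpha>\<close> from the definition of \<open>pol\<close>. Substituting for the
  xi_j thus becomes substituting for the u_j with unchanged coefficients.\<close>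

lemma right_linear_eta_pol:
  fixes f :: "('n::{finite,linorder} \<Rightarrow> nat) \<Rightarrow> 'n cliff"
  assumes card: "CARD('n) \<ge> 2" and f: "fin_supp f"
    and supp: "\<And>\<alpha> l. f \<alpha> \<noteq> 0 \<Longrightarrow> l \<noteq> nth_index 1 \<Longrightarrow> l \<noteq> nth_index 2 \<Longrightarrow> \<alpha> l = 0"
  shows "right_linear (\<lambda>\<alpha>. op_monomial (eta_comp (torus_elt t)) \<alpha> (\<lambda>_. 1)) (pol f)
    = pol (rot_subst (nth_index 1) (nth_index 2) (cos (of_real (t 1))) (sin (of_real (t 1))) f)"
proof
  fix x
  let ?M = "rot_mono (nth_index 1) (nth_index 2) (cos (of_real (t 1))) (sin (of_real (t 1))) :: _ \<Rightarrow> 'n cliff \<Rightarrow> _"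
  let ?A = "{\<alpha>. f \<alpha> \<noteq> 0}"
  have "right_linear (\<lambda>\<alpha>. op_monomial (eta_comp (torus_elt t)) \<alpha> (\<lambda>_. 1)) (pol f) x
      = (\<Sum>\<alpha>\<in>?A. op_monomial (eta_comp (torus_elt t)) \<alpha> (\<lambda>_. 1) x * (e_mono \<alpha> * f \<alpha>))"
    using f by (intro right_linear_pol) auto
  also have "\<dots> = (\<Sum>\<alpha>\<in>?A. pol (?M \<alpha> (f \<alpha>)) x)"
  proof (rule sum.cong [OF refl])
    fix \<alpha> assume "\<alpha> \<in> ?A"
    then have "op_monomial (eta_comp (torus_elt t)) \<alpha> (\<lambda>_. 1) = pol (?M \<alpha> (e_mono_inv \<alpha>))"
      using supp by (intro op_monomial_eta_pol [OF card]) auto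
    moreover have "pol (?M \<alpha> (e_mono_inv \<alpha>)) x * (e_mono \<alpha> * f \<alpha>)
        = pol (\<lambda>\<beta>. ?M \<alpha> (e_mono_inv \<alpha>) \<beta> * (e_mono \<alpha> * f \<alpha>)) x"
      by (rule pol_mult_right [OF fin_supp_rot_mono, symmetric])
    moreover have "e_mono_inv \<alpha> * (e_mono \<alpha> * f \<alpha>) = f \<alpha>"
      by (simp flip: mult.assoc)
    ultimately show "op_monomial (eta_comp (torus_elt t)) \<alpha> (\<lambda>_. 1) x * (e_mono \<alpha> * f \<alpha>)
        = pol (?M \<alpha> (f \<alpha>)) x"
      by (simp only: rot_mono_mult_right [symmetric])
  qed
  also have "\<dots> = pol (\<lambda>\<beta>. \<Sum>\<alpha>\<in>?A. ?M \<alpha> (f \<alpha>) \<beta>) x"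
    by (rule pol_sum [symmetric]) (rule fin_supp_rot_mono)
  finally show "right_linear (\<lambda>\<alpha>. op_monomial (eta_comp (torus_elt t)) \<alpha> (\<lambda>_. 1)) (pol f) x
    = pol (rot_subst (nth_index 1) (nth_index 2) (cos (of_real (t 1))) (sin (of_real (t 1))) f) x"
    by (simp only: rot_subst_def)
qed

section \<open>The element \<open>I[1]\<close>\<close>

definition rot_perp :: "nat \<Rightarrow> 'n::{finite,linorder} cliff" where
  "rot_perp j = e_perp (nth_index (2 * j)) * e_perp (nth_index (2 * j - 1))"

text \<open>The products of \<open>f_op j\<close> with \<open>f_dag j\<close> and of
  \<open>g_op j\<close> with \<open>g_dag j\<close>, multiplied out on constants. Both bivectors
  square to -1, so each factor is idempotent.\<close>

definition I_const :: "nat \<Rightarrow> 'n::{finite,linorder} cliff" where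
  "I_const j = ((1/2) *\<^sub>C (1 - \<i> *\<^sub>C rot j)) * ((1/2) *\<^sub>C (1 + \<i> *\<^sub>C rot_perp j))"

definition I_last :: "'n::{finite,linorder} cliff" where
  "I_last = (if even CARD('n) then 1 else e_vec (nth_index CARD('n)) * e_perp (nth_index CARD('n)))"

definition I_one :: "'n::{finite,linorder} cliff" where
  "I_one = foldr (\<lambda>j. (*) (I_const j)) [1..<CARD('n) div 2 + 1] I_last"

lemma R_op_const: "R_op j (\<lambda>_. c) = (\<lambda>_. e_vec j * c)"
  using R_op_pol [OF fin_supp_delta, of j c] by (simp add: pol_delta lmul_delta)

text \<open>The reflection fixes constants, so on them every factor of I is a left
  multiplication.\<close>

lemma S_perp_const: "S_perp j (\<lambda>_. c) = (\<lambda>_. e_perp j * c)"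
  by (simp add: S_perp_def)

lemma I_factor_const:
  assumes "1 \<le> j" "j \<le> CARD('n::{finite,linorder}) div 2"
  shows "I_factor j (\<lambda>_. c) = (\<lambda>_. I_const j * c :: 'n cliff)"
proof -
  define A B P Q where "A = e_vec (nth_index (2 * j - 1) :: 'n)" and "B = e_vec (nth_index (2 * j) :: 'n)"
    and "P = e_perp (nth_index (2 * j - 1) :: 'n)" and "Q = e_perp (nth_index (2 * j) :: 'n)"
  have ne: "(nth_index (2 * j - 1) :: 'n) \<noteq> nth_index (2 * j)"
    using assms by (subst nth_index_inject) auto
  have f: "((1/2) *\<^sub>C (A - \<i> *\<^sub>C B)) * ((1/2) *\<^sub>C (A + \<i> *\<^sub>C B)) = (1/2) *\<^sub>C (1 - \<i> *\<^sub>C rot j)"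
  proof -
    have "A * A = 1" "B * B = 1" "A * B = - rot j" "B * A = rot j"
      using ne e_vec_anticomm [OF ne] by (simp_all only: A_def B_def rot_def e_vec_sq)
    then show ?thesis
      by (intro cliff_eqI) (simp add: distrib_left left_diff_distrib right_diff_distrib distrib_right field_simps)
  qed
  have g: "((1/2) *\<^sub>C (P - \<i> *\<^sub>C Q)) * (- (1/2) *\<^sub>C (P + \<i> *\<^sub>C Q)) = (1/2) *\<^sub>C (1 + \<i> *\<^sub>C rot_perp j)"
  proof -
    have "P * P = - 1" "Q * Q = - 1" "P * Q = - rot_perp j" "Q * P = rot_perp j"
      using ne e_perp_anticomm [OF ne] by (simp_all only: P_def Q_def rot_perp_def e_perp_sq)
    then show ?thesis
      by (intro cliff_eqI) (simp add: distrib_left left_diff_distrib right_diff_distrib distrib_right field_simps)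
  qed
  have "f_op j (\<lambda>_. d) = (\<lambda>_. ((1/2) *\<^sub>C (A - \<i> *\<^sub>C B)) * d)"
    "f_dag j (\<lambda>_. d) = (\<lambda>_. ((1/2) *\<^sub>C (A + \<i> *\<^sub>C B)) * d)"
    "g_op j (\<lambda>_. d) = (\<lambda>_. ((1/2) *\<^sub>C (P - \<i> *\<^sub>C Q)) * d)"
    "g_dag j (\<lambda>_. d) = (\<lambda>_. (- (1/2) *\<^sub>C (P + \<i> *\<^sub>C Q)) * d)" for d
    by (simp_all add: f_op_def f_dag_def g_op_def g_dag_def R_op_const S_perp_const A_def B_def P_def Q_def
        left_diff_distrib distrib_right)
  then show ?thesis
    by (simp only: I_factor_def o_apply I_const_def f [symmetric] g [symmetric] mult.assoc)
qed

lemma I_op_1: "I_op (\<lambda>_. 1 :: 'n::{finite,linorder} cliff) = (\<lambda>_. I_one)"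
proof -
  let ?T = "if even CARD('n) then id
      else R_op (nth_index CARD('n)) \<circ> S_perp (nth_index CARD('n)) :: 'n opr"
  have *: "foldr (\<circ>) (map I_factor l) ?T (\<lambda>_. 1) = (\<lambda>_. foldr (\<lambda>j. (*) (I_const j)) l I_last)"
    if "set l \<subseteq> {1..CARD('n) div 2}" for l
    using that
  proof (induction l)
    case Nil
    show ?case by (simp add: I_last_def R_op_const S_perp_const)
  next
    case (Cons j l)
    then show ?case by (simp add: I_factor_const)
  qed
  show ?thesis
    unfolding I_op_def I_one_def by (rule *) auto
qed

section \<open>Nonvanishing of I[1] and its eigenvalues\<close>

lemma e_vec_rot_perp_commute: "e_vec x * rot_perp j = rot_perp j * e_vec x"
  unfolding rot_perp_def by (intro commute_anticommuting_product e_vec_e_perp_anticomm)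

lemma e_perp_rot_perp_commute:
  "x \<noteq> nth_index (2 * j - 1) \<Longrightarrow> x \<noteq> nth_index (2 * j) \<Longrightarrow> e_perp x * rot_perp j = rot_perp j * e_perp x"
  unfolding rot_perp_def by (intro commute_anticommuting_product e_perp_anticomm)

lemma commute_prod: "x * y = y * x \<Longrightarrow> x * z = z * x \<Longrightarrow> x * (y * z) = y * z * (x::'a::semigroup_mult)"
  by (metis mult.assoc)

lemma commute_I_const:
  assumes "x * rot j = rot j * x" "x * rot_perp j = rot_perp j * x"
  shows "x * I_const j = I_const j * x"
  unfolding I_const_def using assms
  by (intro commute_prod) (simp_all add: distrib_left distrib_right left_diff_distrib right_diff_distrib)

text \<open>The two generators with index 2i - 1 later serve to conjugate the projections of the
  i-th factor; for this they must commute with all the other factors.\<close>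

lemma I_const_commute:
  fixes i j :: nat
  assumes i: "1 \<le> i" "i \<le> CARD('n::{finite,linorder}) div 2"
    and j: "1 \<le> j" "j \<le> CARD('n) div 2" and ij: "i \<noteq> j"
  shows "e_vec (nth_index (2 * i - 1)) * I_const j = I_const j * (e_vec (nth_index (2 * i - 1)) :: 'n cliff)"
    and "e_perp (nth_index (2 * i - 1)) * I_const j = I_const j * (e_perp (nth_index (2 * i - 1)) :: 'n cliff)"
    and "rot i * I_const j = I_const j * (rot i :: 'n cliff)"
proof -
  have bi: "1 \<le> 2 * i - 1" "2 * i - 1 \<le> CARD('n)" "1 \<le> 2 * i" "2 * i \<le> CARD('n)"
    using i by auto
  have bj: "1 \<le> 2 * j - 1" "2 * j - 1 \<le> CARD('n)" "1 \<le> 2 * j" "2 * j \<le> CARD('n)"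
    using j by auto
  have "2 * i - 1 \<noteq> 2 * j - 1" "2 * i - 1 \<noteq> 2 * j" "2 * i \<noteq> 2 * j - 1" "2 * i \<noteq> 2 * j"
    using i(1) j(1) ij by presburger+
  then have ne: "(nth_index (2 * i - 1) :: 'n) \<noteq> nth_index (2 * j - 1)"
    "(nth_index (2 * i - 1) :: 'n) \<noteq> nth_index (2 * j)"
    "(nth_index (2 * i) :: 'n) \<noteq> nth_index (2 * j - 1)"
    "(nth_index (2 * i) :: 'n) \<noteq> nth_index (2 * j)"
    by (simp_all only: nth_index_inject bi bj not_False_eq_True)
  have b: "e_vec (nth_index (2 * i)) * I_const j = I_const j * (e_vec (nth_index (2 * i)) :: 'n cliff)"
    by (intro commute_I_const e_vec_rot_commute e_vec_rot_perp_commute ne)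
  show a: "e_vec (nth_index (2 * i - 1)) * I_const j = I_const j * (e_vec (nth_index (2 * i - 1)) :: 'n cliff)"
    by (intro commute_I_const e_vec_rot_commute e_vec_rot_perp_commute ne)
  show "e_perp (nth_index (2 * i - 1)) * I_const j = I_const j * (e_perp (nth_index (2 * i - 1)) :: 'n cliff)"
    by (intro commute_I_const e_perp_rot_commute e_perp_rot_perp_commute ne)
  show "rot i * I_const j = I_const j * (rot i :: 'n cliff)"
    unfolding rot_def by (rule commute_prod [OF b [symmetric] a [symmetric], symmetric])
qed

text \<open>Conjugating by \<open>x\<close> turns \<open>1 + kM\<close> into \<open>1 - kM\<close>, and the sum of the two is \<open>2\<close>.\<close>

lemma half_projection_mult_eq_0:
  fixes x c M :: "'n::{finite,linorder} cliff"
  assumes xM: "x * M = - (M * x)" and xc: "x * c = c * x" and xx: "x * x = 1 \<or> x * x = - 1"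
    and z: "((1/2) *\<^sub>C (1 + k *\<^sub>C M)) * c = 0"
  shows "c = 0"
proof -
  have 1: "c + k *\<^sub>C (M * c) = 0"
    using z by (simp add: scaleC_cancel distrib_right)
  have "x * (M * c) = - (M * c * x)"
  proof -
    have "x * (M * c) = (x * M) * c" by (simp only: mult.assoc)
    also have "\<dots> = - (M * (x * c))" by (simp only: xM mult_minus_left mult.assoc)
    finally show ?thesis by (simp only: xc mult.assoc)
  qed
  then have "(c - k *\<^sub>C (M * c)) * x = x * (c + k *\<^sub>C (M * c))"
    by (simp add: distrib_left left_diff_distrib xc)
  then have "(c - k *\<^sub>C (M * c)) * (x * x) = 0" by (simp add: 1 flip: mult.assoc)
  then have "c - k *\<^sub>C (M * c) = 0" using xx by auto
  then have "c + c = 0" using 1 by (metis add_diff_cancel_right' diff_add_eq eq_iff_diff_eq_0 add.commute)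
  then show ?thesis using double_eq [of c 0] by simp
qed

lemma eigenvector_mult_right:
  fixes M K x :: "'n::{finite,linorder} cliff"
  assumes "M * K = k *\<^sub>C K"
  shows "M * (K * x) = k *\<^sub>C (K * x)"
  using assms by (simp flip: mult.assoc)

text \<open>Nonvanishing is kept as half-projections are added on the left one at a time. For the
  eigenvalue, \<open>rot j\<close> moves to its own factor, where
  \<open>rot j * (1 - \<i> *\<^sub>C rot j)\<close> equals
  \<open>\<i> *\<^sub>C (1 - \<i> *\<^sub>C rot j)\<close> because \<open>rot j\<close> squares to
  -1.\<close>

lemma I_one_properties:
  "I_one \<noteq> (0 :: 'n::{finite,linorder} cliff)"
  "1 \<le> j \<Longrightarrow> j \<le> CARD('n) div 2 \<Longrightarrow> rot j * I_one = \<i> *\<^sub>C (I_one :: 'n cliff)"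
proof -
  let ?J = "{1..CARD('n) div 2}" and ?F = "\<lambda>l. foldr (\<lambda>j. (*) (I_const j)) l (I_last :: 'n cliff)"
  let ?x = "\<lambda>j. e_vec (nth_index (2 * j - 1)) :: 'n cliff" and ?y = "\<lambda>j. e_perp (nth_index (2 * j - 1)) :: 'n cliff"
  have last: "I_last \<noteq> (0 :: 'n cliff)"
  proof
    let ?m = "nth_index CARD('n) :: 'n"
    assume "I_last = (0 :: 'n cliff)"
    then have 0: "e_vec ?m * e_perp ?m = 0" by (simp add: I_last_def split: if_splits)
    have "e_vec ?m * (e_vec ?m * e_perp ?m) * e_perp ?m = (e_vec ?m * e_vec ?m) * (e_perp ?m * e_perp ?m)"
      by (simp only: mult.assoc)
    then show False by (simp add: 0 e_vec_sq e_perp_sq)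
  qed
  \<comment> \<open>For odd m the last index is m, and 2j - 1 < m. The generators then anticommute
    with both factors of \<open>I_last\<close>, hence commute with their product.\<close>
  have last_comm: "?x j * I_last = I_last * ?x j" "?y j * I_last = I_last * ?y j" if "j \<in> ?J" for j
  proof -
    have j: "1 \<le> j" "2 * j \<le> CARD('n)" using that by auto
    then have "2 * j - 1 \<noteq> CARD('n)" "1 \<le> 2 * j - 1" "2 * j - 1 \<le> CARD('n)" "1 \<le> CARD('n)" by linarith+
    then have "(nth_index (2 * j - 1) :: 'n) \<noteq> nth_index CARD('n)"
      by (simp only: nth_index_inject not_False_eq_True le_refl)
    then show "?x j * I_last = I_last * ?x j" "?y j * I_last = I_last * ?y j"
      unfolding I_last_def
      by (auto intro!: commute_anticommuting_product e_vec_anticomm e_perp_anticomm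
          simp: e_vec_e_perp_anticomm)
  qed
  have comm: "?x j * ?F l = ?F l * ?x j \<and> ?y j * ?F l = ?F l * ?y j"
    if "set l \<subseteq> ?J" "j \<in> ?J - set l" for l j
    using that
  proof (induction l)
    case Nil
    then show ?case using last_comm [of j] by simp
  next
    case (Cons i l)
    have "?x j * I_const i = I_const i * ?x j" "?y j * I_const i = I_const i * ?y j"
      by (rule I_const_commute; use Cons.prems in auto)+
    moreover have "?x j * ?F l = ?F l * ?x j" "?y j * ?F l = ?F l * ?y j"
      using Cons by auto
    ultimately show ?case by (simp only: foldr.simps o_apply commute_prod)
  qed
  have nz: "?F l \<noteq> 0" if "set l \<subseteq> ?J" "distinct l" for l
    using that
  proof (induction l)
    case Nil
    then show ?case by (simp add: last)
  next
    case (Cons i l)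
    then have c: "?x i * ?F l = ?F l * ?x i" "?y i * ?F l = ?F l * ?y i"
      using comm [of l i] by auto
    have ne: "(nth_index (2 * i - 1) :: 'n) \<noteq> nth_index (2 * i)"
      using Cons.prems by (subst nth_index_inject) auto
    have anti: "x * (y * x) = - (y * x * x)" if "x * y = - (y * x)" for x y :: "'n cliff"
      by (metis that mult.assoc mult_minus_left)
    have xM: "?x i * rot i = - (rot i * ?x i)" "?y i * rot_perp i = - (rot_perp i * ?y i)"
      unfolding rot_def rot_perp_def by (intro anti e_vec_anticomm e_perp_anticomm ne)+
    let ?q = "(1/2) *\<^sub>C (1 + \<i> *\<^sub>C rot_perp i) :: 'n cliff"
    \<comment> \<open>The perpendicular projection is treated with \<open>e_perp\<close>, the other
      one with \<open>e_vec\<close>. The latter also commutes with \<open>?q\<close>, which by then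
      stands to the right.\<close>
    have q: "?q * ?F l \<noteq> 0"
      using half_projection_mult_eq_0 [OF xM(2) c(2), of \<i>] Cons by (auto simp: e_perp_sq)
    have "?x i * ?q = ?q * ?x i"
      by (simp add: distrib_left distrib_right e_vec_rot_perp_commute)
    then have c': "?x i * (?q * ?F l) = (?q * ?F l) * ?x i" using c(1) by (rule commute_prod)
    have "((1/2) *\<^sub>C (1 + (- \<i>) *\<^sub>C rot i)) * (?q * ?F l) \<noteq> 0"
      using half_projection_mult_eq_0 [OF xM(1) c', of "- \<i>"] q by (auto simp: e_vec_sq)
    moreover have "?F (i # l) = ((1/2) *\<^sub>C (1 + (- \<i>) *\<^sub>C rot i)) * (?q * ?F l)"
      by (simp only: foldr.simps o_apply I_const_def scaleC_minus_left diff_conv_add_uminus mult.assoc)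
    ultimately show ?case by simp
  qed
  show "I_one \<noteq> (0 :: 'n cliff)"
    unfolding I_one_def by (rule nz) auto
  have eig: "rot j * ?F l = \<i> *\<^sub>C ?F l" if "set l \<subseteq> ?J" "j \<in> set l" "distinct l" for j l
    using that
  proof (induction l)
    case (Cons i l)
    show ?case
    proof (cases "j = i")
      case True
      then have "rot j * rot j = (- 1 :: 'n cliff)" using Cons.prems by (intro rot_mult) auto
      then have "rot j * ((1/2) *\<^sub>C (1 - \<i> *\<^sub>C rot j)) = \<i> *\<^sub>C ((1/2) *\<^sub>C (1 - \<i> *\<^sub>C rot j :: 'n cliff))"
        by (intro cliff_eqI) (simp add: right_diff_distrib algebra_simps)
      then have "rot j * I_const j = \<i> *\<^sub>C (I_const j :: 'n cliff)"
        unfolding I_const_def by (rule eigenvector_mult_right)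
      then have "rot j * (I_const j * ?F l) = \<i> *\<^sub>C (I_const j * ?F l)"
        by (rule eigenvector_mult_right)
      then show ?thesis by (simp add: True)
    next
      case False
      then have "rot j * I_const i = I_const i * (rot j :: 'n cliff)"
        using Cons.prems by (intro I_const_commute) auto
      then have "rot j * (I_const i * ?F l) = I_const i * (rot j * ?F l)"
        by (simp flip: mult.assoc)
      also have "rot j * ?F l = \<i> *\<^sub>C ?F l" using Cons False by simp
      finally show ?thesis by simp
    qed
  qed simp
  show "rot j * I_one = \<i> *\<^sub>C (I_one :: 'n cliff)" if "1 \<le> j" "j \<le> CARD('n) div 2"
    unfolding I_one_def using that by (intro eig) auto
qed

lemma exp_torus_gen_I_one:
  "exp (torus_gen t) * I_one
    = exp (\<i> / 2 * (\<Sum>j = 1..CARD('n::{finite,linorder}) div 2. of_real (t j))) *\<^sub>C (I_one :: 'n cliff)"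
proof (rule exp_eigenvector)
  have "torus_gen t * (I_one :: 'n cliff) = (1/2) *\<^sub>R (\<Sum>j = 1..CARD('n) div 2. t j *\<^sub>R (rot j * I_one))"
    by (simp add: torus_gen_def sum_distrib_right)
  also have "\<dots> = (1/2) *\<^sub>R (\<Sum>j = 1..CARD('n) div 2. t j *\<^sub>R (\<i> *\<^sub>C I_one))"
    using I_one_properties(2) [where 'n = 'n] by simp
  also have "\<dots> = (\<i> / 2 * (\<Sum>j = 1..CARD('n) div 2. of_real (t j))) *\<^sub>C I_one"
    by (rule cliff_eqI) (simp add: sum_distrib_left sum_distrib_right sum_divide_distrib mult_ac)
  finally show "torus_gen t * (I_one :: 'n cliff)
      = (\<i> / 2 * (\<Sum>j = 1..CARD('n) div 2. of_real (t j))) *\<^sub>C I_one" .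
qed


section \<open>The highest weight vectors\<close>

definition hw_coeff :: "nat \<Rightarrow> ('n::{finite,linorder} \<Rightarrow> nat) \<Rightarrow> 'n cliff" where
  "hw_coeff k = (shift2 (nth_index 1) (nth_index 2) (1/2) (- \<i>/2) ^^ k) (delta I_one)"

lemma hw_coeff_0: "hw_coeff 0 = delta I_one"
  and hw_coeff_Suc: "hw_coeff (Suc k)
    = shift2 (nth_index 1 :: 'n::{finite,linorder}) (nth_index 2) (1/2) (- \<i>/2) (hw_coeff k)"
  by (simp_all add: hw_coeff_def)

lemma fin_supp_hw_coeff: "fin_supp (hw_coeff k)"
  unfolding hw_coeff_def by (intro fin_supp_funpow_shift2 fin_supp_delta)

text \<open>Half the anticommutator of \<open>e_vec l\<close> with (e_1 - \<i> e_2)/2 is a scalar: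
  1/2 and -\<i>/2 at the first two indices, 0 elsewhere.\<close>

lemma bracket_xi_sum_f_op_pol:
  fixes c :: "('n::{finite,linorder} \<Rightarrow> nat) \<Rightarrow> 'n cliff"
  assumes card: "CARD('n) \<ge> 2" and c: "fin_supp c"
  shows "bracket xi_sum (f_op 1) (pol c) = pol (shift2 (nth_index 1) (nth_index 2) (1/2) (- \<i>/2) c)"
proof -
  let ?i = "nth_index 1 :: 'n" and ?j = "nth_index 2 :: 'n"
  let ?z = "(1/2) *\<^sub>C (e_vec ?i - \<i> *\<^sub>C e_vec ?j)"
  have ij: "?i \<noteq> ?j" using card by (subst nth_index_inject) auto
  have f: "f_op 1 (pol c) = pol (lmul ?z c)" if c: "fin_supp c" for c :: "('n \<Rightarrow> nat) \<Rightarrow> 'n cliff"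
  proof
    fix x
    have "lmul ?z c = (\<lambda>\<alpha>. (1/2) *\<^sub>C (lmul (e_vec ?i) c \<alpha> + (- \<i>) *\<^sub>C lmul (e_vec ?j) c \<alpha>))"
      by (rule ext) (simp add: lmul_def left_diff_distrib)
    then show "f_op 1 (pol c) x = pol (lmul ?z c) x"
      using c by (simp only: f_op_def R_op_pol pol_scaleC pol_add fin_supp_add fin_supp_scaleC fin_supp_lmul)
        (simp add: scaleC_diff numeral_2_eq_2)
  qed
  have "(1/2) *\<^sub>C (e_vec l * ?z + ?z * e_vec l) = (if l = ?i then 1/2 else if l = ?j then - \<i>/2 else 0) *\<^sub>C 1" for l
  proof -
    have "e_vec l * ?z + ?z * e_vec l = (1/2) *\<^sub>C ((e_vec l * e_vec ?i + e_vec ?i * e_vec l)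
        - \<i> *\<^sub>C (e_vec l * e_vec ?j + e_vec ?j * e_vec l))"
      by (rule cliff_eqI) (simp add: left_diff_distrib right_diff_distrib algebra_simps)
    then show ?thesis
      unfolding e_relations using ij by (intro cliff_eqI) (auto simp: coeff_2 coeff_1)
  qed
  note shifts_eq_shift2 [OF ij, of "\<lambda>l. (1/2) *\<^sub>C (e_vec l * ?z + ?z * e_vec l)", OF this]
  then show ?thesis using bracket_pol [OF xi_sum_pol f c] by simp
qed

lemma hw_vector_eq_pol:
  assumes card: "CARD('n::{finite,linorder}) \<ge> 2"
  shows "hw_vector k = pol (hw_coeff k :: ('n \<Rightarrow> nat) \<Rightarrow> 'n cliff)"
proof (induction k)
  case 0
  show ?case by (simp add: hw_vector_def I_op_1 pol_delta hw_coeff_0)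
next
  case (Suc k)
  have "hw_vector (Suc k) = bracket xi_sum (f_op 1) (hw_vector k :: 'n dfun)"
    by (simp add: hw_vector_def)
  also have "\<dots> = pol (hw_coeff (Suc k))"
    unfolding Suc using card
    by (simp only: bracket_xi_sum_f_op_pol fin_supp_hw_coeff hw_coeff_Suc)
  finally show ?case .
qed

lemma hw_coeff_supp:
  "hw_coeff k \<alpha> \<noteq> 0 \<Longrightarrow> l \<noteq> nth_index 1 \<Longrightarrow> l \<noteq> nth_index 2 \<Longrightarrow> \<alpha> l = 0"
proof (induction k arbitrary: \<alpha>)
  case 0
  then show ?case by (auto simp: hw_coeff_0 delta_def split: if_splits)
next
  case (Suc k)
  then have "shift (nth_index 1) (hw_coeff k) \<alpha> \<noteq> 0 \<or> shift (nth_index 2) (hw_coeff k) \<alpha> \<noteq> 0"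
    by (auto simp: hw_coeff_Suc shift2_def)
  then have "hw_coeff k (\<alpha>(nth_index 1 := \<alpha> (nth_index 1) - 1)) \<noteq> 0
      \<or> hw_coeff k (\<alpha>(nth_index 2 := \<alpha> (nth_index 2) - 1)) \<noteq> 0"
    by (auto simp: shift_def split: if_splits)
  then show ?case using Suc.IH Suc.prems by (metis fun_upd_other)
qed

text \<open>The k-th power of u_1 arises only by choosing u_1 at every step. Its coefficient
  witnesses that the vector is nonzero.\<close>

lemma hw_coeff_top:
  assumes card: "CARD('n::{finite,linorder}) \<ge> 2"
  shows "hw_coeff k ((\<lambda>_. 0)(nth_index 1 := k)) = (1/2) ^ k *\<^sub>C (I_one :: 'n cliff)"
proof (induction k)
  case 0
  show ?case by (simp add: hw_coeff_0 delta_def fun_upd_idem)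
next
  case (Suc k)
  define i j :: 'n where "i = nth_index 1" and "j = nth_index 2"
  have "i \<noteq> j" unfolding i_def j_def using card by (subst nth_index_inject) auto
  define \<beta> \<gamma> where "\<beta> = (\<lambda>_. 0 :: nat)(i := Suc k)" and "\<gamma> = (\<lambda>_. 0 :: nat)(i := k)"
  have "\<beta> i = Suc k" "\<beta> j = 0" "\<beta>(i := k) = \<gamma>"
    using \<open>i \<noteq> j\<close> by (auto simp: \<beta>_def \<gamma>_def)
  then have "hw_coeff (Suc k) \<beta> = (1/2) ^ Suc k *\<^sub>C (I_one :: 'n cliff)"
    using Suc [folded i_def, folded \<gamma>_def] by (simp add: hw_coeff_Suc [where 'n = 'n, folded i_def j_def] shift2_def shift_def)
  then show ?case by (simp only: \<beta>_def i_def)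
qed

theorem theorem7:
  fixes k :: nat
  assumes "CARD('n::{finite,linorder}) \<ge> 2"
  shows "(hw_vector k :: 'n dfun) \<noteq> (\<lambda>_. 0) \<and>
    (\<forall>t :: nat \<Rightarrow> real.
      L_action (torus_elt t) (hw_vector k :: 'n dfun) =
        (\<lambda>x. exp (\<i> * (of_nat k + 1/2) * of_real (t 1)
                  + \<i> / 2 * (\<Sum>j = 2..CARD('n) div 2. of_real (t j)))
              *\<^sub>C hw_vector k x))"
proof (intro conjI allI)
  let ?h = "hw_coeff k :: ('n \<Rightarrow> nat) \<Rightarrow> 'n cliff"
  have h: "fin_supp ?h" by (rule fin_supp_hw_coeff)
  show "(hw_vector k :: 'n dfun) \<noteq> (\<lambda>_. 0)"
  proof
    assume "(hw_vector k :: 'n dfun) = (\<lambda>_. 0)"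
    then have "pol ?h = pol (\<lambda>_. 0)" by (simp add: hw_vector_eq_pol [OF assms] fun_eq_iff)
    then have "?h = (\<lambda>_. 0)" by (intro pol_inject h) auto
    then have "(1/2) ^ k *\<^sub>C (I_one :: 'n cliff) = 0" using hw_coeff_top [OF assms, of k] by simp
    then show False using I_one_properties(1) [where 'n = 'n] by (simp add: scaleC_cancel)
  qed
  fix t :: "nat \<Rightarrow> real"
  define a where "a = exp (\<i> * of_real (t 1))"
  define b where "b = exp (\<i> / 2 * (\<Sum>j = 1..CARD('n) div 2. of_real (t j)))"
  have ij: "(nth_index 1 :: 'n) \<noteq> nth_index 2" using assms by (subst nth_index_inject) auto
  have a: "cos (of_real (t 1)) + \<i> * sin (of_real (t 1)) = a"
    by (simp add: a_def exp_Euler)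
  have "right_linear (\<lambda>\<alpha>. op_monomial (eta_comp (torus_elt t)) \<alpha> (\<lambda>_. 1)) (pol ?h)
      = pol (rot_subst (nth_index 1) (nth_index 2) (cos (of_real (t 1))) (sin (of_real (t 1))) ?h)"
    by (rule right_linear_eta_pol [OF assms h]) (rule hw_coeff_supp)
  also have "\<dots> = pol (\<lambda>\<beta>. a ^ k *\<^sub>C ?h \<beta>)"
    unfolding hw_coeff_def rot_subst_power [OF ij] a ..
  finally have "right_linear (\<lambda>\<alpha>. op_monomial (eta_comp (torus_elt t)) \<alpha> (\<lambda>_. 1)) (pol ?h)
      = pol (\<lambda>\<beta>. a ^ k *\<^sub>C ?h \<beta>)" .
  then have "L_action (torus_elt t) (pol ?h) = torus_elt t (pol (\<lambda>\<beta>. a ^ k *\<^sub>C ?h \<beta>))"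
    by (simp only: L_action_def)
  also have "\<dots> = pol (lmul (exp (torus_gen t)) (\<lambda>\<beta>. a ^ k *\<^sub>C ?h \<beta>))"
    by (intro torus_elt_pol fin_supp_scaleC h)
  also have "lmul (exp (torus_gen t)) (\<lambda>\<beta>. a ^ k *\<^sub>C ?h \<beta>) = (\<lambda>\<beta>. a ^ k *\<^sub>C lmul (exp (torus_gen t)) ?h \<beta>)"
    by (simp add: lmul_def)
  \<comment> \<open>The exponential passes through all the shifts down to the constant I[1], on
    which it is multiplication by b.\<close>
  also have "\<dots> = (\<lambda>\<beta>. (a ^ k * b) *\<^sub>C ?h \<beta>)"
    by (simp only: hw_coeff_def lmul_funpow_shift2 lmul_delta exp_torus_gen_I_one delta_scaleC funpow_shift2_scaleC
        b_def [symmetric] scaleC_scaleC)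
  finally have L: "L_action (torus_elt t) (pol ?h) = (\<lambda>x. (a ^ k * b) *\<^sub>C pol ?h x)"
    by (simp only: pol_scaleC [OF h] fun_eq_iff simp_thms)
  \<comment> \<open>Splitting off j = 1 joins the spin contribution 1/2 to the k coming from the
    substitution; m \<ge> 2 ensures that this index is present.\<close>
  have "{1..CARD('n) div 2} = insert 1 {2..CARD('n) div 2}" using assms by auto
  then have "b = exp (\<i> / 2 * of_real (t 1) + \<i> / 2 * (\<Sum>j = 2..CARD('n) div 2. of_real (t j)))"
    by (simp add: b_def distrib_left)
  moreover have "a ^ k = exp (\<i> * of_nat k * of_real (t 1))"
    by (simp add: a_def exp_of_nat_mult [symmetric] mult_ac)
  ultimately have "a ^ k * b = exp (\<i> * (of_nat k + 1/2) * of_real (t 1)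
      + \<i> / 2 * (\<Sum>j = 2..CARD('n) div 2. of_real (t j)))"
    by (simp add: exp_add [symmetric] algebra_simps)
  then show "L_action (torus_elt t) (hw_vector k :: 'n dfun) =
        (\<lambda>x. exp (\<i> * (of_nat k + 1/2) * of_real (t 1)
                  + \<i> / 2 * (\<Sum>j = 2..CARD('n) div 2. of_real (t j)))
              *\<^sub>C hw_vector k x)"
    unfolding hw_vector_eq_pol [OF assms] L by simp
qed

end
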